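(* Let $R=[r]\times[s]$, let $x\in\mathbb R^R$, let $k\in\mathbb Z_{\ge0}$, and let $\Omega=\mathrm{RSK}^{-1}\circ\mathrm{Pro}^P\circ\mathrm{RSK}:\mathbb R^R\to\mathbb R^R$. (a) For all $1\le u\le v\le r$, $H_{u,1}^{v,s}(x;k)=H_{u,1}^{v,s}(\Omega(x);k)$. (b) For all $1<u\le v\le s$, $H_{1,u}^{r,v}(x;k)=H_{1,u-1}^{r,v-1}(\Omega(x);k)$.
   Context: **Toggles, RSK, promotion.** $R=[r]\times[s]$ carries the product order, $[n]=\{1,\dots,n\}$; write $p\lessdot q$ for cover relations. For $p\in R$ the toggle $t_p:\mathbb R^R\to\mathbb R^R$ replaces $x_p$ by $\min_{q\gtrdot p}x_q+\max_{q\lessdot p}x_q-x_p$ and fixes all other labels (empty $\max=0$, empty $\min=1$). The transfer map $\phi:\mathbb R^R\to\mathbb R^R$ is the bijection $\phi(x)_p=x_p-\max_{q\lessdot p}x_q$ (empty $\max=0$). For $I\subseteq R$ with $n$ elements and any linear extension $L:I\to[n]$ (order-preserving bijection), $\rho_I=t_{L^{-1}(1)}\circ\cdots\circ t_{L^{-1}(n)}$ (independent of $L$); $\rho_{i,j}=\rho_{[i]\times[j]}$. With $m=\min(r,s)$, $\mathrm{RSK}=\rho^{-1}_{r-m+1,s-m+1}\circ\cdots\circ\rho^{-1}_{r-2,s-2}\circ\rho^{-1}_{r-1,s-1}\circ\phi^{-1}$ (equal to $\phi^{-1}$ if $m=1$). With $F_k=\{(i,j)\in R:i-j=k\}$, $\mathrm{Pro}^P=\rho_{F_{r-s+1}}\circ\cdots\circ\rho_{F_{r-2}}\circ\rho_{F_{r-1}}$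 (identity if $s=1$). **Path statistics.** For $u_1\le u_2$, $v_1\le v_2$ and $0\le k\le\min(u_2-u_1+1,v_2-v_1+1)$, $H_{u_1,v_1}^{u_2,v_2}(x;k)$ is the maximum, over all systems of $k$ pairwise vertex-disjoint lattice paths (steps $(1,0)$ and $(0,1)$) from $(u_1,v_1),\dots,(u_1,v_1+k-1)$ to $(u_2,v_2-k+1),\dots,(u_2,v_2)$, of the sum of the labels $x_{ij}$ of all vertices on the paths; for larger $k$ it is constant, equal to its value at $k=\min(u_2-u_1+1,v_2-v_1+1)$. *)

theory Defs
  imports Complex_Main "HOL-Library.FuncSet" "HOL-Library.Product_Order"
begin

text \<open>
  The order on pairs of naturals is the componentwise one of \<^theory>\<open>HOL-Library.Product_Order\<close>.
  The space \<open>\<real>\<^sup>R\<close> is modelled by the extensional functions on \<open>R\<close>, so that two labelings are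
  equal iff they agree on \<open>R\<close>, and inverse maps are taken with respect to this carrier.
\<close>

definition rect :: "nat \<Rightarrow> nat \<Rightarrow> (nat \<times> nat) set" where
  "rect r s = {1..r} \<times> {1..s}"

definition labelings :: "nat \<Rightarrow> nat \<Rightarrow> (nat \<times> nat \<Rightarrow> real) set" where
  "labelings r s = rect r s \<rightarrow>\<^sub>E UNIV"

definition covered_by :: "nat \<Rightarrow> nat \<Rightarrow> nat \<times> nat \<Rightarrow> nat \<times> nat \<Rightarrow> bool" where
  "covered_by r s p q \<longleftrightarrow>
     p \<in> rect r s \<and> q \<in> rect r s \<and> p < q \<and> \<not> (\<exists>z\<in>rect r s. p < z \<and> z < q)"

definition max_below :: "nat \<Rightarrow> nat \<Rightarrow> (nat \<times> nat \<Rightarrow> real) \<Rightarrow> nat \<times> nat \<Rightarrow> real" where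
  "max_below r s x p =
     (if {q. covered_by r s q p} = {} then 0 else Max (x ` {q. covered_by r s q p}))"

definition min_above :: "nat \<Rightarrow> nat \<Rightarrow> (nat \<times> nat \<Rightarrow> real) \<Rightarrow> nat \<times> nat \<Rightarrow> real" where
  "min_above r s x p =
     (if {q. covered_by r s p q} = {} then 1 else Min (x ` {q. covered_by r s p q}))"

definition toggle ::
  "nat \<Rightarrow> nat \<Rightarrow> nat \<times> nat \<Rightarrow> (nat \<times> nat \<Rightarrow> real) \<Rightarrow> nat \<times> nat \<Rightarrow> real" where
  "toggle r s p x = x(p := min_above r s x p + max_below r s x p - x p)"

definition transfer :: "nat \<Rightarrow> nat \<Rightarrow> (nat \<times> nat \<Rightarrow> real) \<Rightarrow> nat \<times> nat \<Rightarrow> real" where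
  "transfer r s x = (\<lambda>p\<in>rect r s. x p - max_below r s x p)"

definition linear_extension :: "(nat \<times> nat) set \<Rightarrow> (nat \<times> nat \<Rightarrow> nat) \<Rightarrow> bool" where
  "linear_extension I L \<longleftrightarrow>
     bij_betw L I {1..card I} \<and> (\<forall>p\<in>I. \<forall>q\<in>I. p \<le> q \<longrightarrow> L p \<le> L q)"

definition compose_list :: "('a \<Rightarrow> 'a) list \<Rightarrow> 'a \<Rightarrow> 'a" where
  "compose_list fs = foldr (\<circ>) fs id"

text \<open>
  Rowmotion on a subset \<open>I\<close> of the rectangle; the toggles are those of the whole rectangle.
  The composition does not depend on the linear extension, so the choice is immaterial.
\<close>

definition rho_along ::
  "nat \<Rightarrow> nat \<Rightarrow> (nat \<times> nat) set \<Rightarrow> (nat \<times> nat \<Rightarrow> nat) \<Rightarrow>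
   (nat \<times> nat \<Rightarrow> real) \<Rightarrow> nat \<times> nat \<Rightarrow> real" where
  "rho_along r s I L =
     compose_list (map (\<lambda>i. toggle r s (inv_into I L i)) [1..<Suc (card I)])"

definition rho ::
  "nat \<Rightarrow> nat \<Rightarrow> (nat \<times> nat) set \<Rightarrow> (nat \<times> nat \<Rightarrow> real) \<Rightarrow> nat \<times> nat \<Rightarrow> real" where
  "rho r s I = rho_along r s I (SOME L. linear_extension I L)"

text \<open>The list below runs from \<open>d = min r s - 1\<close> (applied last) down to \<open>d = 1\<close> (applied first).\<close>

definition RSK :: "nat \<Rightarrow> nat \<Rightarrow> (nat \<times> nat \<Rightarrow> real) \<Rightarrow> nat \<times> nat \<Rightarrow> real" where
  "RSK r s =
     compose_list (map (\<lambda>d. inv_into (labelings r s) (rho r s (rect (r - d) (s - d))))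
       (rev [1..<min r s]))
     \<circ> inv_into (labelings r s) (transfer r s)"

definition file_set :: "nat \<Rightarrow> nat \<Rightarrow> int \<Rightarrow> (nat \<times> nat) set" where
  "file_set r s k = {(i, j) \<in> rect r s. int i - int j = k}"

definition ProP :: "nat \<Rightarrow> nat \<Rightarrow> (nat \<times> nat \<Rightarrow> real) \<Rightarrow> nat \<times> nat \<Rightarrow> real" where
  "ProP r s = compose_list (map (\<lambda>k. rho r s (file_set r s k)) [int r - int s + 1 .. int r - 1])"

definition Omega :: "nat \<Rightarrow> nat \<Rightarrow> (nat \<times> nat \<Rightarrow> real) \<Rightarrow> nat \<times> nat \<Rightarrow> real" where
  "Omega r s = inv_into (labelings r s) (RSK r s) \<circ> ProP r s \<circ> RSK r s"

definition lattice_step :: "nat \<times> nat \<Rightarrow> nat \<times> nat \<Rightarrow> bool" where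
  "lattice_step p q \<longleftrightarrow> q = (fst p + 1, snd p) \<or> q = (fst p, snd p + 1)"

definition lattice_path :: "nat \<times> nat \<Rightarrow> nat \<times> nat \<Rightarrow> (nat \<times> nat) list \<Rightarrow> bool" where
  "lattice_path p q vs \<longleftrightarrow>
     vs \<noteq> [] \<and> hd vs = p \<and> last vs = q \<and> successively lattice_step vs"

text \<open>
  The \<open>i\<close>-th path (counted from 0) joins the \<open>i\<close>-th start to the \<open>i\<close>-th end;
  the end column \<open>v\<^sub>2 - k + 1 + i\<close> is written so that the subtraction on naturals comes last.
\<close>

definition path_systems ::
  "nat \<Rightarrow> nat \<Rightarrow> nat \<Rightarrow> nat \<Rightarrow> nat \<Rightarrow> (nat \<times> nat) list list set" where
  "path_systems u1 v1 u2 v2 k =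
     {ps. length ps = k \<and>
          (\<forall>i<k. lattice_path (u1, v1 + i) (u2, v2 + 1 + i - k) (ps ! i)) \<and>
          (\<forall>i<k. \<forall>j<k. i \<noteq> j \<longrightarrow> set (ps ! i) \<inter> set (ps ! j) = {})}"

definition H ::
  "nat \<Rightarrow> nat \<Rightarrow> nat \<Rightarrow> nat \<Rightarrow> (nat \<times> nat \<Rightarrow> real) \<Rightarrow> nat \<Rightarrow> real" where
  "H u1 v1 u2 v2 x k =
     Max ((\<lambda>ps. \<Sum>p\<in>(\<Union>vs\<in>set ps. set vs). x p) `
       path_systems u1 v1 u2 v2 (min k (min (u2 + 1 - u1) (v2 + 1 - v1))))"

end

theory Submission
  imports Defs
begin

text \<open>
  For a fixed range of rows write \<open>L u v k\<close> for the statistic \<open>H\<close> on the columns from \<open>u\<close> to \<open>v\<close>.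
  The theorem rests on the tropical form of the Desnanot--Jacobi identity
  \<open>L u (v - 1) k + L (u + 1) v k =
   max (L u v k + L (u + 1) (v - 1) k) (L u v (k + 1) + L (u + 1) (v - 1) (k - 1))\<close>.
  Here \<open>\<ge>\<close> follows by taking minima and maxima of crossing paths. For \<open>\<le>\<close>, superpose two optimal
  systems. The recolourings of the superposition that are again pairs of disjoint systems are
  governed by a perfect matching of the ends of the paths, and flipping one matched pair turns the
  left-hand side into one of the two terms on the right.

  The identity says that the increments \<open>L u v k - L u v (k - 1)\<close> evolve by toggles when \<open>u\<close> grows.
  Applied to \<open>x\<close> with an extra column on the left it gives the local growth rule of RSK, so the
  diagonals of \<open>RSK x\<close> are the increments of the statistics with a path start at \<open>(1, 1)\<close>; applied to
  \<open>x\<close> itself it shows that promotion replaces the increments on columns \<open>1..v\<close> by those on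
  \<open>2..v+1\<close> and leaves the row statistics alone. Since the identity also determines \<open>L (u + 1)\<close> from
  \<open>L u\<close>, all the other intervals follow.
\<close>

text \<open>Minima and maxima join left starts to left ends, so applied to the left-hand side of the
  identity they only give back systems of the same kind. A change of colours along the strands can
  turn a left start into a right end. It is controllable because the two systems share all their
  starting columns and all their final columns except the outermost ones: at a shared column the two
  strands must keep different colours, so only two nodes can be the partner of the end that is
  flipped, and they correspond to the two terms of the maximum. The identity contains no minimum,
  whereas a toggle does; the minimum appears when the identity for \<open>k - 1\<close> is
  subtracted from the one for \<open>k\<close>. Terms that ask for more paths than there are rows or
  columns drop out of the maximum exactly where the lower neighbours are missing at the border of
  the rectangle. RSK is a composition of inverse maps. Its intermediate labelings are therefore
  written down in closed form, and every factor is verified in the direction in which it is a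
  product of toggles.\<close>

section \<open>Path systems as families of strands\<close>

text \<open>
  A path is stored as its column \<open>c t\<close> on the antidiagonal \<open>t = row + column\<close>. Outside the rows
  \<open>u1..u2\<close> it is continued vertically, so that all the paths of a system live at all times;
  truncated subtraction identifies all rows above row 1 with row 0.
\<close>

definition strand :: "nat \<Rightarrow> nat \<Rightarrow> nat \<Rightarrow> nat \<Rightarrow> (nat \<Rightarrow> nat) \<Rightarrow> bool" where
  "strand u1 u2 a b c \<longleftrightarrow> c 0 = a \<and>
     (\<forall>t. c (Suc t) = c t \<or> c (Suc t) = Suc (c t) \<and> u1 \<le> t - c t \<and> t - c t \<le> u2) \<and>
     (\<forall>\<^sub>F t in sequentially. c t = b)"

text \<open>A vertex on a given antidiagonal is determined by its column, so disjointness of paths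
  is a comparison at equal times.\<close>

definition fsys :: "nat \<Rightarrow> nat \<Rightarrow> nat \<Rightarrow> nat \<Rightarrow> nat \<Rightarrow> (nat \<Rightarrow> nat \<Rightarrow> nat) \<Rightarrow> bool" where
  "fsys u1 u2 v1 v2 k p \<longleftrightarrow>
     (\<forall>i<k. strand u1 u2 (v1 + i) (v2 + 1 + i - k) (p i)) \<and>
     (\<forall>i<k. \<forall>j<k. i \<noteq> j \<longrightarrow> (\<forall>t. p i t \<noteq> p j t))"

text \<open>The vertical continuations carry weight 0. Hence every sufficiently long range of times
  gives the weight of the actual path.\<close>

definition cell_wt :: "(nat \<times> nat \<Rightarrow> real) \<Rightarrow> nat \<Rightarrow> nat \<Rightarrow> nat \<Rightarrow> nat \<Rightarrow> real" where
  "cell_wt x u1 u2 t c = (if u1 \<le> t - c \<and> t - c \<le> u2 then x (t - c, c) else 0)"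

definition sys_wt ::
  "(nat \<times> nat \<Rightarrow> real) \<Rightarrow> nat \<Rightarrow> nat \<Rightarrow> nat \<Rightarrow> nat \<Rightarrow> (nat \<Rightarrow> nat \<Rightarrow> nat) \<Rightarrow> real" where
  "sys_wt x u1 u2 T k p = (\<Sum>t<T. \<Sum>i<k. cell_wt x u1 u2 t (p i t))"

definition cells :: "nat \<Rightarrow> nat \<Rightarrow> nat \<Rightarrow> nat \<Rightarrow> (nat \<Rightarrow> nat) \<Rightarrow> (nat \<times> nat) list" where
  "cells u1 u2 a b c = map (\<lambda>t. (t - c t, c t)) [u1 + a..<Suc (u2 + b)]"

section \<open>Strands: monotonicity, boundary columns and the time spent inside the rows\<close>

lemma strand_step:
  assumes "strand u1 u2 a b c"
  shows "c (Suc t) = c t \<or> c (Suc t) = Suc (c t) \<and> u1 \<le> t - c t \<and> t - c t \<le> u2"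
  using assms by (auto simp: strand_def)

lemma strand_0: "strand u1 u2 a b c \<Longrightarrow> c 0 = a"
  by (auto simp: strand_def)

lemma strand_mono:
  assumes "strand u1 u2 a b c" "s \<le> t"
  shows "c s \<le> c t"
  using assms(2)
proof (induction t rule: dec_induct)
  case (step n)
  then show ?case using strand_step[OF assms(1), of n] by auto
qed simp

lemma strand_eventually:
  assumes "strand u1 u2 a b c"
  obtains T where "\<And>t. t \<ge> T \<Longrightarrow> c t = b"
  using assms by (auto simp: strand_def eventually_sequentially)

lemma strand_bounds:
  assumes "strand u1 u2 a b c"
  shows "a \<le> c t" "c t \<le> b"
proof -
  show "a \<le> c t" using strand_mono[OF assms, of 0 t] strand_0[OF assms] by simp
  obtain T where T: "\<And>t. t \<ge> T \<Longrightarrow> c t = b" using strand_eventually[OF assms] by blast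
  show "c t \<le> b" using T[of "max t T"] strand_mono[OF assms, of t "max t T"] by simp
qed

lemma strand_start:
  assumes "strand u1 u2 a b c" "1 \<le> u1" "t \<le> u1 + a"
  shows "c t = a"
  using assms(3)
proof (induction t)
  case 0
  then show ?case using strand_0[OF assms(1)] by simp
next
  case (Suc t)
  then show ?case using strand_step[OF assms(1), of t] assms(2) by auto
qed

text \<open>Below row \<open>u2\<close> only vertical steps are left, so the column already has its
  final value.\<close>

lemma strand_frozen:
  assumes "strand u1 u2 a b c" "u2 < t - c t"
  shows "c t = b"
proof -
  obtain T where T: "\<And>t. t \<ge> T \<Longrightarrow> c t = b" using strand_eventually[OF assms(1)] by blast
  have "c s = c t" if "t \<le> s" for s
    using that
  proof (induction s rule: dec_induct)
    case (step n)
    then show ?case using strand_step[OF assms(1), of n] assms(2) by auto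
  qed simp
  from this[of "max t T"] T[of "max t T"] show ?thesis by simp
qed

lemma strand_end:
  assumes "strand u1 u2 a b c" "u2 + b \<le> t"
  shows "c t = b"
proof (rule ccontr)
  assume *: "c t \<noteq> b"
  with strand_bounds[OF assms(1), of t] have "c t < b" by simp
  then have "u2 < t - c t" using assms(2) by simp
  from strand_frozen[OF assms(1) this] * show False by simp
qed

text \<open>From time \<open>u1 + a\<close> on the subtraction \<open>t - c t\<close> is not
  truncated, so row and column together recover the time. This makes the map from times to cells
  injective.\<close>

lemma strand_row:
  assumes "strand u1 u2 a b c" "1 \<le> u1" "u1 + a \<le> t"
  shows "c t \<le> t" "u1 \<le> t - c t"
proof -
  have "c t \<le> t \<and> u1 \<le> t - c t"
    using assms(3)
  proof (induction t rule: dec_induct)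
    case base
    then show ?case using strand_start[OF assms(1,2), of "u1 + a"] by simp
  next
    case (step n)
    then show ?case using strand_step[OF assms(1), of n] assms(2) by auto
  qed
  then show "c t \<le> t" "u1 \<le> t - c t" by auto
qed

lemma strand_in_rows:
  assumes "strand u1 u2 a b c" "1 \<le> u1"
  shows "u1 \<le> t - c t \<and> t - c t \<le> u2 \<longleftrightarrow> u1 + a \<le> t \<and> t \<le> u2 + b"
proof (intro iffI conjI; elim conjE)
  assume *: "u1 \<le> t - c t" "t - c t \<le> u2"
  show "u1 + a \<le> t"
    using strand_start[OF assms, of t] * assms(2) by (cases "t \<le> u1 + a") auto
  show "t \<le> u2 + b"
    using strand_end[OF assms(1), of t] * by (cases "u2 + b \<le> t") auto
next
  assume *: "u1 + a \<le> t" "t \<le> u2 + b"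
  then show "u1 \<le> t - c t" using strand_row[OF assms] by simp
  show "t - c t \<le> u2"
    using strand_frozen[OF assms(1), of t] * by (cases "t - c t \<le> u2") auto
qed

lemma strand_rows_le:
  assumes "strand u1 u2 a b c" "1 \<le> u1" "u1 \<le> u2"
  shows "u1 + a \<le> u2 + b"
  using strand_bounds[OF assms(1), of 0] assms(3) by simp

section \<open>Correspondence between strands and lattice paths\<close>

lemma set_cells:
  "set (cells u1 u2 a b c) = (\<lambda>t. (t - c t, c t)) ` {u1 + a..u2 + b}"
  by (auto simp: cells_def)

lemma cells_path:
  assumes "strand u1 u2 a b c" "1 \<le> u1" "u1 \<le> u2"
  shows "lattice_path (u1, a) (u2, b) (cells u1 u2 a b c)"
proof -
  note le = strand_rows_le[OF assms]
  have len: "length (cells u1 u2 a b c) = Suc (u2 + b) - (u1 + a)"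
    using le by (simp add: cells_def Suc_diff_le)
  have ne: "cells u1 u2 a b c \<noteq> []" using le len by auto
  have hd: "hd (cells u1 u2 a b c) = (u1, a)"
    using le strand_start[OF assms(1,2), of "u1 + a"] ne
    by (simp add: cells_def hd_map upt_conv_Cons del: upt_Suc)
  have last: "last (cells u1 u2 a b c) = (u2, b)"
    using le strand_end[OF assms(1), of "u2 + b"] ne
    by (simp add: cells_def last_map)
  have "successively lattice_step (cells u1 u2 a b c)"
    unfolding successively_conv_nth
  proof (intro allI impI)
    fix i assume "Suc i < length (cells u1 u2 a b c)"
    then have i: "Suc i < Suc (u2 + b) - (u1 + a)" by (simp add: len)
    define t where "t = u1 + a + i"
    have "cells u1 u2 a b c ! i = (t - c t, c t)" 
      "cells u1 u2 a b c ! Suc i = (Suc t - c (Suc t), c (Suc t))"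
      using i by (simp_all add: cells_def t_def del: upt_Suc)
    moreover have "c t \<le> t" using strand_row[OF assms(1,2), of t] by (simp add: t_def)
    ultimately show "lattice_step (cells u1 u2 a b c ! i) (cells u1 u2 a b c ! Suc i)"
      using strand_step[OF assms(1), of t] by (auto simp: lattice_step_def)
  qed
  with ne hd last show ?thesis by (simp add: lattice_path_def)
qed

lemma lattice_path_nth_sum:
  assumes "lattice_path p q vs" "n < length vs"
  shows "fst (vs ! n) + snd (vs ! n) = fst p + snd p + n"
  using assms(2)
proof (induction n)
  case 0
  then show ?case using assms(1) by (auto simp: lattice_path_def hd_conv_nth)
next
  case (Suc n)
  have "lattice_step (vs ! n) (vs ! Suc n)"
    using assms(1) Suc.prems by (auto simp: lattice_path_def successively_conv_nth)
  then show ?case using Suc by (auto simp: lattice_step_def)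
qed

lemma lattice_path_length:
  assumes "lattice_path p q vs"
  shows "fst p + snd p + length vs = Suc (fst q + snd q)"
proof -
  have "vs \<noteq> []" "last vs = q" using assms by (auto simp: lattice_path_def)
  then show ?thesis
    using lattice_path_nth_sum[OF assms, of "length vs - 1"] by (simp add: last_conv_nth)
qed

lemma lattice_path_nth_mono:
  assumes "lattice_path p q vs" "m \<le> n" "n < length vs"
  shows "fst (vs ! m) \<le> fst (vs ! n)" "snd (vs ! m) \<le> snd (vs ! n)"
proof -
  have "fst (vs ! m) \<le> fst (vs ! n) \<and> snd (vs ! m) \<le> snd (vs ! n)"
    using assms(2,3)
  proof (induction n rule: dec_induct)
    case (step n)
    have "lattice_step (vs ! n) (vs ! Suc n)"
      using assms(1) step.prems by (auto simp: lattice_path_def successively_conv_nth)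
    then show ?case using step by (auto simp: lattice_step_def)
  qed simp
  then show "fst (vs ! m) \<le> fst (vs ! n)" "snd (vs ! m) \<le> snd (vs ! n)" by auto
qed

lemma lattice_path_cells:
  assumes "lattice_path (u1, a) (u2, b) vs" "1 \<le> u1"
  obtains c where "strand u1 u2 a b c" "cells u1 u2 a b c = vs"
proof
  define N where "N = length vs - 1"
  \<comment> \<open>Clamping the index at both ends of the list freezes the column before the path
    starts and after it ends.\<close>
  define c where "c = (\<lambda>t. snd (vs ! min (t - (u1 + a)) N))"
  have ne: "vs \<noteq> []" and hd: "hd vs = (u1, a)" and last: "last vs = (u2, b)"
    using assms by (auto simp: lattice_path_def)
  have len: "length vs = Suc N" using ne by (simp add: N_def)
  have sum: "u1 + a + N = u2 + b" using lattice_path_length[OF assms(1)] len by simp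
  have v0: "vs ! 0 = (u1, a)" using hd ne by (simp add: hd_conv_nth)
  have vN: "vs ! N = (u2, b)" using last ne by (simp add: last_conv_nth N_def)
  show "strand u1 u2 a b c"
    unfolding strand_def
  proof (intro conjI allI)
    show "c 0 = a" using v0 by (simp add: c_def)
    have "c t = b" if "t \<ge> u2 + b" for t
    proof -
      have "min (t - (u1 + a)) N = N" using that sum by linarith
      then show ?thesis using vN by (simp add: c_def)
    qed
    then show "\<forall>\<^sub>F t in sequentially. c t = b"
      unfolding eventually_sequentially by blast
    fix t
    consider "t < u1 + a" | n where "t = u1 + a + n" "n < N" | "t \<ge> u1 + a + N"
      by (metis add_less_cancel_left le_Suc_ex linorder_not_less)
    then show "c (Suc t) = c t \<or> c (Suc t) = Suc (c t) \<and> u1 \<le> t - c t \<and> t - c t \<le> u2"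
    proof cases
      case 1
      then show ?thesis by (simp add: c_def)
    next
      case 2
      have *: "c t = snd (vs ! n)" "c (Suc t) = snd (vs ! Suc n)"
        using 2 by (simp_all add: c_def Suc_diff_le)
      have "lattice_step (vs ! n) (vs ! Suc n)"
        using assms(1) 2 len by (auto simp: lattice_path_def successively_conv_nth)
      moreover have "t = fst (vs ! n) + snd (vs ! n)"
        using lattice_path_nth_sum[OF assms(1), of n] 2 len by simp
      moreover have "u1 \<le> fst (vs ! n)"
        using lattice_path_nth_mono(1)[OF assms(1), of 0 n] 2 len v0 by simp
      moreover have "fst (vs ! n) \<le> u2"
        using lattice_path_nth_mono(1)[OF assms(1), of n N] 2 len vN by simp
      ultimately show ?thesis using * by (auto simp: lattice_step_def)
    next
      case 3
      then show ?thesis by (simp add: c_def)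
    qed
  qed
  show "cells u1 u2 a b c = vs"
  proof (rule nth_equalityI)
    show "length (cells u1 u2 a b c) = length vs"
      using sum len by (simp add: cells_def)
    fix i assume "i < length (cells u1 u2 a b c)"
    then have i: "i \<le> N" using sum by (simp add: cells_def)
    have "u1 + a + i < Suc (u2 + b)" using i sum by linarith
    then have "[u1 + a..<Suc (u2 + b)] ! i = u1 + a + i" "i < length [u1 + a..<Suc (u2 + b)]"
      by (rule nth_upt) (use i sum in simp)
    then have "cells u1 u2 a b c ! i = (u1 + a + i - c (u1 + a + i), c (u1 + a + i))"
      by (simp only: cells_def nth_map)
    moreover have "c (u1 + a + i) = snd (vs ! i)" using i by (simp add: c_def min_def)
    moreover have "u1 + a + i = fst (vs ! i) + snd (vs ! i)"
      using lattice_path_nth_sum[OF assms(1), of i] i len by simp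
    ultimately show "cells u1 u2 a b c ! i = vs ! i" by simp
  qed
qed

lemma sum_cells:
  assumes "strand u1 u2 a b c" "1 \<le> u1" "u2 + b < T"
  shows "(\<Sum>p\<in>set (cells u1 u2 a b c). x p) = (\<Sum>t<T. cell_wt x u1 u2 t (c t))"
proof -
  have inj: "inj_on (\<lambda>t. (t - c t, c t)) {u1 + a..u2 + b}"
  proof (rule inj_onI)
    fix s t
    assume st: "s \<in> {u1 + a..u2 + b}" "t \<in> {u1 + a..u2 + b}" "(s - c s, c s) = (t - c t, c t)"
    then have "c s \<le> s" "c t \<le> t"
      using strand_row(1)[OF assms(1,2)] by (meson atLeastAtMost_iff)+
    moreover have "s - c s = t - c t" "c s = c t" using st(3) by (meson prod.inject)+
    ultimately show "s = t" by linarith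
  qed
  have "(\<Sum>p\<in>set (cells u1 u2 a b c). x p) = (\<Sum>t\<in>{u1 + a..u2 + b}. x (t - c t, c t))"
    unfolding set_cells sum.reindex[OF inj] by (simp only: comp_def)
  also have "\<dots> = (\<Sum>t\<in>{t\<in>{..<T}. u1 \<le> t - c t \<and> t - c t \<le> u2}. x (t - c t, c t))"
  proof (rule sum.cong)
    show "{u1 + a..u2 + b} = {t \<in> {..<T}. u1 \<le> t - c t \<and> t - c t \<le> u2}"
      unfolding strand_in_rows[OF assms(1,2)] using assms(3) by auto
  qed simp
  also have "\<dots> = (\<Sum>t<T. cell_wt x u1 u2 t (c t))"
    unfolding cell_wt_def by (rule sum.inter_filter) simp
  finally show ?thesis .
qed

text \<open>The vertical continuations create no new intersections: a meeting above row
  \<open>u1\<close> would force equal starting columns, one below row \<open>u2\<close> equal final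
  columns.\<close>

lemma cells_disjoint_iff:
  assumes "strand u1 u2 a b c" "strand u1 u2 a' b' c'" "1 \<le> u1" "a \<noteq> a'" "b \<noteq> b'"
  shows "set (cells u1 u2 a b c) \<inter> set (cells u1 u2 a' b' c') = {} \<longleftrightarrow> (\<forall>t. c t \<noteq> c' t)"
proof
  assume disj: "set (cells u1 u2 a b c) \<inter> set (cells u1 u2 a' b' c') = {}"
  show "\<forall>t. c t \<noteq> c' t"
  proof (rule allI, rule notI)
    fix t assume eq: "c t = c' t"
    consider "t - c t < u1" | "u2 < t - c t" | "u1 \<le> t - c t \<and> t - c t \<le> u2" by linarith
    then show False
    proof cases
      case 1
      then have "t \<le> u1 + a" "t \<le> u1 + a'"
        using strand_row[OF assms(1,3), of t] strand_row[OF assms(2,3), of t] eq by linarith+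
      then show False
        using strand_start[OF assms(1,3)] strand_start[OF assms(2,3)] eq assms(4) by simp
    next
      case 2
      then show False
        using strand_frozen[OF assms(1), of t] strand_frozen[OF assms(2), of t] eq assms(5) by simp
    next
      case 3
      then have "u1 + a \<le> t \<and> t \<le> u2 + b" "u1 + a' \<le> t \<and> t \<le> u2 + b'"
        using strand_in_rows[OF assms(1,3), of t] strand_in_rows[OF assms(2,3), of t] eq by auto
      then have "(t - c t, c t) \<in> set (cells u1 u2 a b c)"
        "(t - c' t, c' t) \<in> set (cells u1 u2 a' b' c')"
        unfolding set_cells by (intro image_eqI[where x = t]; simp)+
      then show False using disj eq by (metis disjoint_iff)
    qed
  qed
next
  assume *: "\<forall>t. c t \<noteq> c' t"
  show "set (cells u1 u2 a b c) \<inter> set (cells u1 u2 a' b' c') = {}"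
  proof (rule ccontr)
    assume "set (cells u1 u2 a b c) \<inter> set (cells u1 u2 a' b' c') \<noteq> {}"
    then obtain q where "q \<in> set (cells u1 u2 a b c)" "q \<in> set (cells u1 u2 a' b' c')"
      by blast
    then obtain s t where "s \<in> {u1 + a..u2 + b}" "t \<in> {u1 + a'..u2 + b'}"
      "q = (s - c s, c s)" "q = (t - c' t, c' t)"
      unfolding set_cells image_iff by blast
    then have st: "s \<ge> u1 + a" "t \<ge> u1 + a'" "s - c s = t - c' t" "c s = c' t"
      by (meson atLeastAtMost_iff prod.inject)+
    then have "c s \<le> s" "c' t \<le> t"
      using strand_row(1)[OF assms(1,3)] strand_row(1)[OF assms(2,3)] by blast+
    then have "s = t" using st(3,4) by linarith
    then show False using * st(4) by blast
  qed
qed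

text \<open>The bound \<open>k \<le> Suc v2\<close> keeps the truncated differences
  \<open>v2 + 1 + i - k\<close> distinct, so that \<open>cells_disjoint_iff\<close> applies.\<close>

lemma fsys_cells:
  assumes p: "fsys u1 u2 v1 v2 k p" and "1 \<le> u1" "u1 \<le> u2" "k \<le> Suc v2" "u2 + v2 < T"
  defines "ps \<equiv> map (\<lambda>i. cells u1 u2 (v1 + i) (v2 + 1 + i - k) (p i)) [0..<k]"
  shows "ps \<in> path_systems u1 v1 u2 v2 k"
    and "(\<Sum>p\<in>(\<Union>vs\<in>set ps. set vs). x p) = sys_wt x u1 u2 T k p"
proof -
  have st: "strand u1 u2 (v1 + i) (v2 + 1 + i - k) (p i)" if "i < k" for i
    using p that by (auto simp: fsys_def)
  have disj: "set (ps ! i) \<inter> set (ps ! j) = {}" if "i < k" "j < k" "i \<noteq> j" for i j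
    using cells_disjoint_iff[OF st st \<open>1 \<le> u1\<close>, of i j] that p \<open>k \<le> Suc v2\<close>
    by (auto simp: ps_def fsys_def)
  show "ps \<in> path_systems u1 v1 u2 v2 k"
    unfolding path_systems_def using disj cells_path[OF st \<open>1 \<le> u1\<close> \<open>u1 \<le> u2\<close>]
    by (auto simp: ps_def)
  have "(\<Union>vs\<in>set ps. set vs) = (\<Union>i\<in>{..<k}. set (ps ! i))"
    by (auto simp: ps_def)
  then have "(\<Sum>p\<in>(\<Union>vs\<in>set ps. set vs). x p) = (\<Sum>i<k. \<Sum>p\<in>set (ps ! i). x p)"
    using disj by (simp add: sum.UNION_disjoint)
  also have "\<dots> = (\<Sum>i<k. \<Sum>t<T. cell_wt x u1 u2 t (p i t))"
  proof (rule sum.cong)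
    fix i assume "i \<in> {..<k}"
    then have i: "i < k" by simp
    then have "u2 + (v2 + 1 + i - k) < T" using assms(4,5) by simp
    from sum_cells[OF st[OF i] \<open>1 \<le> u1\<close> this] i
    show "(\<Sum>p\<in>set (ps ! i). x p) = (\<Sum>t<T. cell_wt x u1 u2 t (p i t))" by (simp add: ps_def)
  qed simp
  also have "\<dots> = sys_wt x u1 u2 T k p"
    unfolding sys_wt_def by (rule sum.swap)
  finally show "(\<Sum>p\<in>(\<Union>vs\<in>set ps. set vs). x p) = sys_wt x u1 u2 T k p" .
qed

lemma path_systems_fsys:
  assumes ps: "ps \<in> path_systems u1 v1 u2 v2 k" and "1 \<le> u1" "k \<le> Suc v2"
  obtains p where "fsys u1 u2 v1 v2 k p"
    "ps = map (\<lambda>i. cells u1 u2 (v1 + i) (v2 + 1 + i - k) (p i)) [0..<k]"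
proof -
  have "\<forall>i<k. \<exists>c. strand u1 u2 (v1 + i) (v2 + 1 + i - k) c \<and>
      cells u1 u2 (v1 + i) (v2 + 1 + i - k) c = ps ! i"
    using ps \<open>1 \<le> u1\<close> unfolding path_systems_def by (blast elim: lattice_path_cells)
  then obtain p where p: "\<And>i. i < k \<Longrightarrow> strand u1 u2 (v1 + i) (v2 + 1 + i - k) (p i)"
      "\<And>i. i < k \<Longrightarrow> cells u1 u2 (v1 + i) (v2 + 1 + i - k) (p i) = ps ! i"
    by metis
  have disj: "set (ps ! i) \<inter> set (ps ! j) = {}" if "i < k" "j < k" "i \<noteq> j" for i j
    using ps that by (auto simp: path_systems_def)
  have "\<forall>t. p i t \<noteq> p j t" if "i < k" "j < k" "i \<noteq> j" for i j
    using cells_disjoint_iff[OF p(1) p(1) \<open>1 \<le> u1\<close>, of i j] disj[OF that] p(2) that \<open>k \<le> Suc v2\<close>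
    by auto
  then have "fsys u1 u2 v1 v2 k p" unfolding fsys_def using p by blast
  moreover have "ps = map (\<lambda>i. cells u1 u2 (v1 + i) (v2 + 1 + i - k) (p i)) [0..<k]"
    by (rule nth_equalityI) (use ps p(2) in \<open>auto simp: path_systems_def\<close>)
  ultimately show ?thesis using that by blast
qed

section \<open>Existence of path systems and of optimal ones\<close>

lemma finite_path_systems: "finite (path_systems u1 v1 u2 v2 k)"
proof -
  define A where "A = {vs. set vs \<subseteq> {..u2} \<times> {..v2 + k} \<and> length vs \<le> Suc (u2 + v2 + k)}"
  have "finite A" unfolding A_def by (intro finite_lists_length_le) auto
  have *: "vs \<in> A" if "lattice_path (u1, a) (u2, b) vs" "b \<le> v2 + k" for vs a b
  proof -
    have "length vs \<le> Suc (u2 + v2 + k)" using lattice_path_length[OF that(1)] that(2) by simp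
    moreover have "set vs \<subseteq> {..u2} \<times> {..v2 + k}"
    proof
      fix p assume "p \<in> set vs"
      then obtain n where n: "n < length vs" "p = vs ! n" by (auto simp: in_set_conv_nth)
      have "last vs = (u2, b)" "vs \<noteq> []" using that by (auto simp: lattice_path_def)
      then have "fst p \<le> u2" "snd p \<le> b"
        using lattice_path_nth_mono[OF that(1), of n "length vs - 1"] n by (auto simp: last_conv_nth)
      then show "p \<in> {..u2} \<times> {..v2 + k}" using that(2) by (cases p) auto
    qed
    ultimately show ?thesis by (simp add: A_def)
  qed
  have "path_systems u1 v1 u2 v2 k \<subseteq> {ps. set ps \<subseteq> A \<and> length ps = k}"
  proof (rule subsetI, rule CollectI, rule conjI[rotated])
    fix ps assume ps: "ps \<in> path_systems u1 v1 u2 v2 k"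
    show "length ps = k" using ps by (simp add: path_systems_def)
    show "set ps \<subseteq> A"
    proof
      fix vs assume "vs \<in> set ps"
      then obtain i where i: "i < k" "vs = ps ! i"
        using ps by (auto simp: in_set_conv_nth path_systems_def)
      then have "lattice_path (u1, v1 + i) (u2, v2 + 1 + i - k) vs"
        using ps by (auto simp: path_systems_def)
      then show "vs \<in> A" by (rule *) (use i in simp)
    qed
  qed
  then show ?thesis
    by (rule finite_subset) (use finite_lists_length_eq[OF \<open>finite A\<close>] in simp)
qed

lemma fsys_exists:
  assumes "1 \<le> u1" "k \<le> u2 + 1 - u1" "k \<le> v2 + 1 - v1"
  obtains p where "fsys u1 u2 v1 v2 k p"
proof (cases "k = 0")
  case True
  then show ?thesis using that[of "\<lambda>i t. 0"] by (simp add: fsys_def)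
next
  case False
  \<comment> \<open>All strands are translates of one another: strand \<open>i\<close> descends to
    row \<open>R - i\<close>, runs along that row and descends again. The rows used are exactly
    \<open>u1..R\<close>, which is where the bound on \<open>k\<close> by the number of rows
    enters.\<close>
  define R where "R = u1 + k - 1"
  define p where "p = (\<lambda>i t. i + max v1 (min (v2 + 1 - k) (t - R)))"
  have "strand u1 u2 (v1 + i) (v2 + 1 + i - k) (p i)" if "i < k" for i
    unfolding strand_def
  proof (intro conjI allI)
    show "p i 0 = v1 + i" by (simp add: p_def)
    have "p i t = v2 + 1 + i - k" if "t \<ge> R + v2 + 1" for t
      using that False assms \<open>i < k\<close> by (simp add: p_def)
    then show "\<forall>\<^sub>F t in sequentially. p i t = v2 + 1 + i - k"
      unfolding eventually_sequentially by blast
    fix t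
    have "t - R < v1 \<or> v1 \<le> t - R \<and> t - R < v2 + 1 - k \<or> v2 + 1 - k \<le> t - R" by linarith
    then show "p i (Suc t) = p i t \<or> p i (Suc t) = Suc (p i t) \<and> u1 \<le> t - p i t \<and> t - p i t \<le> u2"
    proof (elim disjE)
      assume "t - R < v1"
      then show ?thesis by (auto simp: p_def)
    next
      assume *: "v1 \<le> t - R \<and> t - R < v2 + 1 - k"
      show ?thesis
      proof (cases "R \<le> t")
        case True
        then show ?thesis using * assms that False by (auto simp: p_def R_def Suc_diff_le)
      next
        case False
        then show ?thesis by (auto simp: p_def)
      qed
    next
      assume "v2 + 1 - k \<le> t - R"
      then show ?thesis by (auto simp: p_def)
    qed
  qed
  then have "fsys u1 u2 v1 v2 k p" by (auto simp: fsys_def p_def)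
  then show ?thesis using that by blast
qed

lemma H_upper:
  assumes "fsys u1 u2 v1 v2 k p" "1 \<le> u1" "u1 \<le> u2" "k \<le> u2 + 1 - u1" "k \<le> v2 + 1 - v1"
    "u2 + v2 < T"
  shows "sys_wt x u1 u2 T k p \<le> H u1 v1 u2 v2 x k"
proof -
  have k: "min k (min (u2 + 1 - u1) (v2 + 1 - v1)) = k" using assms by auto
  have "k \<le> Suc v2" using assms by simp
  from fsys_cells[OF assms(1-3) this assms(6)]
  show ?thesis unfolding H_def k
    by (intro Max_ge finite_imageI finite_path_systems) (auto intro!: image_eqI)
qed

lemma H_attained:
  assumes "1 \<le> u1" "u1 \<le> u2" "k \<le> u2 + 1 - u1" "k \<le> v2 + 1 - v1" "u2 + v2 < T"
  obtains p where "fsys u1 u2 v1 v2 k p" "H u1 v1 u2 v2 x k = sys_wt x u1 u2 T k p"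
proof -
  have k: "min k (min (u2 + 1 - u1) (v2 + 1 - v1)) = k" using assms by auto
  have k': "k \<le> Suc v2" using assms by simp
  obtain p where "fsys u1 u2 v1 v2 k p" using fsys_exists assms by blast
  from fsys_cells(1)[OF this assms(1,2) k' assms(5)] have "path_systems u1 v1 u2 v2 k \<noteq> {}" by auto
  then have "H u1 v1 u2 v2 x k \<in>
      (\<lambda>ps. \<Sum>p\<in>(\<Union>vs\<in>set ps. set vs). x p) ` path_systems u1 v1 u2 v2 k"
    unfolding H_def k by (intro Max_in finite_imageI finite_path_systems) simp
  then obtain ps where ps: "ps \<in> path_systems u1 v1 u2 v2 k"
      "H u1 v1 u2 v2 x k = (\<Sum>p\<in>(\<Union>vs\<in>set ps. set vs). x p)" by auto
  obtain p where p: "fsys u1 u2 v1 v2 k p"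
      "ps = map (\<lambda>i. cells u1 u2 (v1 + i) (v2 + 1 + i - k) (p i)) [0..<k]"
    using path_systems_fsys[OF ps(1) assms(1) k'] by blast
  show ?thesis using that[OF p(1)] fsys_cells(2)[OF p(1) assms(1,2) k' assms(5)] ps(2) p(2) by simp
qed

section \<open>Recolouring the union of two path systems\<close>

text \<open>
  Node \<open>(False, i)\<close> is the start and \<open>(True, i)\<close> the current end of strand \<open>i\<close>. Colours are negated at
  the ends, so that paired nodes always carry opposite values: joined start and end have the
  same colour, joined starts or joined ends have different ones. When the strands \<open>a\<close> and \<open>b\<close>
  touch, their ends are paired with each other and so are their former partners.
\<close>

definition nodes :: "nat \<Rightarrow> (bool \<times> nat) set" where
  "nodes n = UNIV \<times> {..<n}"

definition pairing :: "nat \<Rightarrow> (bool \<times> nat \<Rightarrow> bool \<times> nat) \<Rightarrow> bool" where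
  "pairing n m \<longleftrightarrow> (\<forall>v\<in>nodes n. m v \<in> nodes n \<and> m (m v) = v \<and> m v \<noteq> v)"

definition alternates :: "nat \<Rightarrow> (bool \<times> nat \<Rightarrow> bool \<times> nat) \<Rightarrow> (bool \<times> nat \<Rightarrow> bool) \<Rightarrow> bool" where
  "alternates n m \<chi> \<longleftrightarrow> (\<forall>v\<in>nodes n. \<chi> (m v) = (\<not> \<chi> v))"

definition charge :: "(nat \<Rightarrow> bool) \<Rightarrow> bool \<times> nat \<Rightarrow> bool" where
  "charge col v = (if fst v then \<not> col (snd v) else col (snd v))"

text \<open>\<open>R\<close> relates the colours at the starts to the colours at the current ends.
  The matching is a source of recolourings: every assignment that alternates along it is realised by
  \<open>R\<close>.\<close>

definition represents ::
  "nat \<Rightarrow> (bool \<times> nat \<Rightarrow> bool \<times> nat) \<Rightarrow> ((nat \<Rightarrow> bool) \<Rightarrow> (nat \<Rightarrow> bool) \<Rightarrow> bool) \<Rightarrow> bool" where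
  "represents n m R \<longleftrightarrow>
     (\<forall>\<chi>. alternates n m \<chi> \<longrightarrow> R (\<lambda>i. \<chi> (False, i)) (\<lambda>i. \<not> \<chi> (True, i)))"

definition touch ::
  "nat \<times> nat \<Rightarrow> ((nat \<Rightarrow> bool) \<Rightarrow> (nat \<Rightarrow> bool) \<Rightarrow> bool) \<Rightarrow> (nat \<Rightarrow> bool) \<Rightarrow> (nat \<Rightarrow> bool) \<Rightarrow> bool" where
  "touch ab R s w' \<longleftrightarrow> (\<exists>w. R s w \<and> w (fst ab) \<noteq> w (snd ab) \<and> w' (fst ab) \<noteq> w' (snd ab) \<and>
     (\<forall>i. i \<noteq> fst ab \<longrightarrow> i \<noteq> snd ab \<longrightarrow> w' i = w i))"

lemma pairing_touch:
  assumes m: "pairing n m" "alternates n m (charge col)" "represents n m R"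
    and ab: "a < n" "b < n" "a \<noteq> b" "col a \<noteq> col b"
  obtains m' where "pairing n m'" "alternates n m' (charge col)" "represents n m' (touch (a, b) R)"
proof -
  define A B where "A = (True, a)" and "B = (True, b)"
  define c d where "c = m A" and "d = m B"
  have AB: "A \<in> nodes n" "B \<in> nodes n" "A \<noteq> B" using ab by (auto simp: A_def B_def nodes_def)
  have cd: "c \<in> nodes n" "d \<in> nodes n" "m c = A" "m d = B" "c \<noteq> A" "d \<noteq> B"
    using m(1) AB unfolding c_def d_def pairing_def by blast+
  have ch: "charge col A \<noteq> charge col B" using ab by (simp add: charge_def A_def B_def)
  show ?thesis
  proof (cases "c = B")
    case True
    \<comment> \<open>The two ends are already partners, so the matching stays as it is and the
      colours pass straight through the vertex.\<close>
    have "represents n m (touch (a, b) R)"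
      unfolding represents_def
    proof (intro allI impI)
      fix \<chi> assume \<chi>: "alternates n m \<chi>"
      then have "\<chi> B = (\<not> \<chi> A)" using AB(1) True unfolding alternates_def c_def by metis
      moreover have "R (\<lambda>i. \<chi> (False, i)) (\<lambda>i. \<not> \<chi> (True, i))"
        using m(3) \<chi> by (auto simp: represents_def)
      ultimately show "touch (a, b) R (\<lambda>i. \<chi> (False, i)) (\<lambda>i. \<not> \<chi> (True, i))"
        unfolding touch_def by (intro exI[of _ "\<lambda>i. \<not> \<chi> (True, i)"]) (auto simp: A_def B_def)
    qed
    then show ?thesis using that m by blast
  next
    case False
    have "c \<noteq> d" using cd AB by metis
    have "d \<noteq> A" using cd(4) False unfolding c_def by metis
    define m' where "m' = m(A := B, B := A, c := d, d := c)"
    have m'_other: "m' v = m v" "m v \<notin> {A, B, c, d}"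
      if "v \<in> nodes n" "v \<noteq> A" "v \<noteq> B" "v \<noteq> c" "v \<noteq> d" for v
    proof -
      show "m' v = m v" using that by (simp add: m'_def)
      show "m v \<notin> {A, B, c, d}"
        using that m(1) cd by (metis c_def d_def insertE empty_iff pairing_def)
    qed
    have m'_val: "m' A = B" "m' B = A" "m' c = d" "m' d = c"
      using \<open>c \<noteq> d\<close> \<open>d \<noteq> A\<close> False cd(5,6) AB(3) unfolding m'_def by simp_all
    have "pairing n m'"
      unfolding pairing_def
    proof (intro ballI)
      fix v assume v: "v \<in> nodes n"
      show "m' v \<in> nodes n \<and> m' (m' v) = v \<and> m' v \<noteq> v"
      proof (cases "v \<in> {A, B, c, d}")
        case True
        then show ?thesis using m'_val AB cd \<open>c \<noteq> d\<close> by (elim insertE emptyE) simp_all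
      next
        case False
        then have *: "m' v = m v" "m v \<notin> {A, B, c, d}" using m'_other[OF v] by blast+
        have mv: "m v \<in> nodes n" "m (m v) = v" "m v \<noteq> v"
          using m(1) v unfolding pairing_def by blast+
        have "m' (m v) = m (m v)" using m'_other(1)[OF mv(1)] *(2) by blast
        then show ?thesis using * mv by simp
      qed
    qed
    have "alternates n m' (charge col)"
      unfolding alternates_def
    proof (intro ballI)
      fix v assume v: "v \<in> nodes n"
      have "charge col c = (\<not> charge col A)" "charge col d = (\<not> charge col B)"
        using m(2) AB unfolding alternates_def c_def d_def by blast+
      note ch_cd = this
      consider "v = A" | "v = B" | "v = c" | "v = d" | "v \<noteq> A" "v \<noteq> B" "v \<noteq> c" "v \<noteq> d" by blast
      then show "charge col (m' v) = (\<not> charge col v)"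
      proof cases
        case 5
        then show ?thesis using m'_other(1)[OF v 5] m(2) v unfolding alternates_def by metis
      qed (use m'_val ch ch_cd in \<open>simp_all only: simp_thms\<close>)
    qed
    have "represents n m' (touch (a, b) R)"
      unfolding represents_def
    proof (intro allI impI)
      fix \<chi> assume \<chi>: "alternates n m' \<chi>"
      \<comment> \<open>Read the colouring backwards through the vertex: the colours entering it are
        dictated by the former partners \<open>c\<close> and \<open>d\<close>. As these are partners
        of each other in \<open>m'\<close>, the entering colours differ, as a touch demands.\<close>
      define \<chi>' where "\<chi>' = \<chi>(A := \<not> \<chi> c, B := \<not> \<chi> d)"
      have \<chi>_cd: "\<chi> d = (\<not> \<chi> c)" "\<chi> B = (\<not> \<chi> A)"
        using \<chi> cd(1) AB(1) m'_val unfolding alternates_def by metis+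
      have "alternates n m \<chi>'"
        unfolding alternates_def
      proof (intro ballI)
        fix v assume v: "v \<in> nodes n"
        show "\<chi>' (m v) = (\<not> \<chi>' v)"
        proof (cases "v \<in> {A, B, c, d}")
          case True
          moreover have "m A = c" "m B = d" by (simp_all add: c_def d_def)
          ultimately show ?thesis
            using cd(3-) AB(3) \<open>c \<noteq> d\<close> \<open>d \<noteq> A\<close> \<open>c \<noteq> B\<close> unfolding \<chi>'_def
            by (elim insertE emptyE) simp_all
        next
          case False
          then have *: "m' v = m v" "m v \<notin> {A, B, c, d}" using m'_other[OF v] by blast+
          then have "\<chi> (m v) = (\<not> \<chi> v)" using \<chi> v by (metis alternates_def)
          then show ?thesis using * False by (simp add: \<chi>'_def)
        qed
      qed
      then have "R (\<lambda>i. \<chi>' (False, i)) (\<lambda>i. \<not> \<chi>' (True, i))"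
        using m(3) by (simp add: represents_def)
      moreover have "(\<lambda>i. \<chi>' (False, i)) = (\<lambda>i. \<chi> (False, i))"
        by (auto simp: \<chi>'_def A_def B_def)
      ultimately show "touch (a, b) R (\<lambda>i. \<chi> (False, i)) (\<lambda>i. \<not> \<chi> (True, i))"
        unfolding touch_def using \<chi>_cd AB
        by (intro exI[of _ "\<lambda>i. \<not> \<chi>' (True, i)"]) (auto simp: \<chi>'_def A_def B_def)
    qed
    with \<open>pairing n m'\<close> \<open>alternates n m' (charge col)\<close> show ?thesis using that by blast
  qed
qed

lemma pairing_touches:
  assumes "pairing n m" "alternates n m (charge col)" "represents n m R"
    and "\<forall>(a, b)\<in>set l. a < n \<and> b < n \<and> a \<noteq> b \<and> col a \<noteq> col b"
  obtains m' where "pairing n m'" "alternates n m' (charge col)" "represents n m' (fold touch l R)"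
  using assms
proof (induction l arbitrary: m R thesis)
  case Nil
  then show ?case by auto
next
  case (Cons ab l)
  obtain a b where ab: "ab = (a, b)" by (cases ab)
  obtain m1 where m1: "pairing n m1" "alternates n m1 (charge col)" "represents n m1 (touch ab R)"
    using pairing_touch[OF Cons.prems(2-4), of a b] Cons.prems(5) ab by auto
  show ?case
    by (rule Cons.IH[OF _ m1]) (use Cons.prems in auto)
qed

section \<open>Colourings that change only where two strands meet\<close>

text \<open>\<open>w\<close> holds the colours entering the vertices of one antidiagonal and
  \<open>w'\<close> those leaving them; two strands that meet may thus exchange their
  colours.\<close>

definition vertex_ok ::
  "nat \<Rightarrow> (nat \<Rightarrow> nat) \<Rightarrow> (nat \<Rightarrow> bool) \<Rightarrow> (nat \<Rightarrow> bool) \<Rightarrow> bool" where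
  "vertex_ok n pos w w' \<longleftrightarrow>
     (\<forall>i<n. (\<forall>j<n. j \<noteq> i \<and> pos i = pos j \<longrightarrow> w i \<noteq> w j \<and> w' i \<noteq> w' j) \<and>
            ((\<forall>j<n. j \<noteq> i \<longrightarrow> pos i \<noteq> pos j) \<longrightarrow> w i = w' i))"

definition touch_list :: "nat \<Rightarrow> (nat \<Rightarrow> nat) \<Rightarrow> (nat \<times> nat) list" where
  "touch_list n pos = filter (\<lambda>(a, b). a < b \<and> pos a = pos b) (List.product [0..<n] [0..<n])"

text \<open>Touches of disjoint pairs do not interact, so a sequence of them amounts to one
  simultaneous change.\<close>

lemma fold_touch:
  assumes "fold touch l R s w'" "distinct l"
    and "\<forall>p\<in>set l. \<forall>q\<in>set l. p \<noteq> q \<longrightarrow> {fst p, snd p} \<inter> {fst q, snd q} = {}"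
  obtains w where "R s w" "\<forall>p\<in>set l. w (fst p) \<noteq> w (snd p) \<and> w' (fst p) \<noteq> w' (snd p)"
    "\<forall>i. (\<forall>p\<in>set l. i \<noteq> fst p \<and> i \<noteq> snd p) \<longrightarrow> w i = w' i"
  using assms
proof (induction l arbitrary: w' thesis rule: rev_induct)
  case Nil
  then show ?case by auto
next
  case (snoc ab l)
  have "touch ab (fold touch l R) s w'" using snoc.prems(2) by simp
  then obtain w1 where w1: "fold touch l R s w1" "w1 (fst ab) \<noteq> w1 (snd ab)" "w' (fst ab) \<noteq> w' (snd ab)"
      "\<And>i. i \<noteq> fst ab \<Longrightarrow> i \<noteq> snd ab \<Longrightarrow> w' i = w1 i"
    unfolding touch_def by blast
  have disj: "{fst p, snd p} \<inter> {fst ab, snd ab} = {}" if "p \<in> set l" for p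
    using snoc.prems(3,4) that by auto
  obtain w where w: "R s w" "\<forall>p\<in>set l. w (fst p) \<noteq> w (snd p) \<and> w1 (fst p) \<noteq> w1 (snd p)"
    "\<forall>i. (\<forall>p\<in>set l. i \<noteq> fst p \<and> i \<noteq> snd p) \<longrightarrow> w i = w1 i"
    by (rule snoc.IH[OF _ w1(1)]) (use snoc.prems in auto)
  show ?case
  proof (rule snoc.prems(1)[OF w(1)])
    have "w (fst ab) = w1 (fst ab)" "w (snd ab) = w1 (snd ab)"
      using w(3) disj by blast+
    moreover have "w' (fst p) = w1 (fst p)" "w' (snd p) = w1 (snd p)" if "p \<in> set l" for p
      using disj[OF that] w1(4) by auto
    ultimately show "\<forall>p\<in>set (l @ [ab]). w (fst p) \<noteq> w (snd p) \<and> w' (fst p) \<noteq> w' (snd p)"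
      using w(2) w1(2,3) by auto
    show "\<forall>i. (\<forall>p\<in>set (l @ [ab]). i \<noteq> fst p \<and> i \<noteq> snd p) \<longrightarrow> w i = w' i"
      using w(3) w1(4) by auto
  qed
qed

lemma fold_touch_list:
  assumes "fold touch (touch_list n pos) R s w'"
    and valid: "\<And>i j. i < n \<Longrightarrow> j < n \<Longrightarrow> i \<noteq> j \<Longrightarrow> pos i = pos j \<Longrightarrow> col i \<noteq> (col j :: bool)"
  obtains w where "R s w" "vertex_ok n pos w w'"
proof -
  have mem: "p \<in> set (touch_list n pos) \<longleftrightarrow>
      fst p < snd p \<and> snd p < n \<and> pos (fst p) = pos (snd p)" for p
    by (cases p) (auto simp: touch_list_def)
  \<comment> \<open>Three strands at one vertex would need three pairwise different Boolean colours.
    Hence strands meet in twos and the listed pairs are disjoint.\<close>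
  have uniq: "j = k" if "i < n" "j < n" "k < n" "j \<noteq> i" "k \<noteq> i" "pos i = pos j" "pos i = pos k" for i j k
    using valid[of i j] valid[of i k] valid[of j k] that by (cases "j = k") auto
  have dist: "distinct (touch_list n pos)"
    by (simp add: touch_list_def distinct_product)
  have "{fst p, snd p} \<inter> {fst q, snd q} = {}"
    if "p \<in> set (touch_list n pos)" "q \<in> set (touch_list n pos)" "p \<noteq> q" for p q
  proof (rule ccontr)
    assume *: "{fst p, snd p} \<inter> {fst q, snd q} \<noteq> {}"
    have p: "fst p < snd p" "snd p < n" "pos (fst p) = pos (snd p)" using that(1) mem by auto
    have q: "fst q < snd q" "snd q < n" "pos (fst q) = pos (snd q)" using that(2) mem by auto
    from * consider "fst p = fst q" | "fst p = snd q" | "snd p = fst q" | "snd p = snd q" by auto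
    then have "fst p = fst q \<and> snd p = snd q"
    proof cases
      case 1 then show ?thesis using uniq[of "fst p" "snd p" "snd q"] p q by auto
    next
      case 2 then show ?thesis using uniq[of "fst p" "snd p" "fst q"] p q by auto
    next
      case 3 then show ?thesis using uniq[of "snd p" "fst p" "snd q"] p q by auto
    next
      case 4 then show ?thesis using uniq[of "snd p" "fst p" "fst q"] p q by auto
    qed
    then show False using that(3) by (auto simp: prod_eq_iff)
  qed
  then have disj: "\<forall>p\<in>set (touch_list n pos). \<forall>q\<in>set (touch_list n pos). p \<noteq> q \<longrightarrow>
      {fst p, snd p} \<inter> {fst q, snd q} = {}" by blast
  obtain w where w: "R s w"
    "\<forall>p\<in>set (touch_list n pos). w (fst p) \<noteq> w (snd p) \<and> w' (fst p) \<noteq> w' (snd p)"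
    "\<forall>i. (\<forall>p\<in>set (touch_list n pos). i \<noteq> fst p \<and> i \<noteq> snd p) \<longrightarrow> w i = w' i"
    by (rule fold_touch[OF assms(1) dist disj])
  have "vertex_ok n pos w w'"
    unfolding vertex_ok_def
  proof (intro allI impI conjI; (elim conjE)?)
    fix i j assume ij: "i < n" "j < n" "j \<noteq> i" "pos i = pos j"
    then have "(i, j) \<in> set (touch_list n pos) \<or> (j, i) \<in> set (touch_list n pos)"
      using mem[of "(i, j)"] mem[of "(j, i)"] by auto
    then show "w i \<noteq> w j" "w' i \<noteq> w' j" using w(2) by force+
  next
    fix i assume i: "i < n" "\<forall>j<n. j \<noteq> i \<longrightarrow> pos i \<noteq> pos j"
    have "i \<noteq> fst p \<and> i \<noteq> snd p" if "p \<in> set (touch_list n pos)" for p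
      using i that mem[of p] by (metis order.strict_trans less_irrefl)
    then show "w i = w' i" using w(3) by blast
  qed
  with w(1) show ?thesis using that by blast
qed

text \<open>Flipping a node together with its partner preserves alternation, so it yields another
  admissible recolouring. Here the end of \<open>z\<close> is flipped and \<open>y\<close> is the
  strand of its partner. By the sign convention of \<open>charge\<close>, the partner is a start if
  \<open>col y = col z\<close> and an end otherwise. The colours \<open>e t\<close> enter
  antidiagonal \<open>t\<close> and \<open>e (Suc t)\<close> leave it.\<close>

lemma flip_end:
  fixes pos :: "nat \<Rightarrow> nat \<Rightarrow> nat" and col :: "nat \<Rightarrow> bool"
  assumes valid: "\<And>i j t. i < n \<Longrightarrow> j < n \<Longrightarrow> i \<noteq> j \<Longrightarrow> pos i t = pos j t \<Longrightarrow> col i \<noteq> col j"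
    and "z < n"
  obtains e y where "y < n" "\<And>t. t < T \<Longrightarrow> vertex_ok n (\<lambda>i. pos i t) (e t) (e (Suc t))"
    "col y = col z \<and> (\<forall>i<n. e 0 i = (col(y := \<not> col y)) i \<and> e T i = (col(z := \<not> col z)) i) \<or>
     col y \<noteq> col z \<and> (\<forall>i<n. e 0 i = col i \<and> e T i = (col(y := \<not> col y, z := \<not> col z)) i)"
proof -
  define R0 :: "(nat \<Rightarrow> bool) \<Rightarrow> (nat \<Rightarrow> bool) \<Rightarrow> bool" where "R0 = (\<lambda>s w. \<forall>i<n. s i = w i)"
  define tl where "tl = (\<lambda>t. touch_list n (\<lambda>i. pos i t))"
  define run where "run = (\<lambda>t. fold touch (concat (map tl [0..<t])) R0)"
  \<comment> \<open>Before any meeting each start is the partner of the end of its own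
    strand.\<close>
  define m0 :: "bool \<times> nat \<Rightarrow> bool \<times> nat" where "m0 = (\<lambda>v. (\<not> fst v, snd v))"
  have "pairing n m0" by (auto simp: pairing_def m0_def nodes_def)
  moreover have "alternates n m0 (charge col)" by (auto simp: alternates_def m0_def charge_def)
  moreover have "represents n m0 R0"
    unfolding represents_def R0_def
  proof (intro allI impI)
    fix \<chi> i assume "alternates n m0 \<chi>" "i < n"
    then have "\<chi> (m0 (False, i)) = (\<not> \<chi> (False, i))" by (simp add: alternates_def nodes_def)
    then show "\<chi> (False, i) = (\<not> \<chi> (True, i))" by (simp add: m0_def)
  qed
  moreover have "\<forall>(a, b)\<in>set (concat (map tl [0..<T])). a < n \<and> b < n \<and> a \<noteq> b \<and> col a \<noteq> col b"
    using valid by (auto simp: tl_def touch_list_def)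
  ultimately obtain m where m: "pairing n m" "alternates n m (charge col)" "represents n m (run T)"
    unfolding run_def by (rule pairing_touches)
  define Z where "Z = (True, z)"
  have Z: "Z \<in> nodes n" using \<open>z < n\<close> by (simp add: Z_def nodes_def)
  have mZ: "m Z \<in> nodes n" "m (m Z) = Z" "m Z \<noteq> Z" "charge col (m Z) = (\<not> charge col Z)"
    using m(1,2) Z by (auto simp: pairing_def alternates_def)
  define \<chi> where "\<chi> = (charge col)(Z := \<not> charge col Z, m Z := \<not> charge col (m Z))"
  have "alternates n m \<chi>"
    unfolding alternates_def
  proof (intro ballI)
    fix v assume v: "v \<in> nodes n"
    show "\<chi> (m v) = (\<not> \<chi> v)"
    proof (cases "v = Z \<or> v = m Z")
      case True
      then show ?thesis using mZ by (auto simp: \<chi>_def)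
    next
      case False
      then have "m v \<noteq> Z" "m v \<noteq> m Z" using m(1) v Z by (metis pairing_def)+
      then show ?thesis using False m(2) v by (auto simp: \<chi>_def alternates_def)
    qed
  qed
  then have run: "run T (\<lambda>i. \<chi> (False, i)) (\<lambda>i. \<not> \<chi> (True, i))"
    using m(3) by (simp add: represents_def)
  \<comment> \<open>The composed relation hides the intermediate colourings; they are recovered one
    antidiagonal at a time.\<close>
  have "\<exists>e. (\<forall>i<n. e 0 i = s i) \<and> e t = w \<and>
      (\<forall>t'<t. vertex_ok n (\<lambda>i. pos i t') (e t') (e (Suc t')))" if "run t s w" for t s w
    using that
  proof (induction t arbitrary: w)
    case 0
    then show ?case by (intro exI[of _ "\<lambda>_. w"]) (auto simp: run_def R0_def)
  next
    case (Suc t)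
    then have "fold touch (touch_list n (\<lambda>i. pos i t)) (run t) s w" by (simp add: run_def tl_def)
    then obtain w1 where w1: "run t s w1" "vertex_ok n (\<lambda>i. pos i t) w1 w"
      by (rule fold_touch_list[where col = col]) (use valid in auto)
    obtain e where e: "\<forall>i<n. e 0 i = s i" "e t = w1"
        "\<forall>t'<t. vertex_ok n (\<lambda>i. pos i t') (e t') (e (Suc t'))"
      using Suc.IH[OF w1(1)] by blast
    show ?case
      by (intro exI[of _ "e(Suc t := w)"]) (use e w1(2) in \<open>auto simp: less_Suc_eq\<close>)
  qed
  from this[OF run] obtain e where e: "\<forall>i<n. e 0 i = \<chi> (False, i)" "e T = (\<lambda>i. \<not> \<chi> (True, i))"
      "\<forall>t'<T. vertex_ok n (\<lambda>i. pos i t') (e t') (e (Suc t'))" by blast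
  define y where "y = snd (m Z)"
  have "y < n" using mZ(1) by (auto simp: y_def nodes_def)
  moreover have "col y = col z \<and> (\<forall>i<n. e 0 i = (col(y := \<not> col y)) i \<and> e T i = (col(z := \<not> col z)) i) \<or>
     col y \<noteq> col z \<and> (\<forall>i<n. e 0 i = col i \<and> e T i = (col(y := \<not> col y, z := \<not> col z)) i)"
  proof (cases "fst (m Z)")
    case False
    then have "m Z = (False, y)" by (simp add: y_def prod_eq_iff)
    then show ?thesis using mZ(4) e(1,2) by (auto simp: \<chi>_def charge_def Z_def)
  next
    case True
    then have "m Z = (True, y)" by (simp add: y_def prod_eq_iff)
    then show ?thesis using mZ(3,4) e(1,2) by (auto simp: \<chi>_def charge_def Z_def)
  qed
  ultimately show ?thesis using that e(3) by blast
qed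

text \<open>The pieces of one colour are glued into new strands. \<open>g t j\<close> is the old
  strand that new strand \<open>j\<close> follows on antidiagonal \<open>t\<close>; whenever that
  old strand changes its colour, \<open>j\<close> jumps to the one it meets there. So
  \<open>j\<close> moves continuously and always has the colour \<open>e 0 j\<close>.\<close>

lemma recolour_reroute:
  fixes pos :: "nat \<Rightarrow> nat \<Rightarrow> nat" and e :: "nat \<Rightarrow> nat \<Rightarrow> bool"
  assumes ok: "\<And>t. vertex_ok n (\<lambda>i. pos i t) (e t) (e (Suc t))"
  obtains g where "\<And>j. g 0 j = j" "\<And>t. bij_betw (g t) {..<n} {..<n}"
    "\<And>t j. j < n \<Longrightarrow> e t (g t j) = e 0 j"
    "\<And>t j. j < n \<Longrightarrow> pos (g (Suc t) j) t = pos (g t j) t"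
proof -
  define touched where "touched = (\<lambda>t i j. j < n \<and> j \<noteq> i \<and> pos i t = pos j t)"
  define partner where "partner = (\<lambda>t i. SOME j. touched t i j)"
  define g where "g = rec_nat (\<lambda>j. j)
    (\<lambda>t gt j. if e (Suc t) (gt j) = e t (gt j) then gt j else partner t (gt j))"
  have g0: "g 0 j = j" for j by (simp add: g_def)
  have gS: "g (Suc t) j = (if e (Suc t) (g t j) = e t (g t j) then g t j else partner t (g t j))" for t j
    by (simp add: g_def)
  have diff: "e t i \<noteq> e t j \<and> e (Suc t) i \<noteq> e (Suc t) j" if "touched t i j" "i < n" for t i j
    using ok[of t] that by (auto simp: vertex_ok_def touched_def)
  have partner: "touched t i (partner t i)" if "i < n" "e (Suc t) i \<noteq> e t i" for t i
  proof -
    have "\<exists>j. touched t i j"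
      using ok[of t] that by (auto simp: vertex_ok_def touched_def)
    then show ?thesis unfolding partner_def by (rule someI_ex)
  qed
  have step: "g (Suc t) j < n" "e (Suc t) (g (Suc t) j) = e t (g t j)"
      "pos (g (Suc t) j) t = pos (g t j) t" if "g t j < n" for t j
  proof -
    have "g (Suc t) j < n \<and> e (Suc t) (g (Suc t) j) = e t (g t j) \<and>
      pos (g (Suc t) j) t = pos (g t j) t"
    proof (cases "e (Suc t) (g t j) = e t (g t j)")
      case True
      then show ?thesis using that by (simp add: gS)
    next
      case False
      define k where "k = partner t (g t j)"
      have "touched t (g t j) k" using partner[OF that False] by (simp add: k_def)
      moreover have "g (Suc t) j = k" using False by (simp add: gS k_def)
      ultimately show ?thesis
        using diff[of t "g t j" k] that False by (simp add: touched_def)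
    qed
    then show "g (Suc t) j < n" "e (Suc t) (g (Suc t) j) = e t (g t j)"
      "pos (g (Suc t) j) t = pos (g t j) t" by blast+
  qed
  have range: "g t j < n" if "j < n" for t j
    by (induction t) (simp_all only: that g0 step(1))
  have colour: "e t (g t j) = e 0 j" if "j < n" for t j
    by (induction t) (simp_all only: g0 step(2)[OF range[OF that]])
  have inj: "inj_on (g t) {..<n}" for t
  proof (induction t)
    case 0
    then show ?case by (auto simp: g0 inj_on_def)
  next
    case (Suc t)
    show ?case
    proof (rule inj_onI, rule ccontr)
      fix i j assume ij: "i \<in> {..<n}" "j \<in> {..<n}" "g (Suc t) i = g (Suc t) j" "i \<noteq> j"
      then have ne: "g t i \<noteq> g t j" using Suc by (auto simp: inj_on_def)
      have r: "g t i < n" "g t j < n" using ij range by auto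
      \<comment> \<open>If two new strands landed on one old strand, they would come from two old
        strands meeting at time \<open>t\<close>. These have different colours, yet both new strands
        keep theirs and end up with the same one.\<close>
      have "pos (g t i) t = pos (g t j) t"
        using step(3)[OF r(1)] step(3)[OF r(2)] ij(3) by simp
      then have "touched t (g t i) (g t j)" using r ne by (auto simp: touched_def)
      from diff[OF this r(1)] step(2)[OF r(1)] step(2)[OF r(2)] ij(3) show False by simp
    qed
  qed
  have "bij_betw (g t) {..<n} {..<n}" for t
    unfolding bij_betw_def
    by (intro conjI inj endo_inj_surj) (use range in auto)
  then show ?thesis using that g0 colour step(3) range by blast
qed

text \<open>Which start is joined to which end need not be known: disjoint strands keep their order
  from left to right, so \<open>m\<close> of them with starts and ends in windows of
  \<open>m\<close> consecutive columns join these in increasing order.\<close>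

lemma fsys_of_family:
  assumes J: "finite J" "card J = m"
    and st: "\<And>j. j \<in> J \<Longrightarrow> strand u1 u2 (st j) (en j) (q j)"
    and disj: "\<And>i j t. i \<in> J \<Longrightarrow> j \<in> J \<Longrightarrow> i \<noteq> j \<Longrightarrow> q i t \<noteq> q j t"
    and range: "\<And>j. j \<in> J \<Longrightarrow> a \<le> st j \<and> st j < a + m"
      "\<And>j. j \<in> J \<Longrightarrow> v + 1 - m \<le> en j \<and> en j \<le> v" "m \<le> v + 1"
  obtains p where "fsys u1 u2 a v m p" "\<And>x T. sys_wt x u1 u2 T m p =
    (\<Sum>t<T. \<Sum>j\<in>J. cell_wt x u1 u2 t (q j t))"
proof -
  have q0: "q j 0 = st j" if "j \<in> J" for j using strand_0[OF st[OF that]] .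
  have inj: "inj_on st J" using disj q0 by (metis inj_onI)
  have "st ` J = {a..<a + m}"
    by (rule card_subset_eq) (use range inj J in \<open>auto simp: card_image\<close>)
  then have bij: "bij_betw st J {a..<a + m}" using inj by (simp add: bij_betw_def)
  define \<sigma> where "\<sigma> = (\<lambda>i. inv_into J st (a + i))"
  have "bij_betw (\<lambda>i. a + i) {..<m} {a..<a + m}"
    by (rule bij_betw_byWitness[where f' = "\<lambda>i. i - a"]) auto
  from bij_betw_trans[OF this bij_betw_inv_into[OF bij]]
  have \<sigma>: "bij_betw \<sigma> {..<m} J" by (simp add: \<sigma>_def comp_def)
  have \<sigma>J: "\<sigma> i \<in> J" if "i < m" for i using \<sigma> that by (auto dest: bij_betwE)
  have st\<sigma>: "st (\<sigma> i) = a + i" if "i < m" for i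
    unfolding \<sigma>_def by (rule f_inv_into_f) (use \<open>st ` J = _\<close> that in simp)
  define p where "p = (\<lambda>i. q (\<sigma> i))"
  have ne: "p i t \<noteq> p j t" if "i < m" "j < m" "i \<noteq> j" for i j t
    unfolding p_def using disj[OF \<sigma>J \<sigma>J] that \<sigma> by (metis bij_betw_def inj_onD lessThan_iff)
  have less: "p i t < p j t" if "i < j" "j < m" for i j t
  proof (induction t)
    case 0
    then show ?case using that q0[OF \<sigma>J] st\<sigma> by (simp add: p_def)
  next
    case (Suc t)
    have "p i (Suc t) \<le> Suc (p i t)" "p j t \<le> p j (Suc t)"
      using strand_step[OF st[OF \<sigma>J], of i t] strand_mono[OF st[OF \<sigma>J], of j t "Suc t"] that
      by (auto simp: p_def)
    with Suc ne[of i j "Suc t"] that show ?case by simp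
  qed
  define b where "b = v + 1 - m"
  have en_less: "en (\<sigma> i) < en (\<sigma> j)" if "i < j" "j < m" for i j
  proof -
    have "i < m" using that by simp
    obtain S where S: "\<And>t. t \<ge> S \<Longrightarrow> q (\<sigma> i) t = en (\<sigma> i)"
      using strand_eventually[OF st[OF \<sigma>J[OF \<open>i < m\<close>]]] by blast
    obtain S' where S': "\<And>t. t \<ge> S' \<Longrightarrow> q (\<sigma> j) t = en (\<sigma> j)"
      using strand_eventually[OF st[OF \<sigma>J[OF \<open>j < m\<close>]]] by blast
    show ?thesis using less[OF that, of "max S S'"] S S' by (simp add: p_def)
  qed
  \<comment> \<open>The end columns increase strictly inside a window of \<open>m\<close> columns.
    Induction from the left bounds them from below, induction from the right from above, and the
    bounds coincide.\<close>
  have lower: "b + i \<le> en (\<sigma> i)" if "i < m" for i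
    using that
  proof (induction i)
    case 0
    then show ?case using range(2)[OF \<sigma>J, of 0] by (simp add: b_def)
  next
    case (Suc i)
    then show ?case using en_less[of i "Suc i"] by simp
  qed
  have upper: "en (\<sigma> (m - 1 - i)) + i \<le> v" if "i < m" for i
    using that
  proof (induction i)
    case 0
    then show ?case using range(2)[OF \<sigma>J, of "m - 1"] by simp
  next
    case (Suc i)
    have "en (\<sigma> (m - 1 - Suc i)) < en (\<sigma> (m - 1 - i))" by (rule en_less) (use Suc in auto)
    then show ?case using Suc by simp
  qed
  have en\<sigma>: "en (\<sigma> i) = v + 1 + i - m" if "i < m" for i
  proof -
    have "m - 1 - (m - 1 - i) = i" using that by simp
    then have "en (\<sigma> i) + (m - 1 - i) \<le> v" using upper[of "m - 1 - i"] that by simp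
    then show ?thesis
      using lower[OF that] that range(3) unfolding b_def by linarith
  qed
  have "fsys u1 u2 a v m p"
    unfolding fsys_def
  proof (intro conjI allI impI)
    fix i assume "i < m"
    then show "strand u1 u2 (a + i) (v + 1 + i - m) (p i)"
      using st[OF \<sigma>J[OF \<open>i < m\<close>]] st\<sigma> en\<sigma> by (simp add: p_def)
  qed (use ne in auto)
  moreover have "sys_wt x u1 u2 T m p = (\<Sum>t<T. \<Sum>j\<in>J. cell_wt x u1 u2 t (q j t))" for x T
    unfolding sys_wt_def p_def
    by (rule sum.cong[OF refl], rule sum.reindex_bij_betw[OF \<sigma>])
  ultimately show ?thesis using that by blast
qed

section \<open>Exchange relations for maximal path systems\<close>

lemma fsys_strand:
  "fsys u1 u2 v1 v2 k p \<Longrightarrow> i < k \<Longrightarrow> strand u1 u2 (v1 + i) (v2 + 1 + i - k) (p i)"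
  by (simp add: fsys_def)

text \<open>A strand moves by at most one column per step, so two strands cannot change their order
  without meeting.\<close>

lemma fsys_less:
  assumes p: "fsys u1 u2 v1 v2 k p" and "i < j" "j < k"
  shows "p i t < p j t"
proof (induction t)
  case 0
  then show ?case
    using strand_0[OF fsys_strand[OF p, of i]] strand_0[OF fsys_strand[OF p, of j]] assms(2,3) by simp
next
  case (Suc t)
  have "p i (Suc t) \<le> Suc (p i t)" "p j t \<le> p j (Suc t)"
    using strand_step[OF fsys_strand[OF p], of i t] strand_mono[OF fsys_strand[OF p], of j t "Suc t"]
      assms(2,3) by auto
  moreover have "p i (Suc t) \<noteq> p j (Suc t)" using p assms(2,3) by (simp add: fsys_def)
  ultimately show ?case using Suc by simp
qed

lemma fsys_gap:
  assumes p: "fsys u1 u2 v1 v2 k p" and "i + d < k"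
  shows "p i t + d \<le> p (i + d) t"
  using assms(2)
proof (induction d)
  case (Suc d)
  then show ?case using fsys_less[OF p, of "i + d" "i + Suc d" t] by simp
qed simp

text \<open>The last strand is the last to reach row \<open>u1\<close>. Until then it stays in its
  starting column, and the strict order pins all the others to theirs. At the other end the first
  strand has the same effect, see \<open>fsys_end\<close>.\<close>

lemma fsys_start:
  assumes p: "fsys u1 u2 v1 v2 k p" and "1 \<le> u1" "i < k" "t \<le> u1 + v1 + k - 1"
  shows "p i t = v1 + i"
proof -
  have "p (k - 1) t = v1 + (k - 1)"
    using strand_start[OF fsys_strand[OF p] \<open>1 \<le> u1\<close>, of "k - 1" t] assms(3,4) by simp
  moreover have "p i t + (k - 1 - i) \<le> p (i + (k - 1 - i)) t"
    by (rule fsys_gap[OF p]) (use assms in simp)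
  moreover have "i + (k - 1 - i) = k - 1" using assms(3) by simp
  ultimately show ?thesis using strand_bounds(1)[OF fsys_strand[OF p], of i t] assms(3) by simp
qed

lemma fsys_end:
  assumes p: "fsys u1 u2 v1 v2 k p" and "i < k" "u2 + v2 + 1 - k \<le> t" "k \<le> v2 + 1"
  shows "p i t = v2 + 1 + i - k"
proof -
  have "p 0 t = v2 + 1 - k"
    using strand_end[OF fsys_strand[OF p], of 0 t] assms(2-) by simp
  moreover have "p 0 t + i \<le> p (0 + i) t" by (rule fsys_gap[OF p]) (use assms in simp)
  ultimately show ?thesis
    using strand_bounds(2)[OF fsys_strand[OF p], of i t] assms(2,4) by simp
qed

text \<open>By \<open>fsys_start\<close> the first strand does not leave column \<open>v1\<close>
  before row \<open>u1 + k - 1\<close>. If that row exceeded \<open>u2\<close>, the strand would be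
  frozen there, although its final column is a different one.\<close>

lemma fsys_rows:
  assumes p: "fsys u1 u2 v1 v2 k p" and "1 \<le> u1" "v1 + k \<le> v2"
  shows "k \<le> u2 + 1 - u1"
proof (rule ccontr)
  assume *: "\<not> k \<le> u2 + 1 - u1"
  define t where "t = u1 + v1 + k - 1"
  have t: "p 0 t = v1" using fsys_start[OF p \<open>1 \<le> u1\<close>, of 0 t] * by (simp add: t_def)
  then have "u2 < t - p 0 t" using * \<open>1 \<le> u1\<close> by (simp add: t_def)
  from strand_frozen[OF fsys_strand[OF p] this] t * assms(3) show False by simp
qed

section \<open>Uncrossing by minima and maxima\<close>

lemma strand_min:
  assumes "strand u1 u2 a b c" "strand u1 u2 a' b' c'"
  shows "strand u1 u2 (min a a') (min b b') (\<lambda>t. min (c t) (c' t))"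
  unfolding strand_def
proof (intro conjI allI)
  show "min (c 0) (c' 0) = min a a'" using strand_0[OF assms(1)] strand_0[OF assms(2)] by simp
  have "\<forall>\<^sub>F t in sequentially. c t = b" "\<forall>\<^sub>F t in sequentially. c' t = b'"
    using assms by (auto simp: strand_def)
  then show "\<forall>\<^sub>F t in sequentially. min (c t) (c' t) = min b b'"
    by eventually_elim simp
  fix t
  show "min (c (Suc t)) (c' (Suc t)) = min (c t) (c' t) \<or>
    min (c (Suc t)) (c' (Suc t)) = Suc (min (c t) (c' t)) \<and>
    u1 \<le> t - min (c t) (c' t) \<and> t - min (c t) (c' t) \<le> u2"
    using strand_step[OF assms(1), of t] strand_step[OF assms(2), of t]
    by (cases "c t < c' t"; cases "c t = c' t") (auto simp: min_def)
qed

lemma strand_max: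
  assumes "strand u1 u2 a b c" "strand u1 u2 a' b' c'"
  shows "strand u1 u2 (max a a') (max b b') (\<lambda>t. max (c t) (c' t))"
  unfolding strand_def
proof (intro conjI allI)
  show "max (c 0) (c' 0) = max a a'" using strand_0[OF assms(1)] strand_0[OF assms(2)] by simp
  have "\<forall>\<^sub>F t in sequentially. c t = b" "\<forall>\<^sub>F t in sequentially. c' t = b'"
    using assms by (auto simp: strand_def)
  then show "\<forall>\<^sub>F t in sequentially. max (c t) (c' t) = max b b'"
    by eventually_elim simp
  fix t
  show "max (c (Suc t)) (c' (Suc t)) = max (c t) (c' t) \<or>
    max (c (Suc t)) (c' (Suc t)) = Suc (max (c t) (c' t)) \<and>
    u1 \<le> t - max (c t) (c' t) \<and> t - max (c t) (c' t) \<le> u2"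
    using strand_step[OF assms(1), of t] strand_step[OF assms(2), of t]
    by (cases "c t < c' t"; cases "c t = c' t") (auto simp: max_def)
qed

lemma fsysI:
  assumes "\<And>i. i < k \<Longrightarrow> strand u1 u2 (v1 + i) (v2 + 1 + i - k) (p i)"
    and "\<And>i t. Suc i < k \<Longrightarrow> p i t < p (Suc i) t"
  shows "fsys u1 u2 v1 v2 k p"
proof -
  have *: "p i t < p (i + Suc d) t" if "i + Suc d < k" for i d t
    using that
  proof (induction d)
    case (Suc d)
    then show ?case using assms(2)[of "i + Suc d" t] by (simp add: less_trans)
  qed (use assms(2) in simp)
  have "p i t \<noteq> p j t" if "i < k" "j < k" "i \<noteq> j" for i j t
  proof (cases "i < j")
    case True
    then show ?thesis using *[of i "j - Suc i" t] that by simp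
  next
    case False
    then show ?thesis using *[of j "i - Suc j" t] that by simp
  qed
  then show ?thesis using assms(1) by (simp add: fsys_def)
qed

lemma min_max_cell_wt:
  "cell_wt x u1 u2 t (min a b) + cell_wt x u1 u2 t (max a b) = cell_wt x u1 u2 t a + cell_wt x u1 u2 t b"
  by (simp add: min_def max_def)

lemma uncross_equal:
  assumes P: "fsys u1 u2 u v k P" and Q: "fsys u1 u2 (u + 1) (v - 1) k Q" and "k < v"
  obtains A B where "fsys u1 u2 u (v - 1) k A" "fsys u1 u2 (u + 1) v k B"
    "\<And>x T. sys_wt x u1 u2 T k A + sys_wt x u1 u2 T k B = sys_wt x u1 u2 T k P + sys_wt x u1 u2 T k Q"
proof
  define A B where "A = (\<lambda>i t. min (P i t) (Q i t))" and "B = (\<lambda>i t. max (P i t) (Q i t))"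
  show "fsys u1 u2 u (v - 1) k A"
  proof (rule fsysI)
    fix i assume i: "i < k"
    have "min (u + i) (u + 1 + i) = u + i" "min (v + 1 + i - k) (v - 1 + 1 + i - k) = v - 1 + 1 + i - k"
      using \<open>k < v\<close> by auto
    then show "strand u1 u2 (u + i) (v - 1 + 1 + i - k) (A i)"
      unfolding A_def using strand_min[OF fsys_strand[OF P i] fsys_strand[OF Q i]] by simp
  next
    fix i t assume "Suc i < k"
    then have "P i t < P (Suc i) t" "Q i t < Q (Suc i) t"
      using fsys_less[OF P] fsys_less[OF Q] by simp_all
    then show "A i t < A (Suc i) t" by (simp add: A_def min_def)
  qed
  show "fsys u1 u2 (u + 1) v k B"
  proof (rule fsysI)
    fix i assume i: "i < k"
    have "max (u + i) (u + 1 + i) = u + 1 + i" "max (v + 1 + i - k) (v - 1 + 1 + i - k) = v + 1 + i - k"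
      using \<open>k < v\<close> by auto
    then show "strand u1 u2 (u + 1 + i) (v + 1 + i - k) (B i)"
      unfolding B_def using strand_max[OF fsys_strand[OF P i] fsys_strand[OF Q i]] by simp
  next
    fix i t assume "Suc i < k"
    then have "P i t < P (Suc i) t" "Q i t < Q (Suc i) t"
      using fsys_less[OF P] fsys_less[OF Q] by simp_all
    then show "B i t < B (Suc i) t" by (simp add: B_def max_def)
  qed
  fix x T
  show "sys_wt x u1 u2 T k A + sys_wt x u1 u2 T k B = sys_wt x u1 u2 T k P + sys_wt x u1 u2 T k Q"
    unfolding sys_wt_def A_def B_def by (simp add: sum.distrib[symmetric] min_max_cell_wt)
qed

text \<open>\<open>P (Suc i)\<close> and \<open>Q i\<close> have the same starting and the same
  final column. The first strand of \<open>P\<close> is joined to the maxima and the last one to the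
  minima; with the roles exchanged a strand of \<open>Q\<close> could meet the extra strand.\<close>

lemma uncross_nested:
  assumes P: "fsys u1 u2 u v (k + 1) P" and Q: "fsys u1 u2 (u + 1) (v - 1) (k - 1) Q"
    and "1 \<le> k" "k < v"
  obtains A B where "fsys u1 u2 u (v - 1) k A" "fsys u1 u2 (u + 1) v k B"
    "\<And>x T. sys_wt x u1 u2 T k A + sys_wt x u1 u2 T k B =
      sys_wt x u1 u2 T (k + 1) P + sys_wt x u1 u2 T (k - 1) Q"
proof
  define A where "A = (\<lambda>i t. if i = 0 then P 0 t else max (P i t) (Q (i - 1) t))"
  define B where "B = (\<lambda>i t. if i = k - 1 then P k t else min (P (Suc i) t) (Q i t))"
  have PQ: "u + Suc i = u + 1 + i" "v + 1 + Suc i - (k + 1) = v - 1 + 1 + i - (k - 1)" for i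
    using \<open>1 \<le> k\<close> \<open>k < v\<close> by auto
  have P': "strand u1 u2 (u + 1 + i) (v - 1 + 1 + i - (k - 1)) (P (Suc i))" if "i < k" for i
    using fsys_strand[OF P, of "Suc i"] that unfolding PQ by simp
  show "fsys u1 u2 u (v - 1) k A"
  proof (rule fsysI)
    fix i assume i: "i < k"
    show "strand u1 u2 (u + i) (v - 1 + 1 + i - k) (A i)"
    proof (cases i)
      case 0
      then show ?thesis using fsys_strand[OF P, of 0] \<open>k < v\<close> by (simp add: A_def)
    next
      case (Suc j)
      have "v - 1 + 1 + i - k = v - 1 + 1 + j - (k - 1)" using Suc \<open>k < v\<close> \<open>1 \<le> k\<close> by simp
      then show ?thesis
        using strand_max[OF P'[of j] fsys_strand[OF Q, of j]] i Suc by (simp add: A_def)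
    qed
  next
    fix i t assume i: "Suc i < k"
    then have "P i t < P (Suc i) t" "i \<noteq> 0 \<longrightarrow> Q (i - 1) t < Q i t"
      using fsys_less[OF P] fsys_less[OF Q] by simp_all
    then show "A i t < A (Suc i) t" by (cases "i = 0") (auto simp: A_def max_def)
  qed
  show "fsys u1 u2 (u + 1) v k B"
  proof (rule fsysI)
    fix i assume i: "i < k"
    have *: "v + 1 + i - k = v - 1 + 1 + i - (k - 1)" using \<open>k < v\<close> \<open>1 \<le> k\<close> by simp
    show "strand u1 u2 (u + 1 + i) (v + 1 + i - k) (B i)"
    proof (cases "i = k - 1")
      case True
      then have "Suc i = k" using i by simp
      then have "B i = P (Suc i)" using True by (simp add: B_def)
      then show ?thesis using P'[OF i] unfolding * by simp
    next
      case False
      then show ?thesis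
        using strand_min[OF P'[OF i] fsys_strand[OF Q, of i]] i unfolding * by (simp add: B_def)
    qed
  next
    fix i t assume i: "Suc i < k"
    then have "P (Suc i) t < P (Suc (Suc i)) t" "Suc i \<noteq> k - 1 \<longrightarrow> Q i t < Q (Suc i) t"
      using fsys_less[OF P] fsys_less[OF Q] by simp_all
    then show "B i t < B (Suc i) t"
      using i by (cases "Suc i = k - 1") (auto simp: B_def min_def)
  qed
  fix x T
  obtain m where k: "k = Suc m" using \<open>1 \<le> k\<close> by (cases k) auto
  have "(\<Sum>i<k. cell_wt x u1 u2 t (A i t)) + (\<Sum>i<k. cell_wt x u1 u2 t (B i t)) =
      (\<Sum>i<k+1. cell_wt x u1 u2 t (P i t)) + (\<Sum>i<k-1. cell_wt x u1 u2 t (Q i t))" for t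
  proof -
    have "(\<Sum>i<k. cell_wt x u1 u2 t (A i t)) =
        cell_wt x u1 u2 t (P 0 t) + (\<Sum>i<m. cell_wt x u1 u2 t (max (P (Suc i) t) (Q i t)))"
      unfolding k by (subst sum.lessThan_Suc_shift) (simp add: A_def)
    moreover have "(\<Sum>i<k. cell_wt x u1 u2 t (B i t)) =
        (\<Sum>i<m. cell_wt x u1 u2 t (min (P (Suc i) t) (Q i t))) + cell_wt x u1 u2 t (P k t)"
      unfolding k by (simp add: B_def k)
    moreover have "(\<Sum>i<k+1. cell_wt x u1 u2 t (P i t)) =
        cell_wt x u1 u2 t (P 0 t) + (\<Sum>i<m. cell_wt x u1 u2 t (P (Suc i) t)) + cell_wt x u1 u2 t (P k t)"
      unfolding k Suc_eq_plus1[symmetric] by (subst sum.lessThan_Suc_shift) simp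
    moreover have "(\<Sum>i<m. cell_wt x u1 u2 t (max (P (Suc i) t) (Q i t))) +
        (\<Sum>i<m. cell_wt x u1 u2 t (min (P (Suc i) t) (Q i t))) =
        (\<Sum>i<m. cell_wt x u1 u2 t (P (Suc i) t)) + (\<Sum>i<m. cell_wt x u1 u2 t (Q i t))"
      unfolding sum.distrib[symmetric] using min_max_cell_wt by (simp add: add.commute)
    ultimately show ?thesis by (simp add: k)
  qed
  then show "sys_wt x u1 u2 T k A + sys_wt x u1 u2 T k B =
      sys_wt x u1 u2 T (k + 1) P + sys_wt x u1 u2 T (k - 1) Q"
    unfolding sys_wt_def sum.distrib[symmetric] by simp
qed

text \<open>Colour the strands of \<open>A\<close> true and those of \<open>B\<close> false. The
  only unshared starting columns are \<open>u\<close> and \<open>u + k\<close>, the only unshared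
  final columns \<open>v - k\<close> and \<open>v\<close>. Strand \<open>0\<close> is the one that
  ends in \<open>v - k\<close>. Flipping its end is compensated either at its own start, which moves
  the whole strand to the other colour and gives the nested pair, or at the end in column
  \<open>v\<close>, which gives the crossing pair.\<close>

lemma exchange:
  assumes A: "fsys u1 u2 u (v - 1) k A" and B: "fsys u1 u2 (u + 1) v k B"
    and "1 \<le> k" "u + k \<le> v"
  obtains (crossing) P Q where "fsys u1 u2 u v k P" "fsys u1 u2 (u + 1) (v - 1) k Q"
      "\<And>x T. sys_wt x u1 u2 T k P + sys_wt x u1 u2 T k Q = sys_wt x u1 u2 T k A + sys_wt x u1 u2 T k B"
    | (nested) P Q where "fsys u1 u2 u v (k + 1) P" "fsys u1 u2 (u + 1) (v - 1) (k - 1) Q"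
      "\<And>x T. sys_wt x u1 u2 T (k + 1) P + sys_wt x u1 u2 T (k - 1) Q =
        sys_wt x u1 u2 T k A + sys_wt x u1 u2 T k B"
proof -
  define n where "n = 2 * k"
  define pos where "pos = (\<lambda>j. if j < k then A j else B (j - k))"
  define col where "col = (\<lambda>j. j < k)"
  define st where "st = (\<lambda>j. if j < k then u + j else u + 1 + (j - k))"
  define en where "en = (\<lambda>j. if j < k then v + j - k else v + 1 + (j - k) - k)"
  define T0 where "T0 = u2 + v"
  have strand: "strand u1 u2 (st j) (en j) (pos j)" if "j < n" for j
    using fsys_strand[OF A, of j] fsys_strand[OF B, of "j - k"] that assms(3,4)
    by (auto simp: st_def en_def pos_def n_def)
  have valid: "col i \<noteq> col j" if "i < n" "j < n" "i \<noteq> j" "pos i t = pos j t" for i j t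
  proof (rule ccontr)
    assume "\<not> col i \<noteq> col j"
    then have "i < k \<and> j < k \<or> \<not> i < k \<and> \<not> j < k" by (auto simp: col_def)
    then show False
    proof
      assume "i < k \<and> j < k"
      then show False using A that by (auto simp: fsys_def pos_def)
    next
      assume *: "\<not> i < k \<and> \<not> j < k"
      then have "i - k < k" "j - k < k" "i - k \<noteq> j - k" using that by (auto simp: n_def)
      then show False using B that(4) * by (auto simp: fsys_def pos_def)
    qed
  qed
  have "0 < n" using assms(3) by (simp add: n_def)
  obtain e0 y where "y < n" and
    e0: "\<And>t. t < Suc T0 \<Longrightarrow> vertex_ok n (\<lambda>i. pos i t) (e0 t) (e0 (Suc t))" and
    y: "col y = col 0 \<and>
        (\<forall>i<n. e0 0 i = (col(y := \<not> col y)) i \<and> e0 (Suc T0) i = (col(0 := \<not> col 0)) i) \<or>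
      col y \<noteq> col 0 \<and>
        (\<forall>i<n. e0 0 i = col i \<and> e0 (Suc T0) i = (col(y := \<not> col y, 0 := \<not> col 0)) i)"
    by (rule flip_end[of n pos col 0 "Suc T0"]; (rule valid \<open>0 < n\<close>; assumption)?) blast
  \<comment> \<open>From time \<open>T0\<close> on all strands stand still, so the last colouring
    can be kept for ever without violating the vertex condition.\<close>
  define e where "e = (\<lambda>t. e0 (min t (Suc T0)))"
  have const: "pos j t = en j" if "j < n" "T0 \<le> t" for j t
  proof (rule strand_end[OF strand[OF that(1)]])
    have "en j \<le> v" using that(1) by (cases "j < k") (simp_all add: en_def n_def)
    then show "u2 + en j \<le> t" using that(2) unfolding T0_def by linarith
  qed
  have ok: "vertex_ok n (\<lambda>i. pos i t) (e t) (e (Suc t))" for t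
  proof (cases "t < Suc T0")
    case True
    then have "e t = e0 t" "e (Suc t) = e0 (Suc t)" by (simp_all add: e_def)
    then show ?thesis using e0[OF True] by simp
  next
    case False
    then have e: "e t = e0 (Suc T0)" "e (Suc t) = e0 (Suc T0)" by (simp_all add: e_def)
    have ok0: "vertex_ok n (\<lambda>i. pos i T0) (e0 T0) (e0 (Suc T0))" using e0 by simp
    have pos: "pos i t = pos i T0" if "i < n" for i
      using const[OF that, of t] const[OF that, of T0] False by simp
    show ?thesis
      unfolding vertex_ok_def e
    proof (intro allI impI conjI; (elim conjE)?)
      fix i j assume "i < n" "j < n" "j \<noteq> i" "pos i t = pos j t"
      then have "j \<noteq> i \<and> pos i T0 = pos j T0" using pos by metis
      then show "e0 (Suc T0) i \<noteq> e0 (Suc T0) j" "e0 (Suc T0) i \<noteq> e0 (Suc T0) j"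
        using ok0 \<open>i < n\<close> \<open>j < n\<close> unfolding vertex_ok_def by blast+
    qed (rule refl)
  qed
  obtain g where g: "\<And>j. g 0 j = j" "\<And>t. bij_betw (g t) {..<n} {..<n}"
    "\<And>t j. j < n \<Longrightarrow> e t (g t j) = e 0 j"
    "\<And>t j. j < n \<Longrightarrow> pos (g (Suc t) j) t = pos (g t j) t"
    by (rule recolour_reroute[of n pos e]; (rule ok)?) blast
  have g_less: "g t j < n" if "j < n" for t j using g(2)[of t] that by (auto dest: bij_betwE)
  define q where "q = (\<lambda>j t. pos (g t j) t)"
  define en' where "en' = (\<lambda>j. en (g (Suc T0) j))"
  have strand': "strand u1 u2 (st j) (en' j) (q j)" if "j < n" for j
    unfolding strand_def
  proof (intro conjI allI)
    show "q j 0 = st j" using strand_0[OF strand[OF that]] by (simp add: q_def g)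
    have "q j t = en' j" if "Suc T0 \<le> t" for t
      using that
    proof (induction t rule: dec_induct)
      case base
      then show ?case using const g_less \<open>j < n\<close> by (simp add: q_def en'_def)
    next
      case (step t)
      have "q j (Suc t) = en (g (Suc t) j)"
        using const g_less \<open>j < n\<close> step by (simp add: q_def)
      also have "\<dots> = pos (g (Suc t) j) t" using const g_less \<open>j < n\<close> step by simp
      also have "\<dots> = q j t" using g(4) \<open>j < n\<close> by (simp add: q_def)
      finally show ?case using step by simp
    qed
    then show "\<forall>\<^sub>F t in sequentially. q j t = en' j"
      unfolding eventually_sequentially by blast
    fix t
    show "q j (Suc t) = q j t \<or> q j (Suc t) = Suc (q j t) \<and> u1 \<le> t - q j t \<and> t - q j t \<le> u2"
      using strand_step[OF strand[OF g_less[OF that]], of "Suc t" t] g(4)[OF that, of t]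
      by (auto simp: q_def)
  qed
  have disj: "q i t \<noteq> q j t" if "i < n" "j < n" "i \<noteq> j" "e 0 i = e 0 j" for i j t
  proof
    assume *: "q i t = q j t"
    have "g t j \<noteq> g t i"
      using g(2)[of t] that(1-3) unfolding bij_betw_def inj_on_def by blast
    moreover have "pos (g t i) t = pos (g t j) t" using * by (simp add: q_def)
    ultimately have "e t (g t i) \<noteq> e t (g t j)"
      using ok[of t] g_less[OF that(1), of t] g_less[OF that(2), of t]
      unfolding vertex_ok_def by blast
    then show False using g(3)[OF that(1)] g(3)[OF that(2)] that(4) by simp
  qed
  have total: "(\<Sum>j<n. cell_wt x u1 u2 t (q j t)) =
      (\<Sum>i<k. cell_wt x u1 u2 t (A i t)) + (\<Sum>i<k. cell_wt x u1 u2 t (B i t))" for x t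
  proof -
    have "(\<Sum>j<n. cell_wt x u1 u2 t (q j t)) = (\<Sum>j<n. cell_wt x u1 u2 t (pos j t))"
      unfolding q_def using sum.reindex_bij_betw[OF g(2)[of t], of "\<lambda>j. cell_wt x u1 u2 t (pos j t)"] .
    also have "\<dots> = (\<Sum>j<k. cell_wt x u1 u2 t (pos j t)) + (\<Sum>j\<in>{k..<k+k}. cell_wt x u1 u2 t (pos j t))"
      using sum.atLeastLessThan_concat[of 0 k "k + k" "\<lambda>j. cell_wt x u1 u2 t (pos j t)"]
      by (simp add: n_def lessThan_atLeast0 mult_2)
    also have "(\<Sum>j\<in>{k..<k+k}. cell_wt x u1 u2 t (pos j t)) = (\<Sum>i<k. cell_wt x u1 u2 t (B i t))"
      using sum.shift_bounds_nat_ivl[of "\<lambda>j. cell_wt x u1 u2 t (pos j t)" 0 k k]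
      by (simp add: pos_def lessThan_atLeast0)
    finally show ?thesis by (simp add: pos_def)
  qed
  define J where "J = (\<lambda>c. {j. j < n \<and> e 0 j = c})"
  have J_Un: "{..<n} = J True \<union> J False" "J True \<inter> J False = {}" and fin: "finite (J c)" for c
    by (auto simp: J_def)
  have total': "(\<Sum>t<T. \<Sum>j\<in>J True. cell_wt x u1 u2 t (q j t)) +
      (\<Sum>t<T. \<Sum>j\<in>J False. cell_wt x u1 u2 t (q j t)) =
      sys_wt x u1 u2 T k A + sys_wt x u1 u2 T k B" for x T
  proof -
    have "(\<Sum>j\<in>J True. cell_wt x u1 u2 t (q j t)) + (\<Sum>j\<in>J False. cell_wt x u1 u2 t (q j t)) =
        (\<Sum>i<k. cell_wt x u1 u2 t (A i t)) + (\<Sum>i<k. cell_wt x u1 u2 t (B i t))" for t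
      using total[of x t] unfolding J_Un(1) sum.union_disjoint[OF fin fin J_Un(2)] .
    then have "(\<Sum>t<T. (\<Sum>j\<in>J True. cell_wt x u1 u2 t (q j t)) +
          (\<Sum>j\<in>J False. cell_wt x u1 u2 t (q j t))) =
        (\<Sum>t<T. (\<Sum>i<k. cell_wt x u1 u2 t (A i t)) + (\<Sum>i<k. cell_wt x u1 u2 t (B i t)))"
      by (rule sum.cong[OF refl])
    then show ?thesis unfolding sys_wt_def by (simp only: sum.distrib)
  qed
  have en'_mem: "en' j \<in> en ` {i. i < n \<and> e (Suc T0) i = c}" if "j \<in> J c" for j c
    unfolding en'_def by (rule imageI) (use g_less g(3) that in \<open>auto simp: J_def\<close>)
  have family: "\<exists>p. fsys u1 u2 a w m p \<and> (\<forall>x T. sys_wt x u1 u2 T m p =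
      (\<Sum>t<T. \<Sum>j\<in>J c. cell_wt x u1 u2 t (q j t)))"
    if hyps: "card (J c) = m" "\<forall>j\<in>J c. a \<le> st j \<and> st j < a + m"
      "\<forall>i<n. e (Suc T0) i = c \<longrightarrow> w + 1 - m \<le> en i \<and> en i \<le> w" "m \<le> w + 1" for c m a w
  proof (rule fsys_of_family[of "J c" m u1 u2 st en' q a w])
    show "w + 1 - m \<le> en' j \<and> en' j \<le> w" if "j \<in> J c" for j
      using en'_mem[OF that] hyps(3) by auto
    show "strand u1 u2 (st j) (en' j) (q j)" if "j \<in> J c" for j
      using strand' that by (simp add: J_def)
    show "q i t \<noteq> q j t" if "i \<in> J c" "j \<in> J c" "i \<noteq> j" for i j t
      using disj that by (simp add: J_def)
  qed (use fin hyps in blast)+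
  have eT: "e (Suc T0) = e0 (Suc T0)" "e 0 = e0 0" "e T0 = e0 T0" by (simp_all add: e_def)
  from y show thesis
  proof (elim disjE conjE)
    assume "col y = col 0"
      and e_ends: "\<forall>i<n. e0 0 i = (col(y := \<not> col y)) i \<and> e0 (Suc T0) i = (col(0 := \<not> col 0)) i"
    then have "y < k" using assms(3) by (simp add: col_def)
    have e_first: "e 0 i = (col(y := \<not> col y)) i"
      and e_last: "e (Suc T0) i = (col(0 := \<not> col 0)) i" if "i < n" for i
      using e_ends that unfolding eT by blast+
    \<comment> \<open>Otherwise the start of \<open>y\<close> shares its column with strand
      \<open>y'\<close> of \<open>B\<close>, and flipping only one of the two would give them the
      same colour.\<close>
    have "y = 0"
    proof (rule ccontr)
      assume "y \<noteq> 0"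
      define y' where "y' = k + (y - 1)"
      have y': "y' < n" "y' \<noteq> y" "y' \<ge> k"
        using \<open>y < k\<close> \<open>y \<noteq> 0\<close> by (simp_all add: y'_def n_def)
      have "pos y 0 = st y" "pos y' 0 = st y'"
        using strand_0[OF strand] \<open>y < n\<close> y' by blast+
      then have "pos y 0 = pos y' 0"
        using \<open>y < k\<close> \<open>y \<noteq> 0\<close> by (simp add: st_def y'_def)
      then have "e 0 y \<noteq> e 0 y'"
        using ok[of 0] y' \<open>y < n\<close> unfolding vertex_ok_def by blast
      then show False
        using e_first[OF \<open>y < n\<close>] e_first[OF y'(1)] y' \<open>y < k\<close> by (simp add: col_def)
    qed
    then have e1: "e 0 i = (i < k \<and> i \<noteq> 0)" "e (Suc T0) i = (i < k \<and> i \<noteq> 0)" if "i < n" for i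
      using e_first[OF that] e_last[OF that] assms(3) by (auto simp: col_def)
    have JT: "J True = {1..<k}" and JF: "J False = insert 0 {k..<2 * k}"
      using e1 assms(3) by (auto simp: J_def n_def)
    have "card (J False) = k + 1"
      using assms(3) by (simp add: JF mult_2)
    moreover have "\<forall>j\<in>J False. u \<le> st j \<and> st j < u + (k + 1)"
      unfolding JF
    proof
      fix j assume "j \<in> insert 0 {k..<2 * k}"
      then show "u \<le> st j \<and> st j < u + (k + 1)"
        using assms(3,4) by (cases "j < k") (simp_all add: st_def, linarith?)
    qed
    moreover have "\<forall>i<n. e (Suc T0) i = False \<longrightarrow> v + 1 - (k + 1) \<le> en i \<and> en i \<le> v"
    proof (intro allI impI)
      fix i assume "i < n" "e (Suc T0) i = False"
      then show "v + 1 - (k + 1) \<le> en i \<and> en i \<le> v"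
        using assms(3,4) e1(2)[of i] by (cases "i < k") (simp_all add: en_def n_def, linarith?)
    qed
    moreover have "k + 1 \<le> v + 1" using assms(3,4) by simp
    ultimately obtain P where P: "fsys u1 u2 (u) (v) (k + 1) P"
        "\<And>x T. sys_wt x u1 u2 T (k + 1) P = (\<Sum>t<T. \<Sum>j\<in>J False. cell_wt x u1 u2 t (q j t))"
      using family[of False "k + 1" "u" "v"] by blast
    have "card (J True) = k - 1"
      using assms(3) by (simp add: JT mult_2)
    moreover have "\<forall>j\<in>J True. u + 1 \<le> st j \<and> st j < u + 1 + (k - 1)"
      unfolding JT
    proof
      fix j assume "j \<in> {1..<k}"
      then show "u + 1 \<le> st j \<and> st j < u + 1 + (k - 1)"
        using assms(3,4) by (cases "j < k") (simp_all add: st_def, linarith?)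
    qed
    moreover have "\<forall>i<n. e (Suc T0) i = True \<longrightarrow> v - 1 + 1 - (k - 1) \<le> en i \<and> en i \<le> v - 1"
    proof (intro allI impI)
      fix i assume "i < n" "e (Suc T0) i = True"
      then show "v - 1 + 1 - (k - 1) \<le> en i \<and> en i \<le> v - 1"
        using assms(3,4) e1(2)[of i] by (cases "i < k") (simp_all add: en_def n_def, linarith?)
    qed
    moreover have "k - 1 \<le> v - 1 + 1" using assms(3,4) by simp
    ultimately obtain Q where Q: "fsys u1 u2 (u + 1) (v - 1) (k - 1) Q"
        "\<And>x T. sys_wt x u1 u2 T (k - 1) Q = (\<Sum>t<T. \<Sum>j\<in>J True. cell_wt x u1 u2 t (q j t))"
      using family[of True "k - 1" "u + 1" "v - 1"] by blast
    show thesis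
      by (rule nested[OF P(1) Q(1)]) (use P(2) Q(2) total' in \<open>simp add: add.commute\<close>)
  next
    assume ne: "col y \<noteq> col 0" and e_ends: "\<forall>i<n. e0 0 i = col i \<and>
      e0 (Suc T0) i = (col(y := \<not> col y, 0 := \<not> col 0)) i"
    then have "y \<ge> k" using assms(3) by (simp add: col_def)
    have e_first: "e 0 i = col i"
      and e_last: "e (Suc T0) i = (col(y := \<not> col y, 0 := \<not> col 0)) i" if "i < n" for i
      using e_ends that unfolding eT by blast+
    \<comment> \<open>Strand \<open>2 * k - 1\<close> is the one that ends in column
      \<open>v\<close>. Any other strand of \<open>B\<close> ends together with strand
      \<open>y'\<close> of \<open>A\<close>, and again flipping one of the two would make their
      colours equal.\<close>
    have "y = 2 * k - 1"
    proof (rule ccontr)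
      assume "y \<noteq> 2 * k - 1"
      define y' where "y' = y - k + 1"
      have y': "y' < n" "y' \<noteq> y" "y' < k" "y' \<noteq> 0"
        using \<open>y \<ge> k\<close> \<open>y < n\<close> \<open>y \<noteq> 2 * k - 1\<close> by (simp_all add: y'_def n_def)
      have "pos y T0 = en y" "pos y' T0 = en y'" using const \<open>y < n\<close> y' by blast+
      then have "pos y T0 = pos y' T0"
        using \<open>y' < k\<close> \<open>y \<ge> k\<close> assms(3) by (simp add: en_def y'_def)
      then have "e (Suc T0) y \<noteq> e (Suc T0) y'"
        using ok[of T0] y' \<open>y < n\<close> unfolding vertex_ok_def by blast
      then show False
        using e_last[OF \<open>y < n\<close>] e_last[OF y'(1)] y' \<open>y \<ge> k\<close> assms(3) by (simp add: col_def)
    qed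
    then have e1: "e 0 i = (i < k)" "e (Suc T0) i = (i < k \<and> i \<noteq> 0 \<or> i = 2 * k - 1)" if "i < n" for i
      using e_first[OF that] e_last[OF that] assms(3) by (auto simp: col_def)
    have JT: "J True = {0..<k}" and JF: "J False = {k..<2 * k}"
      using e1 assms(3) by (auto simp: J_def n_def)
    have "card (J True) = k"
      using assms(3) by (simp add: JT mult_2)
    moreover have "\<forall>j\<in>J True. u \<le> st j \<and> st j < u + (k)"
      unfolding JT
    proof
      fix j assume "j \<in> {0..<k}"
      then show "u \<le> st j \<and> st j < u + (k)"
        using assms(3,4) by (cases "j < k") (simp_all add: st_def, linarith?)
    qed
    moreover have "\<forall>i<n. e (Suc T0) i = True \<longrightarrow> v + 1 - (k) \<le> en i \<and> en i \<le> v"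
    proof (intro allI impI)
      fix i assume "i < n" "e (Suc T0) i = True"
      then show "v + 1 - (k) \<le> en i \<and> en i \<le> v"
        using assms(3,4) e1(2)[of i] by (cases "i < k") (simp_all add: en_def n_def, linarith?)
    qed
    moreover have "k \<le> v + 1" using assms(3,4) by simp
    ultimately obtain P where P: "fsys u1 u2 (u) (v) (k) P"
        "\<And>x T. sys_wt x u1 u2 T (k) P = (\<Sum>t<T. \<Sum>j\<in>J True. cell_wt x u1 u2 t (q j t))"
      using family[of True "k" "u" "v"] by blast
    have "card (J False) = k"
      using assms(3) by (simp add: JF mult_2)
    moreover have "\<forall>j\<in>J False. u + 1 \<le> st j \<and> st j < u + 1 + (k)"
      unfolding JF
    proof
      fix j assume "j \<in> {k..<2 * k}"
      then show "u + 1 \<le> st j \<and> st j < u + 1 + (k)"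
        using assms(3,4) by (cases "j < k") (simp_all add: st_def, linarith?)
    qed
    moreover have "\<forall>i<n. e (Suc T0) i = False \<longrightarrow> v - 1 + 1 - (k) \<le> en i \<and> en i \<le> v - 1"
    proof (intro allI impI)
      fix i assume "i < n" "e (Suc T0) i = False"
      then show "v - 1 + 1 - (k) \<le> en i \<and> en i \<le> v - 1"
        using assms(3,4) e1(2)[of i] by (cases "i < k") (simp_all add: en_def n_def, linarith?)
    qed
    moreover have "k \<le> v - 1 + 1" using assms(3,4) by simp
    ultimately obtain Q where Q: "fsys u1 u2 (u + 1) (v - 1) (k) Q"
        "\<And>x T. sys_wt x u1 u2 T (k) Q = (\<Sum>t<T. \<Sum>j\<in>J False. cell_wt x u1 u2 t (q j t))"
      using family[of False "k" "u + 1" "v - 1"] by blast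
    show thesis
      by (rule crossing[OF P(1) Q(1)]) (use P(2) Q(2) total' in simp)
  qed
qed

section \<open>The inequalities behind the tropical Desnanot-Jacobi identity\<close>

text \<open>A disjunction takes the place of the maximum because \<open>H\<close> is constant from
  the number of rows on: \<open>k + 1\<close> paths are available only for
  \<open>k < u2 + 1 - u1\<close>. In the nested case \<open>fsys_rows\<close> supplies this
  inequality.\<close>

lemma H_octahedron_le:
  assumes "1 \<le> u1" "u1 \<le> u2" "1 \<le> k" "k \<le> u2 + 1 - u1" "u + k < v"
  shows "H u1 u u2 (v - 1) x k + H u1 (u + 1) u2 v x k \<le> H u1 u u2 v x k + H u1 (u + 1) u2 (v - 1) x k \<or>
    k < u2 + 1 - u1 \<and> H u1 u u2 (v - 1) x k + H u1 (u + 1) u2 v x k \<le>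
      H u1 u u2 v x (k + 1) + H u1 (u + 1) u2 (v - 1) x (k - 1)"
proof -
  define T where "T = u2 + v + 1"
  obtain A where A: "fsys u1 u2 u (v - 1) k A" "H u1 u u2 (v - 1) x k = sys_wt x u1 u2 T k A"
    by (rule H_attained[of u1 u2 k "v - 1" u T x]) (use assms in \<open>auto simp: T_def\<close>)
  obtain B where B: "fsys u1 u2 (u + 1) v k B" "H u1 (u + 1) u2 v x k = sys_wt x u1 u2 T k B"
    by (rule H_attained[of u1 u2 k v "u + 1" T x]) (use assms in \<open>auto simp: T_def\<close>)
  have "u + k \<le> v" using assms by simp
  from A(1) B(1) \<open>1 \<le> k\<close> this show ?thesis
  proof (cases rule: exchange)
    case (crossing P Q)
    have "sys_wt x u1 u2 T k P \<le> H u1 u u2 v x k"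
      by (rule H_upper[OF crossing(1)]) (use assms in \<open>auto simp: T_def\<close>)
    moreover have "sys_wt x u1 u2 T k Q \<le> H u1 (u + 1) u2 (v - 1) x k"
      by (rule H_upper[OF crossing(2)]) (use assms in \<open>auto simp: T_def\<close>)
    ultimately show ?thesis using crossing(3)[of x T] A(2) B(2) by simp
  next
    case (nested P Q)
    have rows: "k + 1 \<le> u2 + 1 - u1"
      by (rule fsys_rows[OF nested(1)]) (use assms in auto)
    have "sys_wt x u1 u2 T (k + 1) P \<le> H u1 u u2 v x (k + 1)"
      by (rule H_upper[OF nested(1)]) (use assms rows in \<open>auto simp: T_def\<close>)
    moreover have "sys_wt x u1 u2 T (k - 1) Q \<le> H u1 (u + 1) u2 (v - 1) x (k - 1)"
      by (rule H_upper[OF nested(2)]) (use assms in \<open>auto simp: T_def\<close>)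
    ultimately show ?thesis using nested(3)[of x T] A(2) B(2) rows by simp
  qed
qed

lemma H_crossing_le:
  assumes "1 \<le> u1" "u1 \<le> u2" "1 \<le> k" "k \<le> u2 + 1 - u1" "u + k < v"
  shows "H u1 u u2 v x k + H u1 (u + 1) u2 (v - 1) x k \<le> H u1 u u2 (v - 1) x k + H u1 (u + 1) u2 v x k"
proof -
  define T where "T = u2 + v + 1"
  obtain P where P: "fsys u1 u2 u v k P" "H u1 u u2 v x k = sys_wt x u1 u2 T k P"
    by (rule H_attained[of u1 u2 k v u T x]) (use assms in \<open>auto simp: T_def\<close>)
  obtain Q where Q: "fsys u1 u2 (u + 1) (v - 1) k Q" "H u1 (u + 1) u2 (v - 1) x k = sys_wt x u1 u2 T k Q"
    by (rule H_attained[of u1 u2 k "v - 1" "u + 1" T x]) (use assms in \<open>auto simp: T_def\<close>)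
  obtain A B where AB: "fsys u1 u2 u (v - 1) k A" "fsys u1 u2 (u + 1) v k B"
    "\<And>x T. sys_wt x u1 u2 T k A + sys_wt x u1 u2 T k B = sys_wt x u1 u2 T k P + sys_wt x u1 u2 T k Q"
    by (rule uncross_equal[OF P(1) Q(1)]) (use assms in auto)
  have "sys_wt x u1 u2 T k A \<le> H u1 u u2 (v - 1) x k"
    by (rule H_upper[OF AB(1)]) (use assms in \<open>auto simp: T_def\<close>)
  moreover have "sys_wt x u1 u2 T k B \<le> H u1 (u + 1) u2 v x k"
    by (rule H_upper[OF AB(2)]) (use assms in \<open>auto simp: T_def\<close>)
  ultimately show ?thesis using AB(3)[of x T] P(2) Q(2) by simp
qed

lemma H_nested_le:
  assumes "1 \<le> u1" "u1 \<le> u2" "1 \<le> k" "k < u2 + 1 - u1" "u + k < v"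
  shows "H u1 u u2 v x (k + 1) + H u1 (u + 1) u2 (v - 1) x (k - 1) \<le>
    H u1 u u2 (v - 1) x k + H u1 (u + 1) u2 v x k"
proof -
  define T where "T = u2 + v + 1"
  obtain P where P: "fsys u1 u2 u v (k + 1) P" "H u1 u u2 v x (k + 1) = sys_wt x u1 u2 T (k + 1) P"
    by (rule H_attained[of u1 u2 "k + 1" v u T x]) (use assms in \<open>auto simp: T_def\<close>)
  obtain Q where Q: "fsys u1 u2 (u + 1) (v - 1) (k - 1) Q"
      "H u1 (u + 1) u2 (v - 1) x (k - 1) = sys_wt x u1 u2 T (k - 1) Q"
    by (rule H_attained[of u1 u2 "k - 1" "v - 1" "u + 1" T x]) (use assms in \<open>auto simp: T_def\<close>)
  obtain A B where AB: "fsys u1 u2 u (v - 1) k A" "fsys u1 u2 (u + 1) v k B"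
    "\<And>x T. sys_wt x u1 u2 T k A + sys_wt x u1 u2 T k B =
      sys_wt x u1 u2 T (k + 1) P + sys_wt x u1 u2 T (k - 1) Q"
    by (rule uncross_nested[OF P(1) Q(1)]) (use assms in auto)
  have "sys_wt x u1 u2 T k A \<le> H u1 u u2 (v - 1) x k"
    by (rule H_upper[OF AB(1)]) (use assms in \<open>auto simp: T_def\<close>)
  moreover have "sys_wt x u1 u2 T k B \<le> H u1 (u + 1) u2 v x k"
    by (rule H_upper[OF AB(2)]) (use assms in \<open>auto simp: T_def\<close>)
  ultimately show ?thesis using AB(3)[of x T] P(2) Q(2) by simp
qed

section \<open>Symmetry, growth and bordering\<close>

lemma H_min: "H u1 v1 u2 v2 x k = H u1 v1 u2 v2 x (min k (min (u2 + 1 - u1) (v2 + 1 - v1)))"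
  by (simp add: H_def)

lemma H_zero:
  assumes "min k (min (u2 + 1 - u1) (v2 + 1 - v1)) = 0"
  shows "H u1 v1 u2 v2 x k = 0"
proof -
  have "path_systems u1 v1 u2 v2 0 = {[]}" by (auto simp: path_systems_def)
  then show ?thesis unfolding H_def assms by simp
qed

section \<open>Symmetry under transposition\<close>

text \<open>While the strands still stand in their starting columns, they fill whole antidiagonals
  of the triangle at the corner \<open>(u1, v1)\<close>. The triangle does not change its shape
  under transposition; the same holds at the opposite corner.\<close>

lemma sum_start_triangle:
  assumes "1 \<le> u1" "d < k" "u1 + k \<le> u2 + 1"
  shows "(\<Sum>i<k. cell_wt x u1 u2 (u1 + v1 + d) (v1 + i)) = (\<Sum>i\<le>d. x (u1 + (d - i), v1 + i))"
proof -
  have "(\<Sum>i\<le>d. x (u1 + (d - i), v1 + i)) = (\<Sum>i<k. cell_wt x u1 u2 (u1 + v1 + d) (v1 + i))"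
  proof (rule sum.mono_neutral_cong_left)
    show "{..d} \<subseteq> {..<k}" using assms by auto
    show "\<forall>i\<in>{..<k} - {..d}. cell_wt x u1 u2 (u1 + v1 + d) (v1 + i) = 0"
    proof
      fix i assume "i \<in> {..<k} - {..d}"
      then have "u1 + v1 + d - (v1 + i) < u1" using assms(1) by auto
      then show "cell_wt x u1 u2 (u1 + v1 + d) (v1 + i) = 0" by (simp add: cell_wt_def)
    qed
    fix i assume "i \<in> {..d}"
    then have "u1 + v1 + d - (v1 + i) = u1 + (d - i)" "u1 + (d - i) \<le> u2" using assms by auto
    then show "x (u1 + (d - i), v1 + i) = cell_wt x u1 u2 (u1 + v1 + d) (v1 + i)"
      by (simp add: cell_wt_def)
  qed simp
  then show ?thesis by simp
qed

lemma sum_end_triangle: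
  assumes "1 \<le> u1" "t + e = u2 + v2" "e < k" "u1 + k \<le> u2 + 1" "k \<le> v2 + 1"
  shows "(\<Sum>i<k. cell_wt x u1 u2 t (v2 + 1 + i - k)) = (\<Sum>i\<le>e. x (u2 - (e - i), v2 - i))"
proof -
  have "(\<Sum>i<k. cell_wt x u1 u2 t (v2 + 1 + i - k)) =
      (\<Sum>i<k. cell_wt x u1 u2 t (v2 + 1 + (k - Suc i) - k))"
    by (rule sum.nat_diff_reindex[symmetric])
  also have "\<dots> = (\<Sum>i<k. cell_wt x u1 u2 t (v2 - i))"
  proof (rule sum.cong[OF refl])
    fix i assume "i \<in> {..<k}"
    then have "v2 + 1 + (k - Suc i) - k = v2 - i" by simp
    then show "cell_wt x u1 u2 t (v2 + 1 + (k - Suc i) - k) = cell_wt x u1 u2 t (v2 - i)" by simp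
  qed
  also have "\<dots> = (\<Sum>i\<le>e. x (u2 - (e - i), v2 - i))"
  proof (rule sum.mono_neutral_cong_right)
    show "{..e} \<subseteq> {..<k}" using assms by auto
    show "\<forall>i\<in>{..<k} - {..e}. cell_wt x u1 u2 t (v2 - i) = 0"
    proof
      fix i assume "i \<in> {..<k} - {..e}"
      then have "u2 < t - (v2 - i)" using assms by auto
      then show "cell_wt x u1 u2 t (v2 - i) = 0" by (simp add: cell_wt_def)
    qed
    fix i assume "i \<in> {..e}"
    then have "t - (v2 - i) = u2 - (e - i)" "u1 \<le> u2 - (e - i)" using assms by auto
    then show "cell_wt x u1 u2 t (v2 - i) = x (u2 - (e - i), v2 - i)"
      by (simp add: cell_wt_def)
  qed simp
  finally show ?thesis .
qed

text \<open>The mirror image of a system starts along the first column of the rectangle instead of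
  its first row, so it is not a system of the required form. However, both kinds cover the two
  corner triangles completely. Hence only the part between \<open>t0\<close>, when the last strand
  enters, and \<open>t1\<close>, when the first one reaches row \<open>u2\<close> in its final
  column, is mirrored, with the order of the strands reversed; outside it the strands are vertical
  again.\<close>

lemma fsys_transpose:
  assumes p: "fsys u1 u2 v1 v2 k p" and "1 \<le> u1" "1 \<le> v1" "1 \<le> k"
    and k: "u1 + k \<le> u2 + 1" "v1 + k \<le> v2 + 1"
  obtains p' where "fsys v1 v2 u1 u2 k p'"
    "\<And>x T. sys_wt (x \<circ> prod.swap) v1 v2 T k p' = sys_wt x u1 u2 T k p"
proof
  define t0 t1 where "t0 = u1 + v1 + k - 1" and "t1 = u2 + v2 + 1 - k"
  define p' where "p' = (\<lambda>i t. if t \<le> t0 then u1 + i else if t1 \<le> t then u2 + 1 + i - k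
    else t - p (k - 1 - i) t)"
  have "t0 \<le> t1" using k \<open>1 \<le> k\<close> by (simp add: t0_def t1_def)
  have start: "p j t = v1 + j" if "j < k" "t \<le> t0" for j t
    using fsys_start[OF p \<open>1 \<le> u1\<close>] that by (simp add: t0_def)
  have "end": "p j t = v2 + 1 + j - k" if "j < k" "t1 \<le> t" for j t
    using fsys_end[OF p that(1)] that k \<open>1 \<le> v1\<close> by (simp add: t1_def)
  have bnd: "v1 \<le> p j t \<and> p j t \<le> v2" if "j < k" for j t
    using strand_bounds[OF fsys_strand[OF p that], of t] that by simp
  have row: "p j t \<le> t \<and> u1 \<le> t - p j t \<and> t - p j t \<le> u2" if "j < k" "t0 \<le> t" "t \<le> t1" for j t
  proof -
    have "u1 + (v1 + j) \<le> t" using that \<open>1 \<le> k\<close> by (simp add: t0_def)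
    moreover have "t \<le> u2 + (v2 + 1 + j - k)" using that k \<open>1 \<le> v1\<close> by (simp add: t1_def)
    ultimately show ?thesis
      using strand_row(1)[OF fsys_strand[OF p that(1)] \<open>1 \<le> u1\<close>]
        strand_in_rows[OF fsys_strand[OF p that(1)] \<open>1 \<le> u1\<close>, of t] by blast
  qed
  have mid: "p' i t = t - p (k - 1 - i) t" if "i < k" "t0 \<le> t" "t \<le> t1" for i t
  proof -
    have j: "k - 1 - i < k" using that by simp
    consider "t = t0" | "t0 < t" "t = t1" | "t0 < t" "t < t1"
      using \<open>t0 \<le> t\<close> \<open>t \<le> t1\<close> by linarith
    then show ?thesis
    proof cases
      case 1
      then have "t - p (k - 1 - i) t = u1 + i" using start[OF j, of t] that by (simp add: t0_def)
      then show ?thesis using 1 by (simp add: p'_def)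
    next
      case 2
      have "t - p (k - 1 - i) t = u2 + 1 + i - k"
        using "end"[OF j, of t] that 2 k \<open>1 \<le> v1\<close> by (simp add: t1_def)
      then show ?thesis using 2 by (simp add: p'_def)
    next
      case 3
      then show ?thesis by (simp add: p'_def)
    qed
  qed
  show "fsys v1 v2 u1 u2 k p'"
  proof (rule fsysI)
    fix i assume i: "i < k"
    have j: "k - 1 - i < k" using i by simp
    show "strand v1 v2 (u1 + i) (u2 + 1 + i - k) (p' i)"
      unfolding strand_def
    proof (intro conjI allI)
      show "p' i 0 = u1 + i" by (simp add: p'_def)
      have "p' i t = u2 + 1 + i - k" if "Suc t1 \<le> t" for t
        using that \<open>t0 \<le> t1\<close> by (simp add: p'_def)
      then show "\<forall>\<^sub>F t in sequentially. p' i t = u2 + 1 + i - k"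
        unfolding eventually_sequentially by blast
      fix t
      consider "t < t0" | "t0 \<le> t" "t < t1" | "t1 \<le> t" using \<open>t0 \<le> t1\<close> by linarith
      then show "p' i (Suc t) = p' i t \<or>
        p' i (Suc t) = Suc (p' i t) \<and> v1 \<le> t - p' i t \<and> t - p' i t \<le> v2"
      proof cases
        case 1
        then show ?thesis by (simp add: p'_def)
      next
        case 2
        have m: "p' i t = t - p (k - 1 - i) t" "p' i (Suc t) = Suc t - p (k - 1 - i) (Suc t)"
          using mid[OF i] 2 by simp_all
        have r: "p (k - 1 - i) t \<le> t" using row[OF j, of t] 2 by simp
        from strand_step[OF fsys_strand[OF p j], of t] show ?thesis
        proof
          assume "p (k - 1 - i) (Suc t) = p (k - 1 - i) t"
          then show ?thesis using m r bnd[OF j, of t] by (simp add: Suc_diff_le)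
        next
          assume "p (k - 1 - i) (Suc t) = Suc (p (k - 1 - i) t) \<and>
            u1 \<le> t - p (k - 1 - i) t \<and> t - p (k - 1 - i) t \<le> u2"
          then show ?thesis using m by simp
        qed
      next
        case 3
        then have "p' i t = u2 + 1 + i - k"
        proof (cases "t = t1")
          case True
          then show ?thesis
            using mid[OF i, of t] \<open>t0 \<le> t1\<close> "end"[OF j, of t] k \<open>1 \<le> v1\<close> i by (simp add: t1_def)
        next
          case False
          then show ?thesis using 3 \<open>t0 \<le> t1\<close> by (simp add: p'_def)
        qed
        moreover have "p' i (Suc t) = u2 + 1 + i - k" using 3 \<open>t0 \<le> t1\<close> by (simp add: p'_def)
        ultimately show ?thesis by simp
      qed
    qed
  next
    fix i t assume i: "Suc i < k"
    consider "t < t0" | "t0 \<le> t" "t \<le> t1" | "t1 < t" by linarith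
    then show "p' i t < p' (Suc i) t"
    proof cases
      case 1
      then show ?thesis by (simp add: p'_def)
    next
      case 2
      have "p (k - 1 - Suc i) t < p (k - 1 - i) t" by (rule fsys_less[OF p]) (use i in simp_all)
      moreover have "p (k - 1 - i) t \<le> t" using row[of "k - 1 - i" t] 2 i by simp
      moreover have "p' i t = t - p (k - 1 - i) t" "p' (Suc i) t = t - p (k - 1 - Suc i) t"
        using mid[of i t] mid[of "Suc i" t] 2 i by simp_all
      ultimately show ?thesis by linarith
    next
      case 3
      then show ?thesis using \<open>t0 \<le> t1\<close> i k by (simp add: p'_def)
    qed
  qed
  fix x :: "nat \<times> nat \<Rightarrow> real" and T
  have "(\<Sum>i<k. cell_wt (x \<circ> prod.swap) v1 v2 t (p' i t)) = (\<Sum>i<k. cell_wt x u1 u2 t (p i t))" for t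
  proof -
    consider "t < u1 + v1" | "u1 + v1 \<le> t" "t < t0" | "t0 \<le> t" "t \<le> t1" |
        "t1 < t" "t \<le> u2 + v2" | "t1 < t" "u2 + v2 < t"
      by linarith
    then show ?thesis
    proof cases
      case 1
      then have "t \<le> t0" using \<open>1 \<le> k\<close> by (simp add: t0_def)
      have "cell_wt x u1 u2 t (v1 + i) = 0" "cell_wt (x \<circ> prod.swap) v1 v2 t (u1 + i) = 0" for i
      proof -
        have "t - (v1 + i) < u1" "t - (u1 + i) < v1" using 1 \<open>1 \<le> u1\<close> \<open>1 \<le> v1\<close> by linarith+
        then show "cell_wt x u1 u2 t (v1 + i) = 0" "cell_wt (x \<circ> prod.swap) v1 v2 t (u1 + i) = 0"
          by (simp_all add: cell_wt_def)
      qed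
      then show ?thesis using start \<open>t \<le> t0\<close> by (simp add: p'_def)
    next
      case 2
      define d where "d = t - (u1 + v1)"
      have "t \<le> t0" using 2 by simp
      have d: "t = u1 + v1 + d" "d < k" using 2 by (simp_all add: d_def t0_def)
      have t: "t = v1 + u1 + d" using d by simp
      have "(\<Sum>i<k. cell_wt (x \<circ> prod.swap) v1 v2 t (p' i t)) =
          (\<Sum>i<k. cell_wt (x \<circ> prod.swap) v1 v2 (v1 + u1 + d) (u1 + i))"
        using \<open>t \<le> t0\<close> t by (simp add: p'_def)
      also have "\<dots> = (\<Sum>i\<le>d. x (u1 + i, v1 + (d - i)))"
        using sum_start_triangle[OF \<open>1 \<le> v1\<close> d(2) k(2), of "x \<circ> prod.swap" u1] by simp
      also have "\<dots> = (\<Sum>i<Suc d. x (u1 + (Suc d - Suc i), v1 + (d - (Suc d - Suc i))))"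
        unfolding lessThan_Suc_atMost[symmetric] by (rule sum.nat_diff_reindex[symmetric])
      also have "\<dots> = (\<Sum>i\<le>d. x (u1 + (d - i), v1 + i))"
        unfolding lessThan_Suc_atMost by (rule sum.cong) simp_all
      also have "\<dots> = (\<Sum>i<k. cell_wt x u1 u2 t (v1 + i))"
        using sum_start_triangle[OF \<open>1 \<le> u1\<close> d(2) k(1), of x v1] d(1) by simp
      also have "\<dots> = (\<Sum>i<k. cell_wt x u1 u2 t (p i t))"
        using start \<open>t \<le> t0\<close> by simp
      finally show ?thesis .
    next
      case 3
      have "(\<Sum>i<k. cell_wt (x \<circ> prod.swap) v1 v2 t (p' i t)) =
          (\<Sum>i<k. cell_wt x u1 u2 t (p (k - Suc i) t))"
      proof (rule sum.cong[OF refl])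
        fix i assume "i \<in> {..<k}"
        then have i: "i < k" "k - 1 - i < k" by auto
        have "p' i t = t - p (k - 1 - i) t" using mid[OF i(1)] 3 by simp
        moreover have "t - (t - p (k - 1 - i) t) = p (k - 1 - i) t" using row[OF i(2)] 3 by simp
        ultimately show "cell_wt (x \<circ> prod.swap) v1 v2 t (p' i t) =
            cell_wt x u1 u2 t (p (k - Suc i) t)"
          using row[OF i(2), of t] bnd[OF i(2), of t] 3 by (simp add: cell_wt_def)
      qed
      then show ?thesis
        using sum.nat_diff_reindex[of "\<lambda>i. cell_wt x u1 u2 t (p i t)" k] by simp
    next
      case 4
      define e where "e = u2 + v2 - t"
      have e: "t + e = u2 + v2" "t + e = v2 + u2" "e < k"
        using 4 k \<open>1 \<le> k\<close> by (auto simp: e_def t1_def)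
      have kk: "k \<le> v2 + 1" "k \<le> u2 + 1" using k by simp_all
      have "(\<Sum>i<k. cell_wt (x \<circ> prod.swap) v1 v2 t (p' i t)) =
          (\<Sum>i<k. cell_wt (x \<circ> prod.swap) v1 v2 t (u2 + 1 + i - k))"
        using 4 \<open>t0 \<le> t1\<close> by (simp add: p'_def)
      also have "\<dots> = (\<Sum>i\<le>e. x (u2 - i, v2 - (e - i)))"
        using sum_end_triangle[OF \<open>1 \<le> v1\<close> e(2,3) k(2) kk(2), of "x \<circ> prod.swap"] by simp
      also have "\<dots> = (\<Sum>i<Suc e. x (u2 - (Suc e - Suc i), v2 - (e - (Suc e - Suc i))))"
        unfolding lessThan_Suc_atMost[symmetric] by (rule sum.nat_diff_reindex[symmetric])
      also have "\<dots> = (\<Sum>i\<le>e. x (u2 - (e - i), v2 - i))"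
        unfolding lessThan_Suc_atMost by (rule sum.cong) simp_all
      also have "\<dots> = (\<Sum>i<k. cell_wt x u1 u2 t (v2 + 1 + i - k))"
        using sum_end_triangle[OF \<open>1 \<le> u1\<close> e(1,3) k(1) kk(1), of x] by simp
      also have "\<dots> = (\<Sum>i<k. cell_wt x u1 u2 t (p i t))"
        by (rule sum.cong[OF refl]) (use "end" 4 in simp)
      finally show ?thesis .
    next
      case 5
      have "cell_wt x u1 u2 t (p i t) = 0" "cell_wt (x \<circ> prod.swap) v1 v2 t (p' i t) = 0"
        if "i < k" for i
      proof -
        have "p i t = v2 + 1 + i - k" using "end" that 5 by simp
        then have "u2 < t - p i t" using that 5 by simp
        then show "cell_wt x u1 u2 t (p i t) = 0" by (simp add: cell_wt_def)
        have "p' i t = u2 + 1 + i - k" using 5 \<open>t0 \<le> t1\<close> by (simp add: p'_def)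
        then have "v2 < t - p' i t" using that 5 by simp
        then show "cell_wt (x \<circ> prod.swap) v1 v2 t (p' i t) = 0" by (simp add: cell_wt_def)
      qed
      then show ?thesis by simp
    qed
  qed
  then show "sys_wt (x \<circ> prod.swap) v1 v2 T k p' = sys_wt x u1 u2 T k p"
    by (simp add: sys_wt_def)
qed

lemma H_transpose_le:
  assumes "1 \<le> u1" "u1 \<le> u2" "1 \<le> v1" "v1 \<le> v2"
  shows "H u1 v1 u2 v2 x k \<le> H v1 u1 v2 u2 (x \<circ> prod.swap) k"
proof -
  define K where "K = min k (min (u2 + 1 - u1) (v2 + 1 - v1))"
  have "min k (min (v2 + 1 - v1) (u2 + 1 - u1)) = K" by (simp add: K_def ac_simps)
  then have H: "H u1 v1 u2 v2 x k = H u1 v1 u2 v2 x K"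
    "H v1 u1 v2 u2 (x \<circ> prod.swap) k = H v1 u1 v2 u2 (x \<circ> prod.swap) K"
    using H_min[of u1 v1 u2 v2 x k] H_min[of v1 u1 v2 u2 "x \<circ> prod.swap" k]
    unfolding K_def[symmetric] by simp_all
  show ?thesis
  proof (cases "K = 0")
    case True
    then show ?thesis unfolding H by (simp add: H_zero)
  next
    case False
    define T where "T = u2 + v2 + 1"
    have K: "1 \<le> K" "K \<le> u2 + 1 - u1" "K \<le> v2 + 1 - v1" using False by (auto simp: K_def)
    obtain p where p: "fsys u1 u2 v1 v2 K p" "H u1 v1 u2 v2 x K = sys_wt x u1 u2 T K p"
      by (rule H_attained[of u1 u2 K v2 v1 T x]) (use assms K in \<open>simp_all add: T_def\<close>)
    have K': "u1 + K \<le> u2 + 1" "v1 + K \<le> v2 + 1" using K assms by simp_all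
    obtain p' where p': "fsys v1 v2 u1 u2 K p'"
      "\<And>x T. sys_wt (x \<circ> prod.swap) v1 v2 T K p' = sys_wt x u1 u2 T K p"
      using fsys_transpose[OF p(1) assms(1,3) K(1) K'] by metis
    have "sys_wt (x \<circ> prod.swap) v1 v2 T K p' \<le> H v1 u1 v2 u2 (x \<circ> prod.swap) K"
      by (rule H_upper[OF p'(1)]) (use assms K in \<open>simp_all add: T_def\<close>)
    then show ?thesis unfolding H using p(2) p'(2) by simp
  qed
qed

lemma H_transpose:
  assumes "1 \<le> u1" "u1 \<le> u2" "1 \<le> v1" "v1 \<le> v2"
  shows "H u1 v1 u2 v2 x k = H v1 u1 v2 u2 (x \<circ> prod.swap) k"
proof (rule antisym)
  show "H u1 v1 u2 v2 x k \<le> H v1 u1 v2 u2 (x \<circ> prod.swap) k"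
    using H_transpose_le assms by simp
  have "x \<circ> prod.swap \<circ> prod.swap = x" by (simp add: fun_eq_iff)
  then show "H v1 u1 v2 u2 (x \<circ> prod.swap) k \<le> H u1 v1 u2 v2 x k"
    using H_transpose_le[OF assms(3,4,1,2), of "x \<circ> prod.swap" k] by simp
qed

section \<open>Systems with the maximal number of paths cover the rectangle\<close>

definition rect_sum :: "nat \<Rightarrow> nat \<Rightarrow> nat \<Rightarrow> nat \<Rightarrow> (nat \<times> nat \<Rightarrow> real) \<Rightarrow> real" where
  "rect_sum u1 v1 u2 v2 x = (\<Sum>c=v1..v2. \<Sum>i=u1..u2. x (i, c))"

lemma column_sum:
  assumes "1 \<le> u1" "u2 + c < T"
  shows "(\<Sum>t<T. cell_wt x u1 u2 t c) = (\<Sum>i=u1..u2. x (i, c))"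
proof -
  have "(\<Sum>i=u1..u2. x (i, c)) = (\<Sum>t\<in>{u1 + c..u2 + c}. x (t - c, c))"
    using sum.shift_bounds_cl_nat_ivl[of "\<lambda>t. x (t - c, c)" u1 c u2] by simp
  also have "\<dots> = (\<Sum>t<T. cell_wt x u1 u2 t c)"
  proof (rule sum.mono_neutral_cong_left)
    show "\<forall>t\<in>{..<T} - {u1 + c..u2 + c}. cell_wt x u1 u2 t c = 0"
      using assms by (auto simp: cell_wt_def)
    fix t assume "t \<in> {u1 + c..u2 + c}"
    then show "x (t - c, c) = cell_wt x u1 u2 t c" by (auto simp: cell_wt_def)
  qed (use assms in auto)
  finally show ?thesis by simp
qed

text \<open>With as many paths as columns every path starts and ends in the same column and has no
  choice. \<open>H_full\<close> adds the case of few rows by transposition.\<close>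

lemma H_all_columns:
  assumes "1 \<le> u1" "u1 \<le> u2" "1 \<le> v1" "v1 \<le> v2 + 1" "v2 + 1 - v1 \<le> u2 + 1 - u1" "v2 + 1 - v1 \<le> k"
  shows "H u1 v1 u2 v2 x k = rect_sum u1 v1 u2 v2 x"
proof -
  define K where "K = v2 + 1 - v1"
  have "min k (min (u2 + 1 - u1) (v2 + 1 - v1)) = K" using assms by (simp add: K_def)
  then have H: "H u1 v1 u2 v2 x k = H u1 v1 u2 v2 x K" using H_min[of u1 v1 u2 v2 x k] by simp
  define T where "T = u2 + v2 + 1"
  obtain p where p: "fsys u1 u2 v1 v2 K p" "H u1 v1 u2 v2 x K = sys_wt x u1 u2 T K p"
    by (rule H_attained[of u1 u2 K v2 v1 T x]) (use assms in \<open>simp_all add: T_def K_def\<close>)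
  have col: "p i t = v1 + i" if "i < K" for i t
    using strand_bounds[OF fsys_strand[OF p(1) that], of t] assms(4) by (simp add: K_def)
  have "H u1 v1 u2 v2 x k = (\<Sum>t<T. \<Sum>i<K. cell_wt x u1 u2 t (v1 + i))"
    unfolding H p(2) sys_wt_def using col by simp
  also have "\<dots> = (\<Sum>i<K. \<Sum>t<T. cell_wt x u1 u2 t (v1 + i))" by (rule sum.swap)
  also have "\<dots> = (\<Sum>i<K. \<Sum>j=u1..u2. x (j, v1 + i))"
  proof (rule sum.cong[OF refl])
    fix i assume "i \<in> {..<K}"
    then show "(\<Sum>t<T. cell_wt x u1 u2 t (v1 + i)) = (\<Sum>j=u1..u2. x (j, v1 + i))"
      by (intro column_sum assms(1)) (auto simp: K_def T_def)
  qed
  also have "\<dots> = (\<Sum>c=v1..v2. \<Sum>j=u1..u2. x (j, c))"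
    by (rule sum.reindex_bij_witness[of _ "\<lambda>c. c - v1" "\<lambda>i. v1 + i"]) (auto simp: K_def)
  finally show ?thesis by (simp add: rect_sum_def)
qed

lemma rect_sum_swap: "rect_sum v1 u1 v2 u2 (x \<circ> prod.swap) = rect_sum u1 v1 u2 v2 x"
  unfolding rect_sum_def by (subst sum.swap) simp

lemma H_full:
  assumes "1 \<le> u1" "u1 \<le> u2" "1 \<le> v1" "v1 \<le> v2 + 1" "min (u2 + 1 - u1) (v2 + 1 - v1) \<le> k"
  shows "H u1 v1 u2 v2 x k = rect_sum u1 v1 u2 v2 x"
proof (cases "v2 + 1 - v1 \<le> u2 + 1 - u1")
  case True
  then show ?thesis using assms by (intro H_all_columns) simp_all
next
  case False
  then have "v1 \<le> v2" using assms by simp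
  then have "H u1 v1 u2 v2 x k = H v1 u1 v2 u2 (x \<circ> prod.swap) k"
    by (intro H_transpose assms)
  also have "\<dots> = rect_sum v1 u1 v2 u2 (x \<circ> prod.swap)"
    by (rule H_all_columns) (use assms False \<open>v1 \<le> v2\<close> in simp_all)
  finally show ?thesis by (simp add: rect_sum_swap)
qed

lemma rect_sum_exchange:
  assumes "u < v"
  shows "rect_sum u1 u u2 (v - 1) x + rect_sum u1 (u + 1) u2 v x =
    rect_sum u1 u u2 v x + rect_sum u1 (u + 1) u2 (v - 1) x"
proof -
  define f where "f = (\<lambda>c. \<Sum>i=u1..u2. x (i, c))"
  have v: "v = Suc (v - 1)" using assms by simp
  have "sum f {u..v} = sum f {u..v - 1} + f v" "sum f {u + 1..v} = sum f {u + 1..v - 1} + f v"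
    using assms by (subst v, subst sum.nat_ivl_Suc', simp_all)+
  then show ?thesis unfolding rect_sum_def f_def by simp
qed

section \<open>The exchange identity and its toggle form\<close>

text \<open>A maximum of up to two optional terms. Its value 0 without terms is the convention for
  the empty maximum in a toggle, which makes it comparable with \<open>max_below\<close>.\<close>

definition guarded_max :: "bool \<Rightarrow> real \<Rightarrow> bool \<Rightarrow> real \<Rightarrow> real" where
  "guarded_max a x b y = (if a then if b then max x y else x else if b then y else 0)"

definition H_diff :: "nat \<Rightarrow> nat \<Rightarrow> nat \<Rightarrow> (nat \<times> nat \<Rightarrow> real) \<Rightarrow> nat \<Rightarrow> real" where
  "H_diff u r v x k = H 1 u r v x k - H 1 u r v x (k - 1)"

text \<open>The two sums of the identity are written relative to a common part, so that a term
  without enough rows or columns simply leaves the maximum. If \<open>u + k = v\<close>, everything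
  that does not cancel is a sum over a rectangle and the identity is inclusion-exclusion.\<close>

lemma H_exchange:
  assumes "1 \<le> r" "1 \<le> u" "1 \<le> k" "k \<le> r" "u + k \<le> v"
  shows "H 1 u r (v - 1) x k + H 1 (u + 1) r v x k = H 1 u r v x k + H 1 (u + 1) r (v - 1) x (k - 1) +
    guarded_max (k < r) (H_diff u r v x (k + 1)) (u + k < v) (H_diff (u + 1) r (v - 1) x k)"
proof (cases "u + k < v")
  case True
  define L L' M M' where "L = H 1 u r v x k" and "L' = H 1 u r v x (k + 1)"
    and "M = H 1 (u + 1) r (v - 1) x (k - 1)" and "M' = H 1 (u + 1) r (v - 1) x k"
  define S where "S = H 1 u r (v - 1) x k + H 1 (u + 1) r v x k"
  have le: "S \<le> L + M' \<or> k < r \<and> S \<le> L' + M"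
    using H_octahedron_le[of 1 r k u v x] assms True unfolding S_def L_def L'_def M_def M'_def by simp
  have cr: "L + M' \<le> S"
    using H_crossing_le[of 1 r k u v x] assms True unfolding S_def L_def M'_def by simp
  have ne: "k < r \<Longrightarrow> L' + M \<le> S"
    using H_nested_le[of 1 r k u v x] assms True unfolding S_def L'_def M_def by simp
  have "S = L + M + guarded_max (k < r) (L' - L) True (M' - M)"
    using le cr ne by (cases "k < r") (auto simp: guarded_max_def max_def)
  then show ?thesis
    using True by (simp add: S_def L_def L'_def M_def M'_def H_diff_def)
next
  case False
  then have v: "v = u + k" using assms by simp
  have "H 1 u r (v - 1) x k = rect_sum 1 u r (v - 1) x"
    by (rule H_full) (use assms v in simp_all)
  moreover have "H 1 (u + 1) r v x k = rect_sum 1 (u + 1) r v x"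
    by (rule H_full) (use assms v in simp_all)
  moreover have "H 1 (u + 1) r (v - 1) x (k - 1) = rect_sum 1 (u + 1) r (v - 1) x"
    by (rule H_full) (use assms v in simp_all)
  moreover have "H 1 u r v x (k + 1) = rect_sum 1 u r v x"
    by (rule H_full) (use assms v in simp_all)
  moreover have "H 1 u r v x k = rect_sum 1 u r v x" if "\<not> k < r"
    by (rule H_full) (use assms v that in simp_all)
  moreover have "u < v" using assms v by simp
  ultimately show ?thesis
    using rect_sum_exchange[of u v 1 r x] False
    by (cases "k < r") (simp_all add: guarded_max_def H_diff_def)
qed

lemma max_add_min_eq: "max a b + min a b = a + (b :: real)"
  by (simp add: max_def min_def)

text \<open>This is \<open>H_exchange\<close> for \<open>k\<close> minus the same for
  \<open>k - 1\<close>; the second maximum becomes a minimum through \<open>max_add_min_eq\<close>.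
  The result has the shape of a toggle: minimum plus maximum minus old value. For
  \<open>k = 1\<close> the minimum has a single term.\<close>

lemma H_diff_growth:
  assumes "1 \<le> r" "1 \<le> u" "1 \<le> k" "k \<le> r" "u + k \<le> v"
  shows "H_diff (u + 1) r v x k =
    (if k = 1 then H_diff u r v x 1 else min (H_diff u r v x k) (H_diff (u + 1) r (v - 1) x (k - 1))) +
    guarded_max (k < r) (H_diff u r v x (k + 1)) (u + k < v) (H_diff (u + 1) r (v - 1) x k) -
    H_diff u r (v - 1) x k"
proof (cases "k = 1")
  case True
  have "H 1 u r v x 0 = 0" "H 1 u r (v - 1) x 0 = 0" "H 1 (u + 1) r v x 0 = 0"
    "H 1 (u + 1) r (v - 1) x 0 = 0" by (simp_all add: H_zero)
  then show ?thesis
    using H_exchange[OF assms, of x] True by (simp add: H_diff_def)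
next
  case False
  have "H 1 u r (v - 1) x (k - 1) + H 1 (u + 1) r v x (k - 1) =
      H 1 u r v x (k - 1) + H 1 (u + 1) r (v - 1) x (k - 1 - 1) +
      guarded_max (k - 1 < r) (H_diff u r v x (k - 1 + 1)) (u + (k - 1) < v)
        (H_diff (u + 1) r (v - 1) x (k - 1))"
    by (rule H_exchange) (use assms False in simp_all)
  moreover have "k - 1 < r" "u + (k - 1) < v" "k - 1 + 1 = k" using assms False by simp_all
  ultimately have "H 1 u r (v - 1) x (k - 1) + H 1 (u + 1) r v x (k - 1) =
      H 1 u r v x (k - 1) + H 1 (u + 1) r (v - 1) x (k - 1 - 1) +
      max (H_diff u r v x k) (H_diff (u + 1) r (v - 1) x (k - 1))"
    by (simp add: guarded_max_def)
  moreover note H_exchange[OF assms, of x]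
  moreover have "H_diff u r v x k = H 1 u r v x k - H 1 u r v x (k - 1)"
    "H_diff (u + 1) r (v - 1) x (k - 1) =
      H 1 (u + 1) r (v - 1) x (k - 1) - H 1 (u + 1) r (v - 1) x (k - 1 - 1)"
    "H_diff (u + 1) r v x k = H 1 (u + 1) r v x k - H 1 (u + 1) r v x (k - 1)"
    "H_diff u r (v - 1) x k = H 1 u r (v - 1) x k - H 1 u r (v - 1) x (k - 1)"
    by (simp_all only: H_diff_def)
  moreover have "max (H_diff u r v x k) (H_diff (u + 1) r (v - 1) x (k - 1)) +
      min (H_diff u r v x k) (H_diff (u + 1) r (v - 1) x (k - 1)) =
      H_diff u r v x k + H_diff (u + 1) r (v - 1) x (k - 1)"
    by (rule max_add_min_eq)
  ultimately show ?thesis using False by simp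
qed

text \<open>\<open>H_exchange\<close> can be solved for the interval from \<open>u + 1\<close> to
  \<open>u + n\<close>: all other terms start at \<open>u\<close> or belong to a shorter interval.
  The starts \<open>u\<close> and \<open>u'\<close> may differ, which allows the comparison of
  shifted intervals.\<close>

lemma H_determined:
  assumes "1 \<le> r" "1 \<le> u" "1 \<le> u'"
    and eq: "\<And>n k. n \<le> N \<Longrightarrow> H 1 u r (u + n) x k = H 1 u' r (u' + n) y k"
    and "n \<le> N"
  shows "H 1 (u + 1) r (u + n) x k = H 1 (u' + 1) r (u' + n) y k"
  using \<open>n \<le> N\<close>
proof (induction n arbitrary: k)
  case 0
  then show ?case by (simp add: H_zero)
next
  case (Suc n)
  define K where "K = min k (min r (Suc n))"
  have K: "H 1 (u + 1) r (u + Suc n) x k = H 1 (u + 1) r (u + Suc n) x K"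
    "H 1 (u' + 1) r (u' + Suc n) y k = H 1 (u' + 1) r (u' + Suc n) y K"
    using H_min[of 1 "u + 1" r "u + Suc n" x k] H_min[of 1 "u' + 1" r "u' + Suc n" y k]
    unfolding K_def by simp_all
  show ?case
  proof (cases "K = 0")
    case True
    then show ?thesis unfolding K by (simp add: H_zero)
  next
    case False
    have "1 \<le> K" "K \<le> r" "K \<le> Suc n" using False by (auto simp: K_def)
    have IH: "H 1 (u + 1) r (u + n) x j = H 1 (u' + 1) r (u' + n) y j" for j
      using Suc by simp
    have e1: "H 1 u r (u + n) x j = H 1 u' r (u' + n) y j" for j using eq[of n] Suc.prems by simp
    have e2: "H 1 u r (u + Suc n) x j = H 1 u' r (u' + Suc n) y j" for j
      using eq[of "Suc n"] Suc.prems by simp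
    have "H 1 u r (u + Suc n - 1) x K + H 1 (u + 1) r (u + Suc n) x K =
        H 1 u r (u + Suc n) x K + H 1 (u + 1) r (u + Suc n - 1) x (K - 1) +
        guarded_max (K < r) (H_diff u r (u + Suc n) x (K + 1)) (u + K < u + Suc n)
          (H_diff (u + 1) r (u + Suc n - 1) x K)"
      by (rule H_exchange) (use assms \<open>1 \<le> K\<close> \<open>K \<le> r\<close> \<open>K \<le> Suc n\<close> in simp_all)
    moreover have "H 1 u' r (u' + Suc n - 1) y K + H 1 (u' + 1) r (u' + Suc n) y K =
        H 1 u' r (u' + Suc n) y K + H 1 (u' + 1) r (u' + Suc n - 1) y (K - 1) +
        guarded_max (K < r) (H_diff u' r (u' + Suc n) y (K + 1)) (u' + K < u' + Suc n)
          (H_diff (u' + 1) r (u' + Suc n - 1) y K)"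
      by (rule H_exchange) (use assms \<open>1 \<le> K\<close> \<open>K \<le> r\<close> \<open>K \<le> Suc n\<close> in simp_all)
    moreover have "u + Suc n - 1 = u + n" "u' + Suc n - 1 = u' + n" by simp_all
    ultimately show ?thesis
      unfolding K using e1 e2 IH by (simp add: H_diff_def)
  qed
qed

section \<open>Shifting columns, bordering and the local growth rule\<close>

text \<open>Time is row plus column, so a move to the next column delays everything by one
  unit.\<close>

lemma strand_shift:
  assumes "strand u1 u2 a b c"
  shows "strand u1 u2 (a + 1) (b + 1) (\<lambda>t. Suc (c (t - 1)))"
  unfolding strand_def
proof (intro conjI allI)
  show "Suc (c (0 - 1)) = a + 1" using strand_0[OF assms] by simp
  obtain S where S: "\<And>t. t \<ge> S \<Longrightarrow> c t = b" using strand_eventually[OF assms] by blast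
  have "Suc (c (t - 1)) = b + 1" if "Suc S \<le> t" for t using S[of "t - 1"] that by simp
  then show "\<forall>\<^sub>F t in sequentially. Suc (c (t - 1)) = b + 1"
    unfolding eventually_sequentially by blast
  fix t
  show "Suc (c (Suc t - 1)) = Suc (c (t - 1)) \<or> Suc (c (Suc t - 1)) = Suc (Suc (c (t - 1))) \<and>
    u1 \<le> t - Suc (c (t - 1)) \<and> t - Suc (c (t - 1)) \<le> u2"
    using strand_step[OF assms, of "t - 1"] by (cases t) simp_all
qed

lemma strand_unshift:
  assumes "strand u1 u2 (a + 1) (b + 1) c" "1 \<le> u1"
  shows "strand u1 u2 a b (\<lambda>t. c (Suc t) - 1)"
  unfolding strand_def
proof (intro conjI allI)
  show "c (Suc 0) - 1 = a" using strand_start[OF assms, of "Suc 0"] assms(2) by simp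
  obtain S where S: "\<And>t. t \<ge> S \<Longrightarrow> c t = b + 1" using strand_eventually[OF assms(1)] by blast
  have "c (Suc t) - 1 = b" if "S \<le> t" for t using S[of "Suc t"] that by simp
  then show "\<forall>\<^sub>F t in sequentially. c (Suc t) - 1 = b"
    unfolding eventually_sequentially by blast
  fix t
  have "c (Suc t) \<noteq> 0" using strand_bounds(1)[OF assms(1), of "Suc t"] by simp
  then obtain d where d: "c (Suc t) = Suc d" by (cases "c (Suc t)") auto
  show "c (Suc (Suc t)) - 1 = c (Suc t) - 1 \<or> c (Suc (Suc t)) - 1 = Suc (c (Suc t) - 1) \<and>
    u1 \<le> t - (c (Suc t) - 1) \<and> t - (c (Suc t) - 1) \<le> u2"
    using strand_step[OF assms(1), of "Suc t"] unfolding d by auto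
qed

text \<open>
  A column with one label \<open>b\<close> in the bottom row is put to the left of \<open>x\<close>. For large \<open>b\<close> an
  optimal system starts with the path that runs down the new column and along the bottom row,
  which keeps all the other paths above that row.
\<close>

definition bordered :: "nat \<Rightarrow> real \<Rightarrow> (nat \<times> nat \<Rightarrow> real) \<Rightarrow> nat \<times> nat \<Rightarrow> real" where
  "bordered r b x = (\<lambda>(i, c). if c = 1 then (if i = r then b else 0) else x (i, c - 1))"

lemma sys_wt_shift:
  assumes "1 \<le> u1" "\<And>i t. i < k \<Longrightarrow> 2 \<le> P i t"
  shows "sys_wt (bordered r b x) u1 u2 (Suc T) k P = sys_wt x u1 u2 T k (\<lambda>i t. P i (Suc t) - 1)"
proof -
  have "cell_wt (bordered r b x) u1 u2 (Suc t) (P i (Suc t)) = cell_wt x u1 u2 t (P i (Suc t) - 1)"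
    if "i < k" for i t
    using assms(2)[OF that, of "Suc t"] by (simp add: cell_wt_def bordered_def)
  moreover have "cell_wt (bordered r b x) u1 u2 0 (P i 0) = 0" for i
    using assms(1) by (simp add: cell_wt_def)
  ultimately show ?thesis unfolding sys_wt_def by (subst sum.lessThan_Suc_shift) simp
qed

lemma H_bordered_shift:
  assumes "1 \<le> u1" "u1 \<le> u2" "1 \<le> v1"
  shows "H u1 (v1 + 1) u2 (v2 + 1) (bordered r b x) k = H u1 v1 u2 v2 x k"
proof -
  define K where "K = min k (min (u2 + 1 - u1) (v2 + 1 - v1))"
  have K: "K \<le> u2 + 1 - u1" "K \<le> v2 + 1 - v1" "K \<le> v2 + 1 + 1 - (v1 + 1)" by (auto simp: K_def)
  have "min k (min (u2 + 1 - u1) (v2 + 1 + 1 - (v1 + 1))) = K" by (simp add: K_def)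
  then have H: "H u1 (v1 + 1) u2 (v2 + 1) (bordered r b x) k =
      H u1 (v1 + 1) u2 (v2 + 1) (bordered r b x) K" "H u1 v1 u2 v2 x k = H u1 v1 u2 v2 x K"
    using H_min[of u1 "v1 + 1" u2 "v2 + 1" "bordered r b x" k] H_min[of u1 v1 u2 v2 x k]
    unfolding K_def[symmetric] by simp_all
  define T where "T = u2 + v2 + 1"
  have T: "u2 + v2 < T" "u2 + (v2 + 1) < Suc T" by (simp_all add: T_def)
  have ends: "v1 + 1 + i = v1 + i + 1" "v2 + 1 + 1 + i - K = v2 + 1 + i - K + 1" for i
    using K(2) assms by simp_all
  obtain P where P: "fsys u1 u2 (v1 + 1) (v2 + 1) K P"
    "H u1 (v1 + 1) u2 (v2 + 1) (bordered r b x) K = sys_wt (bordered r b x) u1 u2 (Suc T) K P"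
    by (rule H_attained[OF assms(1,2) K(1,3) T(2)])
  have two: "2 \<le> P i t" if "i < K" for i t
    using strand_bounds(1)[OF fsys_strand[OF P(1) that], of t] assms(3) by simp
  have "fsys u1 u2 v1 v2 K (\<lambda>i t. P i (Suc t) - 1)"
  proof (rule fsysI)
    fix i assume "i < K"
    from fsys_strand[OF P(1) this] show "strand u1 u2 (v1 + i) (v2 + 1 + i - K) (\<lambda>t. P i (Suc t) - 1)"
      unfolding ends by (rule strand_unshift) (rule assms(1))
  next
    fix i t assume "Suc i < K"
    then show "P i (Suc t) - 1 < P (Suc i) (Suc t) - 1"
      using fsys_less[OF P(1), of i "Suc i" "Suc t"] two[of i "Suc t"] by simp
  qed
  from H_upper[OF this assms(1,2) K(1,2) T(1), of x]
  have le: "H u1 (v1 + 1) u2 (v2 + 1) (bordered r b x) K \<le> H u1 v1 u2 v2 x K"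
    using P(2) sys_wt_shift[OF assms(1), of K P r b x u2 T] two by simp
  obtain p where p: "fsys u1 u2 v1 v2 K p" "H u1 v1 u2 v2 x K = sys_wt x u1 u2 T K p"
    by (rule H_attained[OF assms(1,2) K(1,2) T(1)])
  define Q where "Q = (\<lambda>i t. Suc (p i (t - 1)))"
  have two': "2 \<le> Q i t" if "i < K" for i t
    using strand_bounds(1)[OF fsys_strand[OF p(1) that], of "t - 1"] assms(3) by (simp add: Q_def)
  have "fsys u1 u2 (v1 + 1) (v2 + 1) K Q"
  proof (rule fsysI)
    fix i assume "i < K"
    from strand_shift[OF fsys_strand[OF p(1) this]]
    show "strand u1 u2 (v1 + 1 + i) (v2 + 1 + 1 + i - K) (Q i)"
      unfolding ends Q_def .
  next
    fix i t assume "Suc i < K"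
    then show "Q i t < Q (Suc i) t"
      using fsys_less[OF p(1), of i "Suc i" "t - 1"] by (simp add: Q_def)
  qed
  from H_upper[OF this assms(1,2) K(1,3) T(2), of "bordered r b x"]
  have "H u1 v1 u2 v2 x K \<le> H u1 (v1 + 1) u2 (v2 + 1) (bordered r b x) K"
    using p(2) sys_wt_shift[OF assms(1), of K Q r b x u2 T] two' by (simp add: Q_def)
  with le show ?thesis unfolding H by simp
qed

text \<open>At time \<open>Suc r\<close> column 1 means row \<open>r\<close>. From there the strand
  has to run along row \<open>r\<close> without a pause, since a step down would leave the rows and
  freeze its column.\<close>

lemma border_path:
  assumes c: "strand 1 r 1 e c" "c (Suc r) = 1" and "1 \<le> e"
  shows "c t = max 1 (min e (t - r))"
proof (cases "t \<le> Suc r")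
  case True
  then have "c t = 1"
    using strand_mono[OF c(1) True] strand_bounds(1)[OF c(1), of t] c(2) by simp
  then show ?thesis using True \<open>1 \<le> e\<close> by simp
next
  case False
  have "c (Suc r + d) \<le> Suc d" for d
  proof (induction d)
    case 0
    then show ?case using c(2) by simp
  next
    case (Suc d)
    then show ?case using strand_step[OF c(1), of "Suc r + d"] by auto
  qed
  from this[of "t - Suc r"] have "c t \<le> t - r" using False by simp
  moreover have "c t \<le> e" using strand_bounds(2)[OF c(1)] .
  moreover have "c t = e \<or> t - r \<le> c t"
    using strand_frozen[OF c(1), of t] by (cases "r < t - c t") auto
  ultimately show ?thesis using False \<open>1 \<le> e\<close> by auto
qed

lemma border_path_wt:
  assumes c: "\<And>t. c t = max 1 (min e (t - r))" and "1 \<le> r" "1 \<le> e" "r + e < T"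
  shows "(\<Sum>t<T. cell_wt (bordered r b x) 1 r t (c t)) = b + (\<Sum>j=1..e - 1. x (r, j))"
proof -
  have "(\<Sum>t<T. cell_wt (bordered r b x) 1 r t (c t)) =
      (\<Sum>t\<in>{Suc r..r + e}. cell_wt (bordered r b x) 1 r t (c t))"
  proof (rule sum.mono_neutral_right)
    show "{Suc r..r + e} \<subseteq> {..<T}" using assms(4) by auto
    show "\<forall>t\<in>{..<T} - {Suc r..r + e}. cell_wt (bordered r b x) 1 r t (c t) = 0"
    proof
      fix t assume "t \<in> {..<T} - {Suc r..r + e}"
      then consider "t \<le> r" | "r + e < t" by fastforce
      then show "cell_wt (bordered r b x) 1 r t (c t) = 0"
      proof cases
        case 1
        then have "c t = 1" using assms(3) c[of t] by simp
        moreover have "t - 1 < r" using 1 assms(2) by linarith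
        ultimately show ?thesis by (simp add: cell_wt_def bordered_def)
      next
        case 2
        then have "c t = e" using assms(3) c[of t] by simp
        moreover have "r < t - e" using 2 by linarith
        ultimately show ?thesis by (simp add: cell_wt_def)
      qed
    qed
  qed simp
  also have "\<dots> = (\<Sum>t\<in>{Suc r..r + e}. bordered r b x (r, t - r))"
  proof (rule sum.cong[OF refl])
    fix t assume "t \<in> {Suc r..r + e}"
    then have "c t = t - r" "t - (t - r) = r" using assms(3) c[of t] by auto
    then show "cell_wt (bordered r b x) 1 r t (c t) = bordered r b x (r, t - r)"
      using assms(2) by (simp add: cell_wt_def)
  qed
  also have "\<dots> = (\<Sum>j\<in>{1..e}. bordered r b x (r, j))"
    using sum.shift_bounds_cl_nat_ivl[of "\<lambda>t. bordered r b x (r, t - r)" 1 r e]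
    by (simp add: add.commute)
  also have "\<dots> = b + (\<Sum>j\<in>{Suc 1..e}. bordered r b x (r, j))"
    using assms(3) by (subst sum.atLeast_Suc_atMost) (simp_all add: bordered_def)
  also have "(\<Sum>j\<in>{Suc 1..e}. bordered r b x (r, j)) = (\<Sum>j\<in>{Suc 1..Suc (e - 1)}. bordered r b x (r, j))"
    using assms(3) by simp
  also have "\<dots> = (\<Sum>j=1..e - 1. bordered r b x (r, Suc j))"
    by (rule sum.shift_bounds_cl_Suc_ivl)
  also have "\<dots> = (\<Sum>j=1..e - 1. x (r, j))"
    by (rule sum.cong) (auto simp: bordered_def)
  finally show ?thesis .
qed

text \<open>A strand whose horizontal steps end by row \<open>r - 1\<close> visits row
  \<open>r\<close> exactly once, in its final column.\<close>

lemma cell_wt_last_row: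
  assumes c: "strand 1 (r - 1) a e c" and "1 \<le> r" "r + e < T"
  shows "(\<Sum>t<T. cell_wt y 1 r t (c t)) = (\<Sum>t<T. cell_wt y 1 (r - 1) t (c t)) + y (r, e)"
proof -
  have "cell_wt y 1 r t (c t) = cell_wt y 1 (r - 1) t (c t) + (if t = r + e then y (r, e) else 0)" for t
  proof -
    have "t - c t = r \<longleftrightarrow> t = r + e"
    proof
      assume t: "t - c t = r"
      then have "c t = e" using strand_frozen[OF c, of t] assms(2) by simp
      then show "t = r + e" using t assms(2) by simp
    next
      assume t: "t = r + e"
      then have "c t = e" using strand_end[OF c, of t] by simp
      then show "t - c t = r" using t by simp
    qed
    moreover have "c t = e" if "t = r + e" using strand_end[OF c, of t] that by simp
    ultimately show ?thesis using assms(2)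
      by (cases "t = r + e") (auto simp: cell_wt_def)
  qed
  then have "(\<Sum>t<T. cell_wt y 1 r t (c t)) =
      (\<Sum>t<T. cell_wt y 1 (r - 1) t (c t)) + (\<Sum>t<T. if t = r + e then y (r, e) else 0)"
    by (simp add: sum.distrib)
  also have "(\<Sum>t<T. if t = r + e then y (r, e) else 0) = y (r, e)"
    using assms(3) by (simp add: sum.delta)
  finally show ?thesis .
qed

text \<open>The first strand covers the bottom row up to its own end, and every other strand visits
  that row only in its final column. Together they cover the bottom row once; what remains is a
  system of \<open>k\<close> paths in the rows above.\<close>

lemma bordered_sys:
  assumes P: "fsys 1 r 1 (v + 1) (k + 1) P" and first: "P 0 (Suc r) = 1"
    and "1 \<le> r" "k \<le> v" "r + v + 1 < Suc T"
  defines "p \<equiv> (\<lambda>i t. P (Suc i) (Suc t) - 1)"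
  shows "fsys 1 (r - 1) 1 v k p"
    and "sys_wt (bordered r b x) 1 r (Suc T) (k + 1) P =
      b + (\<Sum>j=1..v. x (r, j)) + sys_wt x 1 (r - 1) T k p"
proof -
  have end_eq: "v + 1 + 1 + Suc i - (k + 1) = v + 1 + i - k + 1" for i
    using \<open>k \<le> v\<close> by simp
  have upper: "strand 1 (r - 1) (1 + i + 1) (v + 1 + i - k + 1) (P (Suc i))" if "i < k" for i
  proof -
    have st: "strand 1 r (1 + Suc i) (v + 1 + 1 + Suc i - (k + 1)) (P (Suc i))"
      by (rule fsys_strand[OF P]) (use that in simp)
    have pst: "strand 1 r (1 + i) (v + 1 + 1 + i - (k + 1)) (P i)"
      by (rule fsys_strand[OF P]) (use that in simp)
    \<comment> \<open>When strand \<open>Suc i\<close> is in row \<open>r\<close>, strand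
      \<open>i\<close> is to its left and thus already below row \<open>r\<close>, parked in its
      final column. So strand \<open>Suc i\<close> has reached its final column, too.\<close>
    have no_step: "t - P (Suc i) t \<noteq> r" if "P (Suc i) (Suc t) = Suc (P (Suc i) t)" for t
    proof
      assume row: "t - P (Suc i) t = r"
      have lt: "P i t < P (Suc i) t" by (rule fsys_less[OF P]) (use \<open>i < k\<close> in simp_all)
      then have "r < t - P i t" using row \<open>1 \<le> r\<close> by simp
      from strand_frozen[OF pst this] lt have "v + 1 + 1 + Suc i - (k + 1) \<le> P (Suc i) t"
        using \<open>k \<le> v\<close> by simp
      then show False using strand_bounds(2)[OF st, of "Suc t"] that by simp
    qed
    have "strand 1 (r - 1) (1 + Suc i) (v + 1 + 1 + Suc i - (k + 1)) (P (Suc i))"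
      unfolding strand_def
    proof (intro conjI allI)
      show "P (Suc i) 0 = 1 + Suc i" using strand_0[OF st] .
      show "\<forall>\<^sub>F t in sequentially. P (Suc i) t = v + 1 + 1 + Suc i - (k + 1)"
        using st unfolding strand_def by blast
      fix t
      show "P (Suc i) (Suc t) = P (Suc i) t \<or> P (Suc i) (Suc t) = Suc (P (Suc i) t) \<and>
          1 \<le> t - P (Suc i) t \<and> t - P (Suc i) t \<le> r - 1"
        using strand_step[OF st, of t] no_step[of t] by linarith
    qed
    then show ?thesis unfolding end_eq by simp
  qed
  have two: "2 \<le> P (Suc i) t" if "i < k" for i t
    using strand_bounds(1)[OF upper[OF that], of t] by simp
  show "fsys 1 (r - 1) 1 v k p"
  proof (rule fsysI)
    fix i assume "i < k"
    from upper[OF this] show "strand 1 (r - 1) (1 + i) (v + 1 + i - k) (p i)"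
      unfolding p_def by (rule strand_unshift) simp
  next
    fix i t assume i: "Suc i < k"
    have "P (Suc i) (Suc t) < P (Suc (Suc i)) (Suc t)"
      by (rule fsys_less[OF P]) (use i in simp_all)
    then show "p i t < p (Suc i) t" using two[of i "Suc t"] i by (simp add: p_def)
  qed
  have st0: "strand 1 r 1 (v + 1 - k) (P 0)" using fsys_strand[OF P, of 0] by simp
  have e: "1 \<le> v + 1 - k" "r + (v + 1 - k) < Suc T" using assms(4,5) by simp_all
  have P0: "(\<Sum>t<Suc T. cell_wt (bordered r b x) 1 r t (P 0 t)) = b + (\<Sum>j=1..v - k. x (r, j))"
    using border_path_wt[OF border_path[OF st0 first e(1)] \<open>1 \<le> r\<close> e, of b x] by simp
  have Pi: "(\<Sum>t<Suc T. cell_wt (bordered r b x) 1 r t (P (Suc i) t)) =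
      (\<Sum>t<Suc T. cell_wt (bordered r b x) 1 (r - 1) t (P (Suc i) t)) + x (r, v + 1 + i - k)"
    if "i < k" for i
  proof -
    have "r + (v + 1 + i - k + 1) < Suc T" using that assms(5) \<open>k \<le> v\<close> by simp
    from cell_wt_last_row[OF upper[OF that] \<open>1 \<le> r\<close> this, of "bordered r b x"]
    show ?thesis using that \<open>k \<le> v\<close> by (simp add: bordered_def)
  qed
  have "sys_wt (bordered r b x) 1 r (Suc T) (k + 1) P =
      (\<Sum>i<Suc k. \<Sum>t<Suc T. cell_wt (bordered r b x) 1 r t (P i t))"
    unfolding sys_wt_def Suc_eq_plus1[symmetric] by (rule sum.swap)
  also have "\<dots> = b + (\<Sum>j=1..v - k. x (r, j)) +
      (\<Sum>i<k. \<Sum>t<Suc T. cell_wt (bordered r b x) 1 r t (P (Suc i) t))"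
    unfolding sum.lessThan_Suc_shift[of _ k] P0 ..
  also have "(\<Sum>i<k. \<Sum>t<Suc T. cell_wt (bordered r b x) 1 r t (P (Suc i) t)) =
      (\<Sum>i<k. (\<Sum>t<Suc T. cell_wt (bordered r b x) 1 (r - 1) t (P (Suc i) t)) + x (r, v + 1 + i - k))"
    by (rule sum.cong[OF refl]) (use Pi in simp)
  also have "\<dots> = (\<Sum>i<k. \<Sum>t<Suc T. cell_wt (bordered r b x) 1 (r - 1) t (P (Suc i) t)) +
      (\<Sum>i<k. x (r, v + 1 + i - k))"
    by (rule sum.distrib)
  also have "(\<Sum>i<k. \<Sum>t<Suc T. cell_wt (bordered r b x) 1 (r - 1) t (P (Suc i) t)) =
      sys_wt (bordered r b x) 1 (r - 1) (Suc T) k (\<lambda>i. P (Suc i))"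
    unfolding sys_wt_def by (rule sum.swap)
  also have "\<dots> = sys_wt x 1 (r - 1) T k p"
    unfolding p_def by (rule sys_wt_shift) (use two in simp_all)
  also have "(\<Sum>i<k. x (r, v + 1 + i - k)) = (\<Sum>j=v - k + 1..v. x (r, j))"
    by (rule sum.reindex_bij_witness[of _ "\<lambda>j. j + k - v - 1" "\<lambda>i. v + 1 + i - k"])
      (use \<open>k \<le> v\<close> in auto)
  finally have "sys_wt (bordered r b x) 1 r (Suc T) (k + 1) P =
      b + (sum (\<lambda>j. x (r, j)) {1..v - k} + sum (\<lambda>j. x (r, j)) {v - k + 1..v}) +
      sys_wt x 1 (r - 1) T k p"
    by simp
  also have "sum (\<lambda>j. x (r, j)) {1..v - k} + sum (\<lambda>j. x (r, j)) {v - k + 1..v} =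
      sum (\<lambda>j. x (r, j)) {1..v}"
    using sum.ub_add_nat[of 1 "v - k" "\<lambda>j. x (r, j)" k] \<open>k \<le> v\<close> by simp
  finally show "sys_wt (bordered r b x) 1 r (Suc T) (k + 1) P =
      b + (\<Sum>j=1..v. x (r, j)) + sys_wt x 1 (r - 1) T k p" .
qed

text \<open>The assumption on \<open>b\<close> makes the right-hand side at least as large as the
  weight of any system that misses the cell carrying \<open>b\<close>. Systems that visit it are
  described by \<open>bordered_sys\<close>.\<close>

lemma H_bordered:
  assumes "1 \<le> r" "k \<le> v" "k < r"
    and b: "H 1 1 r (v + 1) (bordered r 0 x) (k + 1) \<le>
      b + (\<Sum>j=1..v. x (r, j)) + H 1 1 (r - 1) v x k"
  shows "H 1 1 r (v + 1) (bordered r b x) (k + 1) =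
    b + (\<Sum>j=1..v. x (r, j)) + H 1 1 (r - 1) v x k"
proof -
  define T where "T = r + v + 1"
  have T: "r + (v + 1) < Suc T" "r + v + 1 < Suc T" "r - 1 + v < T" by (simp_all add: T_def)
  have k: "k + 1 \<le> r + 1 - 1" "k + 1 \<le> v + 1 + 1 - 1" "k \<le> r - 1 + 1 - 1" "k \<le> v + 1 - 1"
    using assms(2,3) by simp_all
  have upper: "sys_wt x 1 (r - 1) T k p \<le> H 1 1 (r - 1) v x k" if "fsys 1 (r - 1) 1 v k p" for p
  proof (cases "k = 0")
    case True
    then show ?thesis by (simp add: sys_wt_def H_zero)
  next
    case False
    then have "1 \<le> r - 1" using assms(3) by simp
    then show ?thesis by (rule H_upper[OF that order_refl _ k(3,4) T(3)])
  qed
  obtain P where P: "fsys 1 r 1 (v + 1) (k + 1) P"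
    "H 1 1 r (v + 1) (bordered r b x) (k + 1) = sys_wt (bordered r b x) 1 r (Suc T) (k + 1) P"
    by (rule H_attained[OF order_refl \<open>1 \<le> r\<close> k(1,2) T(1)])
  have le: "H 1 1 r (v + 1) (bordered r b x) (k + 1) \<le>
      b + (\<Sum>j=1..v. x (r, j)) + H 1 1 (r - 1) v x k"
  proof (cases "P 0 (Suc r) = 1")
    case True
    show ?thesis
      using upper[OF bordered_sys(1)[OF P(1) True assms(1,2) T(2)]]
        bordered_sys(2)[OF P(1) True assms(1,2) T(2), of b x] P(2) by simp
  next
    case False
    have "cell_wt (bordered r b x) 1 r t (P i t) = cell_wt (bordered r 0 x) 1 r t (P i t)"
      if "i < k + 1" for i t
    proof -
      have "\<not> (P i t = 1 \<and> t - P i t = r)"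
      proof
        assume *: "P i t = 1 \<and> t - P i t = r"
        then have t: "t = Suc r" using assms(1) by linarith
        have "1 + i \<le> P i t" using strand_bounds(1)[OF fsys_strand[OF P(1) that], of t] .
        then have "i = 0" using * by simp
        then show False using False * t by simp
      qed
      then show ?thesis by (auto simp: cell_wt_def bordered_def)
    qed
    then have "sys_wt (bordered r b x) 1 r (Suc T) (k + 1) P =
        sys_wt (bordered r 0 x) 1 r (Suc T) (k + 1) P"
      unfolding sys_wt_def by (intro sum.cong refl) simp
    moreover have "sys_wt (bordered r 0 x) 1 r (Suc T) (k + 1) P \<le>
        H 1 1 r (v + 1) (bordered r 0 x) (k + 1)"
      by (rule H_upper[OF P(1) order_refl \<open>1 \<le> r\<close> k(1,2) T(1)])
    ultimately show ?thesis using P(2) b by simp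
  qed
  have "\<exists>p. fsys 1 (r - 1) 1 v k p \<and> H 1 1 (r - 1) v x k = sys_wt x 1 (r - 1) T k p"
  proof (cases "k = 0")
    case True
    then show ?thesis by (simp add: sys_wt_def H_zero fsys_def)
  next
    case False
    then have "1 \<le> r - 1" using assms(3) by simp
    from H_attained[OF order_refl this k(3,4) T(3), of x] show ?thesis by metis
  qed
  then obtain p where p: "fsys 1 (r - 1) 1 v k p" "H 1 1 (r - 1) v x k = sys_wt x 1 (r - 1) T k p"
    by blast
  \<comment> \<open>The converse of \<open>bordered_sys\<close>: the border path is put in front of
    the shifted optimal system.\<close>
  define Q where "Q = (\<lambda>i t. if i = 0 then max 1 (min (v + 1 - k) (t - r)) else Suc (p (i - 1) (t - 1)))"
  have Q0: "Q 0 t = max 1 (min (v + 1 - k) (t - r))" and QS: "Q (Suc i) t = Suc (p i (t - 1))" for i t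
    by (simp_all add: Q_def)
  have Q: "fsys 1 r 1 (v + 1) (k + 1) Q"
  proof (rule fsysI)
    fix i assume i: "i < k + 1"
    show "strand 1 r (1 + i) (v + 1 + 1 + i - (k + 1)) (Q i)"
    proof (cases i)
      case 0
      have "strand 1 r 1 (v + 1 - k) (Q 0)"
        unfolding strand_def
      proof (intro conjI allI)
        show "Q 0 0 = 1" by (simp add: Q0)
        have "Q 0 t = v + 1 - k" if "r + v + 1 \<le> t" for t using that assms(2) by (simp add: Q0)
        then show "\<forall>\<^sub>F t in sequentially. Q 0 t = v + 1 - k"
          unfolding eventually_sequentially by blast
        fix t
        consider "t - r < 1" | "1 \<le> t - r" "t - r < v + 1 - k" | "v + 1 - k \<le> t - r" by linarith
        then show "Q 0 (Suc t) = Q 0 t \<or> Q 0 (Suc t) = Suc (Q 0 t) \<and> 1 \<le> t - Q 0 t \<and> t - Q 0 t \<le> r"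
        proof cases
          case 1
          then show ?thesis using assms(2) by (simp add: Q0)
        next
          case 2
          then have "Q 0 t = t - r" "Q 0 (Suc t) = Suc (t - r)" by (simp_all add: Q0 Suc_diff_le)
          then show ?thesis using 2 assms(1) by simp
        next
          case 3
          then have "v + 1 - k \<le> Suc t - r" by simp
          then show ?thesis using 3 by (simp add: Q0)
        qed
      qed
      then show ?thesis using 0 by simp
    next
      case (Suc j)
      then have j: "j < k" using i by simp
      have st: "strand 1 (r - 1) (1 + j + 1) (v + 1 + j - k + 1) (Q (Suc j))"
        unfolding QS by (rule strand_shift[OF fsys_strand[OF p(1) j]])
      have "strand 1 r (1 + j + 1) (v + 1 + j - k + 1) (Q (Suc j))"
        unfolding strand_def
      proof (intro conjI allI)
        show "Q (Suc j) 0 = 1 + j + 1" using strand_0[OF st] .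
        show "\<forall>\<^sub>F t in sequentially. Q (Suc j) t = v + 1 + j - k + 1"
          using st unfolding strand_def by blast
        fix t
        show "Q (Suc j) (Suc t) = Q (Suc j) t \<or> Q (Suc j) (Suc t) = Suc (Q (Suc j) t) \<and>
            1 \<le> t - Q (Suc j) t \<and> t - Q (Suc j) t \<le> r"
          using strand_step[OF st, of t] by linarith
      qed
      moreover have "1 + i = 1 + j + 1" "v + 1 + 1 + i - (k + 1) = v + 1 + j - k + 1"
        using Suc assms(2) by simp_all
      ultimately show ?thesis using Suc by simp
    qed
  next
    fix i t assume i: "Suc i < k + 1"
    show "Q i t < Q (Suc i) t"
    proof (cases i)
      case 0
      then have k0: "0 < k" using i by simp
      have st: "strand 1 (r - 1) (1 + 0) (v + 1 + 0 - k) (p 0)" by (rule fsys_strand[OF p(1) k0])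
      have "1 \<le> p 0 (t - 1)" using strand_bounds(1)[OF st, of "t - 1"] by simp
      moreover have "p 0 (t - 1) = v + 1 - k \<or> t - r \<le> p 0 (t - 1)"
      proof (cases "r - 1 < t - 1 - p 0 (t - 1)")
        case True
        from strand_frozen[OF st this] show ?thesis by simp
      next
        case False
        then have "t - r \<le> p 0 (t - 1)" using assms(1) by linarith
        then show ?thesis ..
      qed
      ultimately show ?thesis unfolding 0 Q0 QS by (simp add: max_def min_def) linarith?
    next
      case (Suc j)
      have "p j (t - 1) < p (Suc j) (t - 1)" by (rule fsys_less[OF p(1)]) (use i Suc in simp_all)
      then show ?thesis unfolding Suc QS by simp
    qed
  qed
  have first: "Q 0 (Suc r) = 1" using assms(2) by (simp add: Q0)
  have "sys_wt (bordered r b x) 1 r (Suc T) (k + 1) Q =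
      b + (\<Sum>j=1..v. x (r, j)) + sys_wt x 1 (r - 1) T k p"
    using bordered_sys(2)[OF Q first assms(1,2) T(2), of b x] by (simp add: QS)
  moreover have "sys_wt (bordered r b x) 1 r (Suc T) (k + 1) Q \<le>
      H 1 1 r (v + 1) (bordered r b x) (k + 1)"
    by (rule H_upper[OF Q order_refl \<open>1 \<le> r\<close> k(1,2) T(1)])
  ultimately show ?thesis using le p(2) by simp
qed

text \<open>Several bordered statistics are compared in \<open>H_diff_corner\<close>, so one
  \<open>b\<close> has to serve all \<open>v\<close> and \<open>k\<close>. A sum of the finitely
  many absolute defects dominates each of them.\<close>

lemma H_bordered_large:
  assumes "1 \<le> r"
  obtains b where "\<And>v k. v \<le> V \<Longrightarrow> k \<le> v \<Longrightarrow> k < r \<Longrightarrow>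
    H 1 1 r (v + 1) (bordered r b x) (k + 1) = b + (\<Sum>j=1..v. x (r, j)) + H 1 1 (r - 1) v x k"
proof -
  define f where "f = (\<lambda>(v, k). \<bar>H 1 1 r (v + 1) (bordered r 0 x) (k + 1) - (\<Sum>j=1..v. x (r, j)) -
    H 1 1 (r - 1) v x k\<bar>)"
  define b where "b = sum f ({..V} \<times> {..V})"
  have bound: "f (v, k) \<le> b" if "v \<le> V" "k \<le> v" for v k
    unfolding b_def by (rule member_le_sum) (use that in \<open>auto simp: f_def\<close>)
  have large: "H 1 1 r (v + 1) (bordered r 0 x) (k + 1) \<le> b + (\<Sum>j=1..v. x (r, j)) + H 1 1 (r - 1) v x k"
    if "v \<le> V" "k \<le> v" for v k
    using bound[OF that] unfolding f_def prod.case by linarith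
  show ?thesis
  proof (rule that[of b])
    fix v k assume "v \<le> V" "k \<le> v" "k < r"
    with large[of v k] show "H 1 1 r (v + 1) (bordered r b x) (k + 1) =
        b + (\<Sum>j=1..v. x (r, j)) + H 1 1 (r - 1) v x k"
      by (intro H_bordered assms)
  qed
qed

text \<open>The local growth rule of RSK, obtained from \<open>H_diff_growth\<close> for the
  bordered array \<open>y\<close>. On columns from 2 on, \<open>y\<close> has the statistics of
  \<open>x\<close> with \<open>a\<close> rows; on columns from 1 on, by the choice of
  \<open>B\<close>, those with \<open>a - 1\<close> rows and one path fewer, up to a constant that
  cancels in the increments. For \<open>k = 1\<close> it leaves the difference of two partial sums
  of row \<open>a\<close>, that is \<open>x (a, b)\<close>.\<close>

lemma H_diff_corner:
  assumes "1 \<le> k" "k \<le> a" "k \<le> b"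
  shows "H_diff 1 a b x k =
    (if k = 1 then x (a, b)
     else min (H_diff 1 (a - 1) b x (k - 1)) (H_diff 1 a (b - 1) x (k - 1)) -
       H_diff 1 (a - 1) (b - 1) x (k - 1)) +
    guarded_max (k < a) (H_diff 1 (a - 1) b x k) (k < b) (H_diff 1 a (b - 1) x k)"
proof -
  have a: "1 \<le> a" using assms by simp
  obtain B where B: "\<And>v k. v \<le> b \<Longrightarrow> k \<le> v \<Longrightarrow> k < a \<Longrightarrow>
    H 1 1 a (v + 1) (bordered a B x) (k + 1) = B + (\<Sum>j=1..v. x (a, j)) + H 1 1 (a - 1) v x k"
    using H_bordered_large[OF a, of b x] by metis
  define y where "y = bordered a B x"
  have shift: "H_diff 2 a (v + 1) y j = H_diff 1 a v x j" for v j
  proof -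
    have "H 1 2 a (v + 1) (bordered a B x) i = H 1 1 a v x i" for i
      using H_bordered_shift[of 1 a 1 v a B x i] a by (simp add: numeral_2_eq_2)
    then show ?thesis unfolding H_diff_def y_def by simp
  qed
  have left: "H_diff 1 a (v + 1) y (Suc j) = H_diff 1 (a - 1) v x j"
    if "v \<le> b" "1 \<le> j" "j \<le> v" "j < a" for v j
    using B[of v j] B[of v "j - 1"] that by (simp add: H_diff_def y_def)
  have left1: "H_diff 1 a (v + 1) y 1 = B + (\<Sum>j=1..v. x (a, j))" if "v \<le> b" for v
    using B[of v 0] that a by (simp add: H_diff_def y_def H_zero)
  have growth: "H_diff 2 a (b + 1) y k =
    (if k = 1 then H_diff 1 a (b + 1) y 1
     else min (H_diff 1 a (b + 1) y k) (H_diff 2 a b y (k - 1))) +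
    guarded_max (k < a) (H_diff 1 a (b + 1) y (k + 1)) (1 + k < b + 1) (H_diff 2 a b y k) -
    H_diff 1 a b y k"
    using H_diff_growth[of a 1 k "b + 1" y] assms by (simp add: numeral_2_eq_2)
  have b: "b = b - 1 + 1" using assms by simp
  have mu: "H_diff 2 a (b + 1) y k = H_diff 1 a b x k" by (rule shift)
  have mu': "H_diff 2 a b y j = H_diff 1 a (b - 1) x j" for j
    using shift[of "b - 1" j] b by simp
  have lam: "k < a \<Longrightarrow> H_diff 1 a (b + 1) y (k + 1) = H_diff 1 (a - 1) b x k"
    using left[of b k] assms by simp
  show ?thesis
  proof (cases "k = 1")
    case True
    have "H_diff 1 a b y 1 = B + (\<Sum>j=1..b - 1. x (a, j))" using left1[of "b - 1"] b by simp
    moreover have "(\<Sum>j=1..b. x (a, j)) = (\<Sum>j=1..b - 1. x (a, j)) + x (a, b)"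
      using sum.nat_ivl_Suc'[of 1 "b - 1" "\<lambda>j. x (a, j)"] b by simp
    ultimately show ?thesis
      using growth left1[of b] lam True unfolding mu mu' guarded_max_def by simp
  next
    case False
    have "H_diff 1 a (b + 1) y k = H_diff 1 (a - 1) b x (k - 1)"
      using left[of b "k - 1"] assms False by simp
    moreover have "H_diff 1 a b y k = H_diff 1 (a - 1) (b - 1) x (k - 1)"
      using left[of "b - 1" "k - 1"] assms False b by simp
    ultimately show ?thesis
      using growth lam False unfolding mu mu' guarded_max_def by simp
  qed
qed

section \<open>Toggles, RSK and promotion\<close>

lemma rect_iff: "(i, j) \<in> rect r s \<longleftrightarrow> 1 \<le> i \<and> i \<le> r \<and> 1 \<le> j \<and> j \<le> s"
  by (auto simp: rect_def)

lemma labelings_iff: "x \<in> labelings r s \<longleftrightarrow> (\<forall>p. p \<notin> rect r s \<longrightarrow> x p = undefined)"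
  by (auto simp: labelings_def PiE_def extensional_def)

lemma covered_by_iff:
  "covered_by r s (i, j) (i', j') \<longleftrightarrow> (i, j) \<in> rect r s \<and> (i', j') \<in> rect r s \<and>
     (i' = Suc i \<and> j' = j \<or> i' = i \<and> j' = Suc j)"
proof
  assume c: "covered_by r s (i, j) (i', j')"
  then have mem: "(i, j) \<in> rect r s" "(i', j') \<in> rect r s" and less: "(i, j) < (i', j')"
    and between: "\<And>z. z \<in> rect r s \<Longrightarrow> (i, j) < z \<Longrightarrow> \<not> z < (i', j')"
    unfolding covered_by_def by blast+
  have le: "i \<le> i'" "j \<le> j'" using less by (simp_all add: less_le)
  show "(i, j) \<in> rect r s \<and> (i', j') \<in> rect r s \<and> (i' = Suc i \<and> j' = j \<or> i' = i \<and> j' = Suc j)"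
  proof (cases "i < i'")
    case True
    have "(Suc i, j) \<in> rect r s" "(i, j) < (Suc i, j)"
      using mem True by (simp_all add: rect_iff less_le)
    from between[OF this] have "(Suc i, j) = (i', j')" using True le by (auto simp: less_le)
    then show ?thesis using mem by simp
  next
    case False
    then have ij: "i' = i" "j < j'" using le less by (auto simp: less_le)
    have "(i, Suc j) \<in> rect r s" "(i, j) < (i, Suc j)"
      using mem ij by (simp_all add: rect_iff less_le)
    from between[OF this] have "(i, Suc j) = (i', j')" using ij by (auto simp: less_le)
    then show ?thesis using mem by simp
  qed
next
  assume *: "(i, j) \<in> rect r s \<and> (i', j') \<in> rect r s \<and> (i' = Suc i \<and> j' = j \<or> i' = i \<and> j' = Suc j)"
  have "\<not> ((i, j) < (a, b) \<and> (a, b) < (i', j'))" for a b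
  proof
    assume "(i, j) < (a, b) \<and> (a, b) < (i', j')"
    then have "i \<le> a" "j \<le> b" "a \<le> i'" "b \<le> j'" "(a, b) \<noteq> (i, j)" "(a, b) \<noteq> (i', j')"
      by (auto simp: less_le)
    then show False using * by auto
  qed
  then have "\<not> (\<exists>z\<in>rect r s. (i, j) < z \<and> z < (i', j'))" by (metis surj_pair)
  moreover have "(i, j) < (i', j')" using * by (auto simp: less_le)
  ultimately show "covered_by r s (i, j) (i', j')" using * unfolding covered_by_def by blast
qed

lemma max_below_rect:
  assumes "(i, j) \<in> rect r s"
  shows "max_below r s x (i, j) = guarded_max (1 < i) (x (i - 1, j)) (1 < j) (x (i, j - 1))"
proof -
  have "{q. covered_by r s q (i, j)} =
      (if 1 < i then {(i - 1, j)} else {}) \<union> (if 1 < j then {(i, j - 1)} else {})"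
    (is "?A = ?B")
  proof (rule set_eqI)
    fix q :: "nat \<times> nat"
    obtain a b where q: "q = (a, b)" by (cases q)
    show "q \<in> ?A \<longleftrightarrow> q \<in> ?B"
      unfolding q mem_Collect_eq covered_by_iff using assms by (auto simp: rect_iff)
  qed
  then show ?thesis by (auto simp: max_below_def guarded_max_def max.commute)
qed

text \<open>The assumption \<open>j < s\<close> provides the upper cover \<open>(i, Suc j)\<close>;
  every point toggled in RSK or in promotion satisfies it.\<close>

lemma min_above_rect:
  assumes "(i, j) \<in> rect r s" "j < s"
  shows "min_above r s x (i, j) =
    (if i < r then min (x (Suc i, j)) (x (i, Suc j)) else x (i, Suc j))"
proof -
  have "{q. covered_by r s (i, j) q} = (if i < r then {(Suc i, j)} else {}) \<union> {(i, Suc j)}"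
    (is "?A = ?B")
  proof (rule set_eqI)
    fix q :: "nat \<times> nat"
    obtain a b where q: "q = (a, b)" by (cases q)
    show "q \<in> ?A \<longleftrightarrow> q \<in> ?B"
      unfolding q mem_Collect_eq covered_by_iff using assms by (auto simp: rect_iff)
  qed
  then show ?thesis by (auto simp: min_above_def min.commute)
qed

lemma min_above_cong:
  "(\<And>q. covered_by r s p q \<Longrightarrow> x q = y q) \<Longrightarrow> min_above r s x p = min_above r s y p"
  unfolding min_above_def by (metis (mono_tags, lifting) image_cong mem_Collect_eq)

lemma max_below_cong:
  "(\<And>q. covered_by r s q p \<Longrightarrow> x q = y q) \<Longrightarrow> max_below r s x p = max_below r s y p"
  unfolding max_below_def by (metis (mono_tags, lifting) image_cong mem_Collect_eq)

lemma toggle_toggle: "toggle r s p (toggle r s p x) = x"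
proof -
  have "covered_by r s p q \<Longrightarrow> q \<noteq> p" "covered_by r s q p \<Longrightarrow> q \<noteq> p" for q
    by (auto simp: covered_by_def)
  then have "min_above r s (toggle r s p x) p = min_above r s x p"
    "max_below r s (toggle r s p x) p = max_below r s x p"
    by (auto simp: toggle_def intro!: min_above_cong max_below_cong)
  then show ?thesis
    unfolding toggle_def[of r s p "toggle r s p x"] by (auto simp: toggle_def)
qed

lemma bij_betw_toggle:
  assumes "p \<in> rect r s"
  shows "bij_betw (toggle r s p) (labelings r s) (labelings r s)"
proof (rule bij_betw_byWitness[where f' = "toggle r s p"])
  show "toggle r s p ` labelings r s \<subseteq> labelings r s"
    using assms by (auto simp: labelings_iff toggle_def)
  then show "toggle r s p ` labelings r s \<subseteq> labelings r s" .
qed (simp_all add: toggle_toggle)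

lemma compose_list_simps [simp]:
  "compose_list [] = id" "compose_list (f # fs) = f \<circ> compose_list fs"
  by (simp_all add: compose_list_def)

lemma bij_betw_compose_list:
  "(\<And>f. f \<in> set fs \<Longrightarrow> bij_betw f A A) \<Longrightarrow> bij_betw (compose_list fs) A A"
proof (induction fs)
  case (Cons f fs)
  then have "bij_betw (compose_list fs) A A" "bij_betw f A A" by simp_all
  from bij_betw_trans[OF this] show ?case unfolding compose_list_simps .
qed simp

lemma linear_extension_exists:
  assumes "finite I"
  shows "\<exists>L. linear_extension I L"
  using assms
proof (induction "card I" arbitrary: I)
  case 0
  then show ?case by (auto simp: linear_extension_def bij_betw_def)
next
  case (Suc n)
  then have "I \<noteq> {}" by auto
  then obtain m where m: "m \<in> I" "\<And>q. q \<in> I \<Longrightarrow> m \<le> q \<Longrightarrow> m = q"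
    using finite_has_maximal[of I] Suc.prems by blast
  have "n = card (I - {m})" using Suc m by simp
  then obtain L where L: "bij_betw L (I - {m}) {1..n}"
      "\<And>p q. p \<in> I - {m} \<Longrightarrow> q \<in> I - {m} \<Longrightarrow> p \<le> q \<Longrightarrow> L p \<le> L q"
    using Suc.hyps(1)[of "I - {m}"] Suc.prems unfolding linear_extension_def by auto
  define L' where "L' = L(m := Suc n)"
  have "bij_betw L' (I - {m}) {1..n}"
    using L(1) by (subst bij_betw_cong[of _ _ L]) (simp_all add: L'_def)
  moreover have "L' m = Suc n" by (simp add: L'_def)
  ultimately have "bij_betw L' (insert m (I - {m})) (insert (Suc n) {1..n})"
    using notIn_Un_bij_betw[of m "I - {m}" L' "{1..n}"] by simp
  moreover have "insert m (I - {m}) = I" "insert (Suc n) {1..n} = {1..card I}"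
    using m(1) Suc.hyps(2) by auto
  ultimately have bij: "bij_betw L' I {1..card I}" by simp
  have "L' p \<le> L' q" if "p \<in> I" "q \<in> I" "p \<le> q" for p q
  proof (cases "q = m")
    case True
    then show ?thesis using bij_betwE[OF bij] that Suc.hyps(2) by (auto simp: L'_def)
  next
    case False
    then have "p \<noteq> m" using m(2)[OF that(2)] that(3) by auto
    then show ?thesis using False L(2) that by (simp add: L'_def)
  qed
  then show ?case using bij unfolding linear_extension_def by blast
qed

lemma linear_extension_Eps:
  assumes "I \<subseteq> rect r s"
  shows "linear_extension I (SOME L. linear_extension I L)"
proof -
  have "finite I" using assms by (rule finite_subset) (simp add: rect_def)
  from someI_ex[OF linear_extension_exists[OF this]] show ?thesis .
qed

lemma bij_betw_rho:
  assumes I: "I \<subseteq> rect r s"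
  shows "bij_betw (rho r s I) (labelings r s) (labelings r s)"
  unfolding rho_def rho_along_def
proof (rule bij_betw_compose_list)
  define L where "L = (SOME L. linear_extension I L)"
  have "linear_extension I L" unfolding L_def by (rule linear_extension_Eps[OF I])
  then have L: "L ` I = {1..card I}" by (simp add: linear_extension_def bij_betw_def)
  fix f assume "f \<in> set (map (\<lambda>i. toggle r s (inv_into I (SOME L. linear_extension I L) i))
    [1..<Suc (card I)])"
  then have "f \<in> (\<lambda>i. toggle r s (inv_into I L i)) ` L ` I"
    unfolding L L_def[symmetric] set_map by (simp only: set_upt atLeastLessThanSuc_atLeastAtMost)
  then obtain i where i: "f = toggle r s (inv_into I L i)" "i \<in> L ` I" by blast
  then have "inv_into I L i \<in> rect r s" using I inv_into_into[of i L I] by blast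
  then show "bij_betw f (labelings r s) (labelings r s)"
    unfolding i(1) by (rule bij_betw_toggle)
qed

text \<open>Toggles are applied from the top down, so each one sees new labels above and old labels
  below. This determines the result without mentioning the linear extension.\<close>

lemma rho_eqI:
  assumes I: "I \<subseteq> rect r s"
    and out: "\<And>p. p \<notin> I \<Longrightarrow> z p = y p"
    and "in": "\<And>p. p \<in> I \<Longrightarrow> z p = min_above r s z p + max_below r s y p - y p"
  shows "rho r s I y = z"
proof -
  define L where "L = (SOME L. linear_extension I L)"
  define n where "n = card I"
  have "linear_extension I L" unfolding L_def by (rule linear_extension_Eps[OF I])
  then have L: "L ` I = {1..n}" "inj_on L I"
    and mono: "\<And>p q. p \<in> I \<Longrightarrow> q \<in> I \<Longrightarrow> p \<le> q \<Longrightarrow> L p \<le> L q"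
    by (auto simp: linear_extension_def bij_betw_def n_def)
  \<comment> \<open>The state in which exactly the points with number greater than \<open>m\<close>
    have been toggled.\<close>
  define st where "st = (\<lambda>m p. if p \<in> I \<and> m < L p then z p else y p)"
  define f where "f = (\<lambda>i. toggle r s (inv_into I L i))"
  have toggle_st: "f (Suc m) (st (Suc m)) = st m" if "m < n" for m
  proof -
    define p where "p = inv_into I L (Suc m)"
    have "Suc m \<in> L ` I" using that unfolding L by simp
    then have p: "p \<in> I" "L p = Suc m" unfolding p_def by (rule inv_into_into, rule f_inv_into_f)
    have above: "st (Suc m) q = z q" if "covered_by r s p q" for q
    proof (cases "q \<in> I")
      case True
      have "p \<le> q" "p \<noteq> q" using that by (auto simp: covered_by_def)
      then have "L p \<le> L q" "L p \<noteq> L q"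
        using mono p(1) True L(2) by (auto dest: inj_onD)
      then show ?thesis using True p(2) by (simp add: st_def)
    next
      case False
      then show ?thesis using out by (simp add: st_def)
    qed
    have below: "st (Suc m) q = y q" if "covered_by r s q p" for q
    proof (cases "q \<in> I")
      case True
      have "q \<le> p" using that by (auto simp: covered_by_def)
      then have "L q \<le> Suc m" using mono[OF True p(1)] p(2) by simp
      then show ?thesis by (simp add: st_def)
    qed (simp add: st_def)
    have "toggle r s p (st (Suc m)) q = st m q" for q
    proof (cases "q = p")
      case True
      have "min_above r s (st (Suc m)) p = min_above r s z p"
        using above by (rule min_above_cong)
      moreover have "max_below r s (st (Suc m)) p = max_below r s y p"
        using below by (rule max_below_cong)
      ultimately show ?thesis
        using True p "in"[OF p(1)] by (simp add: toggle_def) (simp add: st_def)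
    next
      case False
      have "L q \<noteq> Suc m" if "q \<in> I" using L(2) p that False by (metis inj_onD)
      then have "st (Suc m) q = st m q" by (auto simp: st_def)
      then show ?thesis using False by (simp add: toggle_def)
    qed
    then show ?thesis unfolding f_def p_def by blast
  qed
  have "compose_list (map f [Suc m..<Suc n]) y = st m" if "m \<le> n" for m
    using that
  proof (induction m rule: inc_induct)
    case base
    have "\<not> n < L p" if "p \<in> I" for p
      using L(1) that by (metis atLeastAtMost_iff imageI not_le)
    then have "st n = y" by (intro ext) (auto simp: st_def)
    then show ?case by simp
  next
    case (step m)
    have "[Suc m..<Suc n] = Suc m # [Suc (Suc m)..<Suc n]"
      using step.hyps by (simp add: upt_conv_Cons del: upt_Suc)
    then show ?case using step.IH toggle_st[OF step.hyps(2)] by (simp del: upt_Suc)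
  qed
  from this[of 0] have "rho r s I y = st 0"
    unfolding rho_def rho_along_def f_def L_def n_def by simp
  also have "st 0 = z"
  proof
    fix p
    have "0 < L p" if "p \<in> I"
      using L(1) that by (metis atLeastAtMost_iff imageI less_eq_Suc_le One_nat_def)
    then show "st 0 p = z p" using out[of p] by (cases "p \<in> I") (simp_all add: st_def)
  qed
  finally show ?thesis .
qed

section \<open>Intermediate labelings of RSK\<close>

text \<open>The labeling after the first \<open>d\<close> inverse rowmotions. At stage 0 it consists
  of the maximal weights of single paths from \<open>(1, 1)\<close>; every stage moves the endpoint
  one step further along the diagonal and adds a path, until the border is reached.\<close>

definition rsk_stage ::
  "nat \<Rightarrow> nat \<Rightarrow> nat \<Rightarrow> (nat \<times> nat \<Rightarrow> real) \<Rightarrow> nat \<times> nat \<Rightarrow> real" where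
  "rsk_stage r s d x = (\<lambda>p\<in>rect r s.
     let e = min d (min (r - fst p) (s - snd p)) in H_diff 1 (fst p + e) (snd p + e) x (e + 1))"

lemma rsk_stage_rect:
  assumes "(i, j) \<in> rect r s" "min d (min (r - i) (s - j)) = e"
  shows "rsk_stage r s d x (i, j) = H_diff 1 (i + e) (j + e) x (e + 1)"
  using assms by (simp add: rsk_stage_def)

lemma rsk_stage_labelings: "rsk_stage r s d x \<in> labelings r s"
  by (simp add: labelings_iff rsk_stage_def)

text \<open>The recursion for a single path, which is \<open>H_diff_corner\<close> with
  \<open>k = 1\<close>. It also yields the surjectivity of \<open>transfer\<close>.\<close>

lemma transfer_rsk_stage:
  assumes "x \<in> labelings r s"
  shows "transfer r s (rsk_stage r s 0 x) = x"
proof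
  fix p
  show "transfer r s (rsk_stage r s 0 x) p = x p"
  proof (cases "p \<in> rect r s")
    case True
    obtain i j where p: "p = (i, j)" by (cases p)
    have ij: "1 \<le> i" "i \<le> r" "1 \<le> j" "j \<le> s" using True by (auto simp: p rect_iff)
    have st: "rsk_stage r s 0 x (a, b) = H_diff 1 a b x 1" if "(a, b) \<in> rect r s" for a b
      using rsk_stage_rect[OF that, of 0 0 x] by simp
    have "(i - 1, j) \<in> rect r s" if "1 < i" using that ij by (auto simp: rect_iff)
    moreover have "(i, j - 1) \<in> rect r s" if "1 < j" using that ij by (auto simp: rect_iff)
    ultimately have "max_below r s (rsk_stage r s 0 x) (i, j) =
        guarded_max (1 < i) (H_diff 1 (i - 1) j x 1) (1 < j) (H_diff 1 i (j - 1) x 1)"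
      using True st by (simp add: max_below_rect p guarded_max_def)
    moreover have "H_diff 1 i j x 1 = x (i, j) +
        guarded_max (1 < i) (H_diff 1 (i - 1) j x 1) (1 < j) (H_diff 1 i (j - 1) x 1)"
      using H_diff_corner[of 1 i j x] ij by simp
    ultimately show ?thesis using True st by (simp add: transfer_def p)
  next
    case False
    then have "x p = undefined" using assms unfolding labelings_iff by blast
    then show ?thesis using False by (simp add: transfer_def)
  qed
qed

lemma bij_betw_transfer: "bij_betw (transfer r s) (labelings r s) (labelings r s)"
proof (rule bij_betw_imageI)
  show "inj_on (transfer r s) (labelings r s)"
  proof (rule inj_onI)
    fix x y assume xy: "x \<in> labelings r s" "y \<in> labelings r s" "transfer r s x = transfer r s y"
    have "\<forall>i j. i + j = n \<longrightarrow> (i, j) \<in> rect r s \<longrightarrow> x (i, j) = y (i, j)" for n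
    proof (induction n rule: less_induct)
      case (less n)
      show ?case
      proof (intro allI impI)
        fix i j assume ij: "i + j = n" "(i, j) \<in> rect r s"
        have "x (i - 1, j) = y (i - 1, j)" if "1 < i"
        proof -
          have "(i - 1, j) \<in> rect r s" "i - 1 + j < n" using ij that by (auto simp: rect_iff)
          then show ?thesis using less by blast
        qed
        moreover have "x (i, j - 1) = y (i, j - 1)" if "1 < j"
        proof -
          have "(i, j - 1) \<in> rect r s" "i + (j - 1) < n" using ij that by (auto simp: rect_iff)
          then show ?thesis using less by blast
        qed
        ultimately have "max_below r s x (i, j) = max_below r s y (i, j)"
          using ij by (simp add: max_below_rect guarded_max_def)
        moreover have "x (i, j) - max_below r s x (i, j) = y (i, j) - max_below r s y (i, j)"
          using fun_cong[OF xy(3), of "(i, j)"] ij by (simp add: transfer_def)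
        ultimately show "x (i, j) = y (i, j)" by simp
      qed
    qed
    then have "x p = y p" if "p \<in> rect r s" for p using that by (cases p) simp
    then show "x = y" using xy(1,2) by (metis ext labelings_iff)
  qed
  show "transfer r s ` labelings r s = labelings r s"
  proof
    show "transfer r s ` labelings r s \<subseteq> labelings r s"
      by (auto simp: labelings_iff transfer_def)
    show "labelings r s \<subseteq> transfer r s ` labelings r s"
      using transfer_rsk_stage rsk_stage_labelings by (metis image_eqI subsetI)
  qed
qed

text \<open>Here \<open>H_diff_corner\<close> for \<open>k = d + 1\<close> is solved for its
  subtracted term, the one with a row, a column and a path fewer: that term is the new
  label.\<close>

lemma rho_rsk_stage:
  assumes d: "1 \<le> d" "d < min r s"
  shows "rho r s (rect (r - d) (s - d)) (rsk_stage r s d x) = rsk_stage r s (d - 1) x"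
proof (rule rho_eqI)
  show "rect (r - d) (s - d) \<subseteq> rect r s" by (auto simp: rect_def)
  fix p :: "nat \<times> nat"
  obtain i j where p: "p = (i, j)" by (cases p)
  {
    assume "p \<notin> rect (r - d) (s - d)"
    then have "min d (min (r - i) (s - j)) = min (d - 1) (min (r - i) (s - j))" if "p \<in> rect r s"
      using that unfolding p rect_iff by linarith
    then show "rsk_stage r s (d - 1) x p = rsk_stage r s d x p"
      unfolding rsk_stage_def by (simp add: p)
  }
  assume "p \<in> rect (r - d) (s - d)"
  then have ij: "1 \<le> i" "i + d \<le> r" "1 \<le> j" "j + d \<le> s"
    using d unfolding p rect_iff by linarith+
  have mem: "(i, j) \<in> rect r s" "(Suc i, j) \<in> rect r s" "(i, Suc j) \<in> rect r s"
    using ij d by (simp_all add: rect_iff)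
  have new: "rsk_stage r s (d - 1) x (i, j) = H_diff 1 (i + d - 1) (j + d - 1) x d"
    "rsk_stage r s (d - 1) x (Suc i, j) = H_diff 1 (i + d) (j + d - 1) x d"
    "rsk_stage r s (d - 1) x (i, Suc j) = H_diff 1 (i + d - 1) (j + d) x d"
    using rsk_stage_rect[OF mem(1), of "d - 1" "d - 1" x]
      rsk_stage_rect[OF mem(2), of "d - 1" "d - 1" x]
      rsk_stage_rect[OF mem(3), of "d - 1" "d - 1" x] ij d by simp_all
  have old: "rsk_stage r s d x (a, b) = H_diff 1 (a + d) (b + d) x (d + 1)"
    if "1 \<le> a" "a \<le> i" "1 \<le> b" "b \<le> j" for a b
  proof (rule rsk_stage_rect)
    show "(a, b) \<in> rect r s" using that ij by (simp add: rect_iff)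
    show "min d (min (r - a) (s - b)) = d" using that ij by simp
  qed
  have "min_above r s (rsk_stage r s (d - 1) x) (i, j) =
      min (H_diff 1 (i + d) (j + d - 1) x d) (H_diff 1 (i + d - 1) (j + d) x d)"
    using min_above_rect[OF mem(1), of "rsk_stage r s (d - 1) x"] ij d new by simp
  moreover have "max_below r s (rsk_stage r s d x) (i, j) = guarded_max (1 < i)
      (H_diff 1 (i + d - 1) (j + d) x (d + 1)) (1 < j) (H_diff 1 (i + d) (j + d - 1) x (d + 1))"
  proof -
    have "rsk_stage r s d x (i - 1, j) = H_diff 1 (i + d - 1) (j + d) x (d + 1)" if "1 < i"
      using old[of "i - 1" j] that ij by simp
    moreover have "rsk_stage r s d x (i, j - 1) = H_diff 1 (i + d) (j + d - 1) x (d + 1)" if "1 < j"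
      using old[of i "j - 1"] that ij by simp
    ultimately show ?thesis using max_below_rect[OF mem(1)] by (simp add: guarded_max_def)
  qed
  moreover have "H_diff 1 (i + d) (j + d) x (d + 1) =
      min (H_diff 1 (i + d - 1) (j + d) x d) (H_diff 1 (i + d) (j + d - 1) x d) -
        H_diff 1 (i + d - 1) (j + d - 1) x d +
      guarded_max (1 < i) (H_diff 1 (i + d - 1) (j + d) x (d + 1))
        (1 < j) (H_diff 1 (i + d) (j + d - 1) x (d + 1))"
    using H_diff_corner[of "d + 1" "i + d" "j + d" x] ij d by simp
  ultimately show "rsk_stage r s (d - 1) x p = min_above r s (rsk_stage r s (d - 1) x) p +
      max_below r s (rsk_stage r s d x) p - rsk_stage r s d x p"
    unfolding p using new old[of i j] ij by (simp add: min.commute)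
qed

lemma RSK_eq:
  assumes "x \<in> labelings r s"
  shows "RSK r s x = rsk_stage r s (min r s - 1) x"
proof -
  define f where "f = (\<lambda>d. inv_into (labelings r s) (rho r s (rect (r - d) (s - d))))"
  have rect: "rect (r - d) (s - d) \<subseteq> rect r s" for d by (auto simp: rect_def)
  have inv: "f d (rsk_stage r s (d - 1) x) = rsk_stage r s d x" if "1 \<le> d" "d < min r s" for d
    unfolding f_def rho_rsk_stage[OF that, symmetric]
    by (rule inv_into_f_f[OF bij_betw_imp_inj_on[OF bij_betw_rho[OF rect]] rsk_stage_labelings])
  have "compose_list (map f (rev [1..<Suc n])) (rsk_stage r s 0 x) = rsk_stage r s n x"
    if "n \<le> min r s - 1" for n
    using that
  proof (induction n)
    case (Suc n)
    then have "compose_list (map f (rev [1..<Suc n])) (rsk_stage r s 0 x) = rsk_stage r s n x" by simp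
    moreover have "f (Suc n) (rsk_stage r s n x) = rsk_stage r s (Suc n) x"
      using inv[of "Suc n"] Suc.prems by fastforce
    moreover have "rev [1..<Suc (Suc n)] = Suc n # rev [1..<Suc n]" by simp
    ultimately show ?case by (simp del: upt_Suc)
  qed simp
  from this[of "min r s - 1"]
  have "compose_list (map f (rev [1..<min r s])) (rsk_stage r s 0 x) = rsk_stage r s (min r s - 1) x"
    by (cases "min r s") (simp_all del: upt_Suc)
  moreover have "inv_into (labelings r s) (transfer r s) x = rsk_stage r s 0 x"
    using inv_into_f_f[OF bij_betw_imp_inj_on[OF bij_betw_transfer[of r s]]
        rsk_stage_labelings[of r s 0 x]]
    unfolding transfer_rsk_stage[OF assms] .
  ultimately show ?thesis unfolding RSK_def f_def by simp
qed

lemma RSK_rect: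
  assumes "x \<in> labelings r s" "(i, j) \<in> rect r s" "min (r - i) (s - j) = e"
  shows "RSK r s x (i, j) = H_diff 1 (i + e) (j + e) x (e + 1)"
  unfolding RSK_eq[OF assms(1)]
  by (rule rsk_stage_rect[OF assms(2)]) (use assms(2,3) in \<open>auto simp: rect_iff\<close>)

lemma bij_betw_RSK: "bij_betw (RSK r s) (labelings r s) (labelings r s)"
  unfolding RSK_def
proof (rule bij_betw_trans[OF bij_betw_inv_into[OF bij_betw_transfer] bij_betw_compose_list])
  fix f assume "f \<in> set (map (\<lambda>d. inv_into (labelings r s) (rho r s (rect (r - d) (s - d))))
    (rev [1..<min r s]))"
  then obtain d where f: "f = inv_into (labelings r s) (rho r s (rect (r - d) (s - d)))" by auto
  have "rect (r - d) (s - d) \<subseteq> rect r s" by (auto simp: rect_def)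
  then show "bij_betw f (labelings r s) (labelings r s)"
    unfolding f by (intro bij_betw_inv_into bij_betw_rho)
qed

section \<open>Intermediate labelings of promotion\<close>

text \<open>The labeling after the toggles along the files \<open>r - 1\<close> down to
  \<open>r - v\<close>. With \<open>w = j + (r - i)\<close>, the label of \<open>(i, j)\<close> on
  these files was an increment for the columns \<open>1..w\<close> and is now the one for
  \<open>2..w + 1\<close>. Integers are used since file numbers may be negative.\<close>

definition pro_stage ::
  "nat \<Rightarrow> nat \<Rightarrow> nat \<Rightarrow> (nat \<times> nat \<Rightarrow> real) \<Rightarrow> nat \<times> nat \<Rightarrow> real" where
  "pro_stage r s v x = (\<lambda>p. if p \<in> rect r s \<and> int r - int v \<le> int (fst p) - int (snd p)
     then H_diff 2 r (snd p + (r - fst p) + 1) x (r - fst p + 1) else RSK r s x p)"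

lemma pro_stage_new:
  assumes "(i, j) \<in> rect r s" "int r - int v \<le> int i - int j" "j + (r - i) + 1 = w" "r - i + 1 = k"
  shows "pro_stage r s v x (i, j) = H_diff 2 r w x k"
  using assms(1,2) unfolding assms(3,4)[symmetric] pro_stage_def by simp

text \<open>Of the neighbours of \<open>(i, j)\<close>, those below and to the left,
  \<open>(Suc i, j)\<close> and \<open>(i, j - 1)\<close>, lie on a file that is already toggled,
  the other two on one that is not. Hence the toggle is \<open>H_diff_growth\<close> for
  \<open>u = 1\<close>.\<close>

lemma rho_pro_stage:
  assumes x: "x \<in> labelings r s" and v: "Suc v < s"
  shows "rho r s (file_set r s (int r - int (Suc v))) (pro_stage r s v x) = pro_stage r s (Suc v) x"
proof (rule rho_eqI)
  show "file_set r s (int r - int (Suc v)) \<subseteq> rect r s" by (auto simp: file_set_def)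
  fix p :: "nat \<times> nat"
  obtain i j where p: "p = (i, j)" by (cases p)
  have in_file: "p \<in> file_set r s (int r - int (Suc v)) \<longleftrightarrow>
      p \<in> rect r s \<and> int i - int j = int r - int (Suc v)"
    by (simp add: file_set_def p)
  {
    assume "p \<notin> file_set r s (int r - int (Suc v))"
    then have "p \<in> rect r s \<Longrightarrow> int r - int (Suc v) \<le> int i - int j \<longleftrightarrow> int r - int v \<le> int i - int j"
      unfolding in_file by linarith
    then show "pro_stage r s (Suc v) x p = pro_stage r s v x p"
      unfolding pro_stage_def p by auto
  }
  assume "p \<in> file_set r s (int r - int (Suc v))"
  then have "p \<in> rect r s \<and> int i - int j = int r - int (Suc v)" unfolding in_file .
  then have mem: "(i, j) \<in> rect r s" and file_ij: "int i - int j = int r - int (Suc v)"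
    unfolding p by blast+
  have ij: "1 \<le> i" "i \<le> r" "1 \<le> j" "j \<le> s" using mem by (auto simp: rect_iff)
  define k w where "k = r - i + 1" and "w = Suc v"
  have w: "j + (r - i) = w" "w < s" "int i - int j = int r - int w" "v = w - 1" "1 \<le> w"
    using file_ij ij v unfolding w_def by linarith+
  have k: "1 \<le> k" "k \<le> r" "1 + k \<le> w + 1" "k < r \<longleftrightarrow> 1 < i" "1 + k < w + 1 \<longleftrightarrow> 1 < j"
      "k = 1 \<longleftrightarrow> i = r"
    using ij w(1) unfolding k_def by linarith+
  have jw: "j + (r - i) = w" using w by simp
  have y: "RSK r s x (i, j) = H_diff 1 r w x k"
  proof -
    have "min (r - i) (s - j) = r - i" using w ij by linarith
    from RSK_rect[OF x mem this] show ?thesis using ij jw by (simp add: k_def)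
  qed
  have new: "pro_stage r s (Suc v) x (i, j) = H_diff 2 r (w + 1) x k"
    using mem w by (simp add: pro_stage_def k_def)
  have old: "pro_stage r s v x (i, j) = H_diff 1 r w x k"
    using w y by (simp add: pro_stage_def)
  have right: "pro_stage r s (Suc v) x (i, Suc j) = H_diff 1 r (w + 1) x k"
  proof -
    have m: "(i, Suc j) \<in> rect r s" using ij w by (simp add: rect_iff)
    have "min (r - i) (s - Suc j) = r - i" using w ij by linarith
    from RSK_rect[OF x m this] have "RSK r s x (i, Suc j) = H_diff 1 r (w + 1) x k"
      using ij jw by (simp add: k_def)
    then show ?thesis using w by (simp add: pro_stage_def)
  qed
  have up: "pro_stage r s (Suc v) x (Suc i, j) = H_diff 2 r w x (k - 1)" if "i < r"
  proof -
    have m: "(Suc i, j) \<in> rect r s" using ij that by (simp add: rect_iff)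
    have "j + (r - Suc i) + 1 = w" "r - Suc i + 1 = k - 1"
      using that w by (simp_all add: k_def)
    moreover have "int r - int (Suc v) \<le> int (Suc i) - int j" using w by simp
    ultimately show ?thesis using pro_stage_new[OF m] by simp
  qed
  have down: "pro_stage r s v x (i - 1, j) = H_diff 1 r (w + 1) x (k + 1)" if "1 < i"
  proof -
    have m: "(i - 1, j) \<in> rect r s" using ij that by (auto simp: rect_iff)
    have "min (r - (i - 1)) (s - j) = k" using w ij that unfolding k_def by linarith
    moreover have "i - 1 + k = r" "j + k = w + 1" using ij that w by (simp_all add: k_def)
    ultimately have "RSK r s x (i - 1, j) = H_diff 1 r (w + 1) x (k + 1)"
      using RSK_rect[OF x m] by simp
    then show ?thesis using w that by (simp add: pro_stage_def of_nat_diff)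
  qed
  have left: "pro_stage r s v x (i, j - 1) = H_diff 2 r w x k" if "1 < j"
  proof -
    have m: "(i, j - 1) \<in> rect r s" using ij that by (auto simp: rect_iff)
    have "j - 1 + (r - i) + 1 = w" using w that by simp
    moreover have "int r - int v \<le> int i - int (j - 1)" using w that by (simp add: of_nat_diff)
    ultimately show ?thesis using pro_stage_new[OF m] by (simp add: k_def)
  qed
  have "min_above r s (pro_stage r s (Suc v) x) (i, j) =
      (if k = 1 then H_diff 1 r (w + 1) x 1 else min (H_diff 1 r (w + 1) x k) (H_diff 2 r w x (k - 1)))"
  proof (cases "k = 1")
    case True
    have "j < s" using w(1,2) by linarith
    from min_above_rect[OF mem this, of "pro_stage r s (Suc v) x"]
    show ?thesis using right True k(6) by simp
  next
    case False
    have "j < s" "i < r" using w(1,2) False k(6) ij by linarith+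
    from min_above_rect[OF mem this(1), of "pro_stage r s (Suc v) x"] this(2)
    show ?thesis using right up False by (simp add: min.commute)
  qed
  moreover have "max_below r s (pro_stage r s v x) (i, j) =
      guarded_max (k < r) (H_diff 1 r (w + 1) x (k + 1)) (1 + k < w + 1) (H_diff 2 r w x k)"
    using max_below_rect[OF mem, of "pro_stage r s v x"] down left unfolding k(4,5)
    by (simp add: guarded_max_def)
  moreover have "H_diff 2 r (w + 1) x k =
      (if k = 1 then H_diff 1 r (w + 1) x 1 else min (H_diff 1 r (w + 1) x k) (H_diff 2 r w x (k - 1))) +
      guarded_max (k < r) (H_diff 1 r (w + 1) x (k + 1)) (1 + k < w + 1) (H_diff 2 r w x k) -
      H_diff 1 r w x k"
    using H_diff_growth[of r 1 k "w + 1" x] k ij by (simp add: numeral_2_eq_2)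
  ultimately show "pro_stage r s (Suc v) x p = min_above r s (pro_stage r s (Suc v) x) p +
      max_below r s (pro_stage r s v x) p - pro_stage r s v x p"
    unfolding p new old by simp
qed

lemma ProP_RSK:
  assumes x: "x \<in> labelings r s" and "1 \<le> s"
  shows "ProP r s (RSK r s x) = pro_stage r s (s - 1) x"
proof -
  define f where "f = (\<lambda>k. rho r s (file_set r s k))"
  have "compose_list (map f [int r - int v .. int r - 1]) (RSK r s x) = pro_stage r s v x"
    if "v < s" for v
    using that
  proof (induction v)
    case 0
    have "pro_stage r s 0 x = RSK r s x"
    proof
      fix p
      have "\<not> (p \<in> rect r s \<and> int r - int 0 \<le> int (fst p) - int (snd p))"
        by (cases p) (auto simp: rect_iff)
      then show "pro_stage r s 0 x p = RSK r s x p" by (simp only: pro_stage_def if_False)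
    qed
    then show ?case by simp
  next
    case (Suc v)
    have "[int r - int (Suc v) .. int r - 1] = (int r - int (Suc v)) # [int r - int v .. int r - 1]"
      by (subst upto_rec1) simp_all
    moreover have "f (int r - int (Suc v)) (pro_stage r s v x) = pro_stage r s (Suc v) x"
      unfolding f_def by (rule rho_pro_stage[OF x Suc.prems])
    ultimately show ?case using Suc by simp
  qed
  from this[of "s - 1"] show ?thesis
    using assms(2) unfolding ProP_def f_def by (simp add: of_nat_diff algebra_simps)
qed

lemma RSK_Omega:
  assumes x: "x \<in> labelings r s" and "1 \<le> s"
  shows "Omega r s x \<in> labelings r s" "RSK r s (Omega r s x) = pro_stage r s (s - 1) x"
proof -
  have "RSK r s x \<in> labelings r s" using bij_betwE[OF bij_betw_RSK] x by blast
  then have "pro_stage r s (s - 1) x \<in> labelings r s" by (simp add: labelings_iff pro_stage_def)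
  then have mem: "pro_stage r s (s - 1) x \<in> RSK r s ` labelings r s"
    using bij_betw_imp_surj_on[OF bij_betw_RSK, of r s] by simp
  have "Omega r s x = inv_into (labelings r s) (RSK r s) (pro_stage r s (s - 1) x)"
    unfolding Omega_def by (simp add: ProP_RSK[OF assms])
  then show "Omega r s x \<in> labelings r s" "RSK r s (Omega r s x) = pro_stage r s (s - 1) x"
    using inv_into_into[OF mem] f_inv_into_f[OF mem] by simp_all
qed

section \<open>Transport of the path statistics by \<open>Omega\<close>\<close>

lemma H_eqI:
  assumes "min (u2 + 1 - 1) (v2 + 1 - v1) = min (u2' + 1 - 1) (v2' + 1 - v1')"
    and "\<And>j. 1 \<le> j \<Longrightarrow> j \<le> min u2 (v2 + 1 - v1) \<Longrightarrow> H_diff v1 u2 v2 x j = H_diff v1' u2' v2' y j"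
  shows "H 1 v1 u2 v2 x k = H 1 v1' u2' v2' y k"
proof -
  have eq: "H 1 v1 u2 v2 x j = H 1 v1' u2' v2' y j" if "j \<le> min u2 (v2 + 1 - v1)" for j
    using that
  proof (induction j)
    case 0
    then show ?case by (simp add: H_zero)
  next
    case (Suc j)
    then show ?case using assms(2)[of "Suc j"] by (simp add: H_diff_def)
  qed
  define K where "K = min k (min u2 (v2 + 1 - v1))"
  have "min k (min (u2 + 1 - 1) (v2 + 1 - v1)) = K" "min k (min (u2' + 1 - 1) (v2' + 1 - v1')) = K"
    using assms(1) by (simp_all add: K_def)
  then have "H 1 v1 u2 v2 x k = H 1 v1 u2 v2 x K" "H 1 v1' u2' v2' y k = H 1 v1' u2' v2' y K"
    using H_min[of 1 v1 u2 v2 x k] H_min[of 1 v1' u2' v2' y k] by metis+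
  moreover have "K \<le> min u2 (v2 + 1 - v1)" unfolding K_def by (rule min.cobounded2)
  ultimately show ?thesis using eq by metis
qed

text \<open>These increments are the labels on file \<open>a - s\<close>, and promotion toggles only
  files with numbers above \<open>r - s\<close>.\<close>

lemma Omega_rows:
  assumes x: "x \<in> labelings r s" and "1 \<le> s" "1 \<le> a" "a \<le> r"
  shows "H 1 1 a s (Omega r s x) k = H 1 1 a s x k"
proof (rule H_eqI)
  fix k assume k: "1 \<le> k" "k \<le> min a (s + 1 - 1)"
  have mem: "(a - k + 1, s - k + 1) \<in> rect r s" using k assms by (auto simp: rect_iff)
  have e: "min (r - (a - k + 1)) (s - (s - k + 1)) = k - 1" using k assms by auto
  have "\<not> int r - int (s - 1) \<le> int (a - k + 1) - int (s - k + 1)" using k assms by auto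
  then have "RSK r s (Omega r s x) (a - k + 1, s - k + 1) = RSK r s x (a - k + 1, s - k + 1)"
    unfolding RSK_Omega(2)[OF assms(1,2)] by (simp add: pro_stage_def)
  moreover have "a - k + 1 + (k - 1) = a" "s - k + 1 + (k - 1) = s" "k - 1 + 1 = k"
    using k by simp_all
  ultimately show "H_diff 1 a s (Omega r s x) k = H_diff 1 a s x k"
    unfolding RSK_rect[OF RSK_Omega(1)[OF assms(1,2)] mem e] RSK_rect[OF x mem e] by simp
qed simp

text \<open>The increments for the columns \<open>1..v\<close> are the labels on file
  \<open>r - v\<close>, which promotion toggles because \<open>v < s\<close>.\<close>

lemma Omega_columns:
  assumes x: "x \<in> labelings r s" and "1 \<le> v" "v < s"
  shows "H 1 1 r v (Omega r s x) k = H 1 2 r (v + 1) x k"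
proof (rule H_eqI)
  have "1 \<le> s" using assms by simp
  note O = RSK_Omega[OF x this]
  fix k assume k: "1 \<le> k" "k \<le> min r (v + 1 - 1)"
  have mem: "(r - k + 1, v - k + 1) \<in> rect r s" using k assms by (auto simp: rect_iff)
  have e: "min (r - (r - k + 1)) (s - (v - k + 1)) = k - 1" using k assms by auto
  have "int r - int (s - 1) \<le> int (r - k + 1) - int (v - k + 1)" using k assms by auto
  moreover have "v - k + 1 + (r - (r - k + 1)) + 1 = v + 1" "r - (r - k + 1) + 1 = k"
    using k by simp_all
  ultimately have "RSK r s (Omega r s x) (r - k + 1, v - k + 1) = H_diff 2 r (v + 1) x k"
    unfolding O(2) by (rule pro_stage_new[OF mem])
  moreover have "r - k + 1 + (k - 1) = r" "v - k + 1 + (k - 1) = v" "k - 1 + 1 = k"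
    using k by simp_all
  ultimately show "H_diff 1 r v (Omega r s x) k = H_diff 2 r (v + 1) x k"
    unfolding RSK_rect[OF O(1) mem e] by simp
qed simp

text \<open>\<open>H_determined\<close> moves the left end of a column interval. Transposition lets
  it act on the upper end of a row interval, starting from \<open>Omega_rows\<close>.\<close>

lemma Omega_row_intervals:
  assumes x: "x \<in> labelings r s" and "1 \<le> s" "1 \<le> u" "u + n \<le> r"
  shows "H 1 u s (u + n) (x \<circ> prod.swap) k = H 1 u s (u + n) (Omega r s x \<circ> prod.swap) k"
  using assms(3,4)
proof (induction u arbitrary: n k rule: dec_induct)
  case base
  have transpose: "H 1 1 s (1 + n) (y \<circ> prod.swap) k = H 1 1 (1 + n) s y k" for y
    by (rule H_transpose[symmetric]) (use assms(2) in simp_all)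
  show ?case unfolding transpose using Omega_rows[OF x assms(2), of "1 + n"] base by simp
next
  case (step u)
  have "H 1 (u + 1) s (u + Suc n) (x \<circ> prod.swap) k =
      H 1 (u + 1) s (u + Suc n) (Omega r s x \<circ> prod.swap) k"
  proof (rule H_determined[where N = "Suc n"])
    fix m k assume "m \<le> Suc n"
    then have "u + m \<le> r" using step.prems by simp
    then show "H 1 u s (u + m) (x \<circ> prod.swap) k = H 1 u s (u + m) (Omega r s x \<circ> prod.swap) k"
      by (rule step.IH)
  qed (use step assms(2) in simp_all)
  then show ?case by (simp add: comp_def)
qed

lemma Omega_column_intervals:
  assumes x: "x \<in> labelings r s" and "1 \<le> r" "1 \<le> u" "u + 1 + n \<le> s"
  shows "H 1 (u + 1) r (u + 1 + n) x k = H 1 u r (u + n) (Omega r s x) k"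
  using assms(3,4)
proof (induction u arbitrary: n k rule: dec_induct)
  case base
  then show ?case using Omega_columns[OF x, of "1 + n" k] by (simp add: numeral_2_eq_2)
next
  case (step u)
  have "H 1 (u + 1 + 1) r (u + 1 + Suc n) x k = H 1 (u + 1) r (u + Suc n) (Omega r s x) k"
  proof (rule H_determined[where N = "Suc n"])
    fix m k assume "m \<le> Suc n"
    then have "u + 1 + m \<le> s" using step.prems by simp
    then show "H 1 (u + 1) r (u + 1 + m) x k = H 1 u r (u + m) (Omega r s x) k"
      by (rule step.IH)
  qed (use step assms(2) in simp_all)
  then show ?case by simp
qed

theorem corollary3p7:
  fixes r s k :: nat and x :: "nat \<times> nat \<Rightarrow> real"
  assumes "1 \<le> r" and "1 \<le> s"
    and "x \<in> labelings r s"
  shows "(\<forall>u v. 1 \<le> u \<and> u \<le> v \<and> v \<le> r \<longrightarrow>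
            H u 1 v s x k = H u 1 v s (Omega r s x) k) \<and>
         (\<forall>u v. 1 < u \<and> u \<le> v \<and> v \<le> s \<longrightarrow>
            H 1 u r v x k = H 1 (u - 1) r (v - 1) (Omega r s x) k)"
proof (intro conjI allI impI; elim conjE)
  fix u v assume uv: "1 \<le> u" "u \<le> v" "v \<le> r"
  have "H u 1 v s y k = H 1 u s v (y \<circ> prod.swap) k" for y
    by (rule H_transpose) (use uv assms(2) in simp_all)
  then show "H u 1 v s x k = H u 1 v s (Omega r s x) k"
    using Omega_row_intervals[OF assms(3,2) uv(1), of "v - u" k] uv by simp
next
  fix u v assume uv: "1 < u" "u \<le> v" "v \<le> s"
  then show "H 1 u r v x k = H 1 (u - 1) r (v - 1) (Omega r s x) k"
    using Omega_column_intervals[OF assms(3,1), of "u - 1" "v - u" k] by simp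
qed

end
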